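(* Let $\Delta^{(0)},\Delta^{(1)}$ be relatively complete, FOL expressive, Gödel expressive dynamic theories with finite support that are communicating in their simple heterogeneous dynamic theory $\Delta^{sh}$ (built with some set of heterogeneous atoms). Then the fully heterogeneous dynamic theory $\Delta^{hero}=((\Delta^{sh})^h)^r$ with its proof calculus $\vdash_{\Delta^{hero}}$ is relatively complete: every $\Delta^{hero}$-valid formula is derivable from the set of $\Delta^{hero}$-valid first-order formulas.
   Context: A dynamic theory consists of pairwise disjoint sets $\mathcal V,\mathcal A,\mathcal P$; nonempty $U$; nonempty state set $S$ with $\mathrm{val}:S\times\mathcal V\to U$ satisfying interpolation (for $\mu,\nu\in S$, $W\subseteq\mathcal V$ some $\omega$ agrees with $\mu$ on $W$ and with $\nu$ off $W$); $\mathcal E_A:\mathcal A\to2^S$, $\mathrm{FV}_A$ finite-valued with states agreeing on $\mathrm{FV}_A(a)$ both in/out of $\mathcal E_A(a)$; $\mathcal E_P:\mathcal P\to2^{S\times S}$, $\mathrm{FV}_P$ finite-valued with overapproximation (for $W\supseteq\mathrm{FV}_P(p)$, $\mu=_W\nu$, $(\mu,\omega)\in\mathcal E_P(p)$ some $\tilde\omega$ has $(\nu,\tilde\omega)\in\mathcal E_P(p)$, $\omega=_W\tilde\omega$) and extensionality. Formulas $a\mid\neg F\mid F\wedge G\mid\forall vF\mid[p]F$, $\langle p\rangle=\neg[p]\neg$, Kripke semantics; first-order = no boxes; $\mathrm{Vars}(p)$ = semantic free $\cup$ bound variables. Relatively complete with calculus $\vdash$: all valid formulas derivable from the valid first-order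 formulas. Finite support, FOL expressive (infinitely many twin variables, first-order equality $\doteq$ on twins, first-order rendition $\mathrm S_p(\underline v,\underline v^+)$ equivalent to $\langle p\rangle(\underline v\doteq\underline v^+)$ for twin vectors $\underline v\supseteq\mathrm{Vars}(p)$, $\underline v^+$ disjoint), inductively expressive (w.r.t. $u2n:U\to\mathbb N$, integer expressive variables $\mathcal V_{\mathbb N}$, first-order $\mathrm{nat}_{>0},\mathrm{nat}_=,\mathrm{nat}_{+1}$) and Gödel expressive (additionally first-order $\mathrm{nat}_<$, and every variable supports Gödelization: first-order $G_v(\tilde w,n,j,\tilde v)$ decoding from a twin $\tilde w$ of some variable $w$ the $j$-th entry of any finite sequence of attainable $v$-values, of length given by $n$, into $\tilde v$) are as in the standard definitions of this framework. Simple heterogeneous theory $\Delta^{sh}$ over $\Delta^{(0)},\Delta^{(1)}$ and heterogeneous atoms $\mathcal A^c$ (evaluated on $S^{(0)}\times S^{(1)}$ satisfying atom requirements): disjoint unions of variables, atoms (plus $\mathcal A^c$), programs; universe $U^{(0)}\cup U^{(1)}$; states $S^{(0)}\times S^{(1)}$ with $\mathrm{val}((\mu_0,\mu_1),v)=\mathrm{val}^{(i)}(\mu_i,v)$ for $v\in\mathcal V^{(i)}$; atoms of $\mathcal A^{(i)}$ evaluated on the $i$-th component; programs of $\mathcal P^{(i)}$ act via $\mathcal E^{(i)}_P$ on the $i$-th component. Communicating in $\Delta^{sh}$: $\Delta^{(0)},\Delta^{(1)}$ inductively and FOL expressive, there is a map $\mathrm{nat}^{sh}_=:\mathcal V^{(0)}_{\mathbb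 N}\times\mathcal V^{(1)}_{\mathbb N}\to$ first-order $\Delta^{sh}$-formulas with $\mu\models\mathrm{nat}^{sh}_=(v,w)$ iff $u2n^{(0)}(\mathrm{val}(\mu,v))=u2n^{(1)}(\mathrm{val}(\mu,w))$, and $\Delta^{sh}$ has a first-order equality predicate $\doteq$ on all pairs of twin variables. $(\cdot)^h$ adds havoc programs $v:=*$ (relation $\mu=_{\mathcal V\setminus\{v\}}\nu$); $(\cdot)^r$ closes programs under $;$, $\cup$, first-order tests $?(\phi)$ (relation $\{(\mu,\nu):\mu\models\phi,\mu=_{\mathcal V}\nu\}$) and ${}^*$. Calculus $\vdash_{\Delta^{hero}}$: complete propositional and first-order reasoning; (G), (K), (V), (B); havoc axiom $[v:=*]\phi\leftrightarrow\forall v\phi$; regular-program axioms for $?$, $;$, ${}^*$, $\cup$ and induction $[\alpha^*](\phi\to[\alpha]\phi)\to(\phi\to[\alpha^*]\phi)$; loop convergence axiom (inherited from an inductively expressive component); and reduction rules importing derivations of $\vdash_{\Delta^{(0)}}$ and $\vdash_{\Delta^{(1)}}$ for formulas of the respective signatures (and from $\Delta^{sh}$ to its havoc lift and from there to its regular closure). *)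

theory Defs
  imports Main
begin

section \<open>Dynamic theories\<close>

text \<open>
  Variables, atoms and programs live in separate types, which makes the three syntactic categories
  disjoint.  The variables and the states of a theory are all elements of the types
  \<open>'v\<close> and \<open>'s\<close>; atoms, programs and the universe are carrier sets, because a theory may have
  no programs, a set of heterogeneous atoms may be empty, and the universes of two theories are
  united when the theories are combined.
\<close>

datatype ('v, 'a, 'p) fml =
    Atom 'a
  | Neg "('v, 'a, 'p) fml"
  | Conj "('v, 'a, 'p) fml" "('v, 'a, 'p) fml"
  | All 'v "('v, 'a, 'p) fml"
  | Box 'p "('v, 'a, 'p) fml"

abbreviation Imp :: "('v, 'a, 'p) fml \<Rightarrow> ('v, 'a, 'p) fml \<Rightarrow> ('v, 'a, 'p) fml" where
  "Imp F G \<equiv> Neg (Conj F (Neg G))"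

abbreviation Iff :: "('v, 'a, 'p) fml \<Rightarrow> ('v, 'a, 'p) fml \<Rightarrow> ('v, 'a, 'p) fml" where
  "Iff F G \<equiv> Conj (Imp F G) (Imp G F)"

abbreviation Ex :: "'v \<Rightarrow> ('v, 'a, 'p) fml \<Rightarrow> ('v, 'a, 'p) fml" where
  "Ex v F \<equiv> Neg (All v (Neg F))"

abbreviation Dia :: "'p \<Rightarrow> ('v, 'a, 'p) fml \<Rightarrow> ('v, 'a, 'p) fml" where
  "Dia p F \<equiv> Neg (Box p (Neg F))"

primrec first_order :: "('v, 'a, 'p) fml \<Rightarrow> bool" where
  "first_order (Atom a) = True"
| "first_order (Neg F) = first_order F"
| "first_order (Conj F G) = (first_order F \<and> first_order G)"
| "first_order (All v F) = first_order F"
| "first_order (Box p F) = False"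

record ('v, 'a, 'p, 'u, 's) dyn_theory =
  universe :: "'u set"
  val :: "'s \<Rightarrow> 'v \<Rightarrow> 'u"
  atoms :: "'a set"
  atom_eval :: "'a \<Rightarrow> 's set"
  atom_fv :: "'a \<Rightarrow> 'v set"
  progs :: "'p set"
  prog_rel :: "'p \<Rightarrow> ('s \<times> 's) set"
  prog_fv :: "'p \<Rightarrow> 'v set"

definition agree :: "('v, 'a, 'p, 'u, 's) dyn_theory \<Rightarrow> 'v set \<Rightarrow> 's \<Rightarrow> 's \<Rightarrow> bool" where
  "agree \<Delta> W \<mu> \<nu> \<longleftrightarrow> (\<forall>v\<in>W. val \<Delta> \<mu> v = val \<Delta> \<nu> v)"

definition dynamic_theory :: "('v, 'a, 'p, 'u, 's) dyn_theory \<Rightarrow> bool" where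
  "dynamic_theory \<Delta> \<longleftrightarrow>
     universe \<Delta> \<noteq> {} \<and>
     (\<forall>\<mu> v. val \<Delta> \<mu> v \<in> universe \<Delta>) \<and>
     \<comment> \<open>interpolation\<close>
     (\<forall>\<mu> \<nu> W. \<exists>\<omega>. agree \<Delta> W \<omega> \<mu> \<and> agree \<Delta> (- W) \<omega> \<nu>) \<and>
     (\<forall>a\<in>atoms \<Delta>. finite (atom_fv \<Delta> a) \<and>
        (\<forall>\<mu> \<nu>. agree \<Delta> (atom_fv \<Delta> a) \<mu> \<nu> \<longrightarrow>
           (\<mu> \<in> atom_eval \<Delta> a \<longleftrightarrow> \<nu> \<in> atom_eval \<Delta> a))) \<and>
     (\<forall>p\<in>progs \<Delta>. finite (prog_fv \<Delta> p) \<and>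
        \<comment> \<open>overapproximation\<close>
        (\<forall>W \<mu> \<nu> \<omega>. prog_fv \<Delta> p \<subseteq> W \<and> agree \<Delta> W \<mu> \<nu> \<and> (\<mu>, \<omega>) \<in> prog_rel \<Delta> p \<longrightarrow>
           (\<exists>\<omega>'. (\<nu>, \<omega>') \<in> prog_rel \<Delta> p \<and> agree \<Delta> W \<omega> \<omega>')) \<and>
        \<comment> \<open>extensionality\<close>
        (\<forall>\<mu> \<mu>' \<nu> \<nu>'. agree \<Delta> UNIV \<mu> \<mu>' \<and> agree \<Delta> UNIV \<nu> \<nu>' \<and> (\<mu>, \<nu>) \<in> prog_rel \<Delta> p \<longrightarrow>
           (\<mu>', \<nu>') \<in> prog_rel \<Delta> p))"

primrec wf_fml :: "('v, 'a, 'p, 'u, 's) dyn_theory \<Rightarrow> ('v, 'a, 'p) fml \<Rightarrow> bool" where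
  "wf_fml \<Delta> (Atom a) = (a \<in> atoms \<Delta>)"
| "wf_fml \<Delta> (Neg F) = wf_fml \<Delta> F"
| "wf_fml \<Delta> (Conj F G) = (wf_fml \<Delta> F \<and> wf_fml \<Delta> G)"
| "wf_fml \<Delta> (All v F) = wf_fml \<Delta> F"
| "wf_fml \<Delta> (Box p F) = (p \<in> progs \<Delta> \<and> wf_fml \<Delta> F)"

primrec sat :: "('v, 'a, 'p, 'u, 's) dyn_theory \<Rightarrow> 's \<Rightarrow> ('v, 'a, 'p) fml \<Rightarrow> bool" where
  "sat \<Delta> \<mu> (Atom a) = (\<mu> \<in> atom_eval \<Delta> a)"
| "sat \<Delta> \<mu> (Neg F) = (\<not> sat \<Delta> \<mu> F)"
| "sat \<Delta> \<mu> (Conj F G) = (sat \<Delta> \<mu> F \<and> sat \<Delta> \<mu> G)"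
| "sat \<Delta> \<mu> (All v F) = (\<forall>\<nu>. agree \<Delta> (- {v}) \<mu> \<nu> \<longrightarrow> sat \<Delta> \<nu> F)"
| "sat \<Delta> \<mu> (Box p F) = (\<forall>\<nu>. (\<mu>, \<nu>) \<in> prog_rel \<Delta> p \<longrightarrow> sat \<Delta> \<nu> F)"

definition valid :: "('v, 'a, 'p, 'u, 's) dyn_theory \<Rightarrow> ('v, 'a, 'p) fml \<Rightarrow> bool" where
  "valid \<Delta> F \<longleftrightarrow> (\<forall>\<mu>. sat \<Delta> \<mu> F)"

definition fo_fml :: "('v, 'a, 'p, 'u, 's) dyn_theory \<Rightarrow> ('v, 'a, 'p) fml \<Rightarrow> bool" where
  "fo_fml \<Delta> F \<longleftrightarrow> wf_fml \<Delta> F \<and> first_order F"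

text \<open>Free and bound variables are the semantic ones (static semantics in the style of
  differential dynamic logic), not the syntactic overapproximations \<open>atom_fv\<close> and \<open>prog_fv\<close>.\<close>

definition FV :: "('v, 'a, 'p, 'u, 's) dyn_theory \<Rightarrow> ('v, 'a, 'p) fml \<Rightarrow> 'v set" where
  "FV \<Delta> F = {v. \<exists>\<mu> \<nu>. agree \<Delta> (- {v}) \<mu> \<nu> \<and> sat \<Delta> \<mu> F \<and> \<not> sat \<Delta> \<nu> F}"

definition FVp :: "('v, 'a, 'p, 'u, 's) dyn_theory \<Rightarrow> 'p \<Rightarrow> 'v set" where
  "FVp \<Delta> p = {v. \<exists>\<mu> \<nu> \<omega>. agree \<Delta> (- {v}) \<mu> \<nu> \<and> (\<mu>, \<omega>) \<in> prog_rel \<Delta> p \<and>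
     \<not> (\<exists>\<omega>'. (\<nu>, \<omega>') \<in> prog_rel \<Delta> p \<and> agree \<Delta> (- {v}) \<omega> \<omega>')}"

definition BVp :: "('v, 'a, 'p, 'u, 's) dyn_theory \<Rightarrow> 'p \<Rightarrow> 'v set" where
  "BVp \<Delta> p = {v. \<exists>\<mu> \<nu>. (\<mu>, \<nu>) \<in> prog_rel \<Delta> p \<and> val \<Delta> \<mu> v \<noteq> val \<Delta> \<nu> v}"

definition Vars :: "('v, 'a, 'p, 'u, 's) dyn_theory \<Rightarrow> 'p \<Rightarrow> 'v set" where
  "Vars \<Delta> p = FVp \<Delta> p \<union> BVp \<Delta> p"

definition finite_support :: "('v, 'a, 'p, 'u, 's) dyn_theory \<Rightarrow> bool" where
  "finite_support \<Delta> \<longleftrightarrow> (\<forall>p\<in>progs \<Delta>. finite (Vars \<Delta> p))"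


section \<open>Expressivity\<close>

definition attainable :: "('v, 'a, 'p, 'u, 's) dyn_theory \<Rightarrow> 'v \<Rightarrow> 'u set" where
  "attainable \<Delta> v = range (\<lambda>\<mu>. val \<Delta> \<mu> v)"

definition twin :: "('v, 'a, 'p, 'u, 's) dyn_theory \<Rightarrow> 'v \<Rightarrow> 'v \<Rightarrow> bool" where
  "twin \<Delta> v w \<longleftrightarrow> attainable \<Delta> v = attainable \<Delta> w"

definition equality_predicate ::
    "('v, 'a, 'p, 'u, 's) dyn_theory \<Rightarrow> ('v \<Rightarrow> 'v \<Rightarrow> ('v, 'a, 'p) fml) \<Rightarrow> bool" where
  "equality_predicate \<Delta> eq \<longleftrightarrow>
     (\<forall>v w. twin \<Delta> v w \<longrightarrow> fo_fml \<Delta> (eq v w) \<and>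
        (\<forall>\<mu>. sat \<Delta> \<mu> (eq v w) \<longleftrightarrow> val \<Delta> \<mu> v = val \<Delta> \<mu> w))"

text \<open>The syntax has no constant for truth, so vectors are nonempty.\<close>

fun eq_vec :: "('v \<Rightarrow> 'v \<Rightarrow> ('v, 'a, 'p) fml) \<Rightarrow> 'v list \<Rightarrow> 'v list \<Rightarrow> ('v, 'a, 'p) fml" where
  "eq_vec eq [v] [w] = eq v w"
| "eq_vec eq (v # v' # vs) (w # w' # ws) = Conj (eq v w) (eq_vec eq (v' # vs) (w' # ws))"

definition twin_vectors :: "('v, 'a, 'p, 'u, 's) dyn_theory \<Rightarrow> 'v list \<Rightarrow> 'v list \<Rightarrow> bool" where
  "twin_vectors \<Delta> vs ws \<longleftrightarrow>
     vs \<noteq> [] \<and> list_all2 (twin \<Delta>) vs ws \<and> distinct vs \<and> distinct ws \<and> set vs \<inter> set ws = {}"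

definition fol_expressive :: "('v, 'a, 'p, 'u, 's) dyn_theory \<Rightarrow> bool" where
  "fol_expressive \<Delta> \<longleftrightarrow>
     (\<forall>v. infinite {w. twin \<Delta> v w}) \<and>
     (\<exists>eq. equality_predicate \<Delta> eq \<and>
        (\<forall>p\<in>progs \<Delta>. \<forall>vs ws. twin_vectors \<Delta> vs ws \<and> Vars \<Delta> p \<subseteq> set vs \<longrightarrow>
           (\<exists>S. fo_fml \<Delta> S \<and> valid \<Delta> (Iff S (Dia p (eq_vec eq vs ws))))))"

text \<open>The data witnessing inductive expressivity are kept explicit because the loop convergence
  axiom and the notion of communicating theories refer to them.  The formula \<open>nat_succ v w\<close>
  says that the number of \<open>w\<close> is the successor of the number of \<open>v\<close>.\<close>

record ('v, 'a, 'p, 'u) nat_data =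
  u2n :: "'u \<Rightarrow> nat"
  nat_vars :: "'v set"
  nat_pos :: "'v \<Rightarrow> ('v, 'a, 'p) fml"
  nat_eq :: "'v \<Rightarrow> 'v \<Rightarrow> ('v, 'a, 'p) fml"
  nat_succ :: "'v \<Rightarrow> 'v \<Rightarrow> ('v, 'a, 'p) fml"

definition inductively_expressive ::
    "('v, 'a, 'p, 'u, 's) dyn_theory \<Rightarrow> ('v, 'a, 'p, 'u) nat_data \<Rightarrow> bool" where
  "inductively_expressive \<Delta> N \<longleftrightarrow>
     infinite (nat_vars N) \<and>
     (\<forall>v\<in>nat_vars N. u2n N ` attainable \<Delta> v = UNIV) \<and>
     (\<forall>v\<in>nat_vars N. fo_fml \<Delta> (nat_pos N v) \<and>
        (\<forall>\<mu>. sat \<Delta> \<mu> (nat_pos N v) \<longleftrightarrow> 0 < u2n N (val \<Delta> \<mu> v))) \<and>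
     (\<forall>v\<in>nat_vars N. \<forall>w\<in>nat_vars N.
        fo_fml \<Delta> (nat_eq N v w) \<and>
        (\<forall>\<mu>. sat \<Delta> \<mu> (nat_eq N v w) \<longleftrightarrow> u2n N (val \<Delta> \<mu> v) = u2n N (val \<Delta> \<mu> w)) \<and>
        fo_fml \<Delta> (nat_succ N v w) \<and>
        (\<forall>\<mu>. sat \<Delta> \<mu> (nat_succ N v w) \<longleftrightarrow> u2n N (val \<Delta> \<mu> v) + 1 = u2n N (val \<Delta> \<mu> w)))"

text \<open>Positions in a sequence are counted from 1.\<close>

definition supports_goedelization ::
    "('v, 'a, 'p, 'u, 's) dyn_theory \<Rightarrow> ('v, 'a, 'p, 'u) nat_data \<Rightarrow> 'v \<Rightarrow> bool" where
  "supports_goedelization \<Delta> N v \<longleftrightarrow>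
     (\<exists>w G. \<forall>w' n j v'.
        twin \<Delta> w w' \<and> twin \<Delta> v v' \<and> n \<in> nat_vars N \<and> j \<in> nat_vars N \<and> distinct [w', n, j, v'] \<longrightarrow>
        fo_fml \<Delta> (G w' n j v') \<and>
        (\<forall>us. set us \<subseteq> attainable \<Delta> v \<longrightarrow>
           (\<exists>z\<in>attainable \<Delta> w. \<forall>\<mu>.
              val \<Delta> \<mu> w' = z \<and> u2n N (val \<Delta> \<mu> n) = length us \<and>
              1 \<le> u2n N (val \<Delta> \<mu> j) \<and> u2n N (val \<Delta> \<mu> j) \<le> length us \<longrightarrow>
              (sat \<Delta> \<mu> (G w' n j v') \<longleftrightarrow> val \<Delta> \<mu> v' = us ! (u2n N (val \<Delta> \<mu> j) - 1)))))"

definition goedel_expressive ::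
    "('v, 'a, 'p, 'u, 's) dyn_theory \<Rightarrow> ('v, 'a, 'p, 'u) nat_data \<Rightarrow> bool" where
  "goedel_expressive \<Delta> N \<longleftrightarrow>
     inductively_expressive \<Delta> N \<and>
     (\<exists>nat_less. \<forall>v\<in>nat_vars N. \<forall>w\<in>nat_vars N. fo_fml \<Delta> (nat_less v w) \<and>
        (\<forall>\<mu>. sat \<Delta> \<mu> (nat_less v w) \<longleftrightarrow> u2n N (val \<Delta> \<mu> v) < u2n N (val \<Delta> \<mu> w))) \<and>
     (\<forall>v. supports_goedelization \<Delta> N v)"


section \<open>Calculi\<close>

text \<open>A calculus relates a set of premises to the formulas derivable from it.\<close>

type_synonym ('v, 'a, 'p) calculus = "('v, 'a, 'p) fml set \<Rightarrow> ('v, 'a, 'p) fml \<Rightarrow> bool"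

definition relatively_complete ::
    "('v, 'a, 'p, 'u, 's) dyn_theory \<Rightarrow> ('v, 'a, 'p) calculus \<Rightarrow> bool" where
  "relatively_complete \<Delta> C \<longleftrightarrow>
     (\<forall>F. wf_fml \<Delta> F \<and> valid \<Delta> F \<longrightarrow> C {G. fo_fml \<Delta> G \<and> valid \<Delta> G} F)"

primrec prop_eval :: "(('v, 'a, 'p) fml \<Rightarrow> bool) \<Rightarrow> ('v, 'a, 'p) fml \<Rightarrow> bool" where
  "prop_eval I (Atom a) = I (Atom a)"
| "prop_eval I (Neg F) = (\<not> prop_eval I F)"
| "prop_eval I (Conj F G) = (prop_eval I F \<and> prop_eval I G)"
| "prop_eval I (All v F) = I (All v F)"
| "prop_eval I (Box p F) = I (Box p F)"

definition tautology :: "('v, 'a, 'p) fml \<Rightarrow> bool" where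
  "tautology F \<longleftrightarrow> (\<forall>I. prop_eval I F)"

text \<open>
  Hilbert-style propositional and first-order reasoning together with (G), (K), (V) and (B),
  extended by further axioms \<open>Ax\<close> and by imported inferences \<open>R\<close>, each consisting of a set of
  premises and a conclusion.  Atoms and programs are opaque, so there is no syntactic substitution;
  instantiating \<open>v\<close> with a twin \<open>w\<close> takes the form \<open>\<forall>v (v \<doteq> w \<longrightarrow> F)\<close>.
\<close>

inductive derives :: "('v, 'a, 'p, 'u, 's) dyn_theory \<Rightarrow> ('v, 'a, 'p) fml set \<Rightarrow>
    (('v, 'a, 'p) fml set \<times> ('v, 'a, 'p) fml) set \<Rightarrow> ('v, 'a, 'p) calculus"
  for \<Delta> :: "('v, 'a, 'p, 'u, 's) dyn_theory"
    and Ax :: "('v, 'a, 'p) fml set"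
    and R :: "(('v, 'a, 'p) fml set \<times> ('v, 'a, 'p) fml) set"
    and \<Gamma> :: "('v, 'a, 'p) fml set"
where
  premise: "F \<in> \<Gamma> \<Longrightarrow> derives \<Delta> Ax R \<Gamma> F"
| "axiom": "F \<in> Ax \<Longrightarrow> derives \<Delta> Ax R \<Gamma> F"
| "import": "(\<Phi>, F) \<in> R \<Longrightarrow> (\<And>G. G \<in> \<Phi> \<Longrightarrow> derives \<Delta> Ax R \<Gamma> G) \<Longrightarrow> derives \<Delta> Ax R \<Gamma> F"
| propositional: "wf_fml \<Delta> F \<Longrightarrow> tautology F \<Longrightarrow> derives \<Delta> Ax R \<Gamma> F"
| modus_ponens: "derives \<Delta> Ax R \<Gamma> F \<Longrightarrow> derives \<Delta> Ax R \<Gamma> (Imp F G) \<Longrightarrow> derives \<Delta> Ax R \<Gamma> G"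
| all_inst: "wf_fml \<Delta> F \<Longrightarrow> derives \<Delta> Ax R \<Gamma> (Imp (All v F) F)"
| all_distrib: "wf_fml \<Delta> F \<Longrightarrow> wf_fml \<Delta> G \<Longrightarrow>
    derives \<Delta> Ax R \<Gamma> (Imp (All v (Imp F G)) (Imp (All v F) (All v G)))"
| all_vacuous: "wf_fml \<Delta> F \<Longrightarrow> v \<notin> FV \<Delta> F \<Longrightarrow> derives \<Delta> Ax R \<Gamma> (Imp F (All v F))"
| all_gen: "derives \<Delta> Ax R \<Gamma> F \<Longrightarrow> derives \<Delta> Ax R \<Gamma> (All v F)"
| G: "p \<in> progs \<Delta> \<Longrightarrow> derives \<Delta> Ax R \<Gamma> F \<Longrightarrow> derives \<Delta> Ax R \<Gamma> (Box p F)"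
| K: "p \<in> progs \<Delta> \<Longrightarrow> wf_fml \<Delta> F \<Longrightarrow> wf_fml \<Delta> G \<Longrightarrow>
    derives \<Delta> Ax R \<Gamma> (Imp (Box p (Imp F G)) (Imp (Box p F) (Box p G)))"
| V: "p \<in> progs \<Delta> \<Longrightarrow> wf_fml \<Delta> F \<Longrightarrow> FV \<Delta> F \<inter> BVp \<Delta> p = {} \<Longrightarrow>
    derives \<Delta> Ax R \<Gamma> (Imp F (Box p F))"
| B: "p \<in> progs \<Delta> \<Longrightarrow> wf_fml \<Delta> F \<Longrightarrow> v \<notin> Vars \<Delta> p \<Longrightarrow>
    derives \<Delta> Ax R \<Gamma> (Imp (All v (Box p F)) (Box p (All v F)))"

text \<open>The reduction rule: if \<open>\<Phi>\<close> yields \<open>F\<close> in the calculus \<open>C\<close> of the theory \<open>\<Delta>\<close>, then the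
  translation of \<open>F\<close> may be inferred from the translations of the formulas in \<open>\<Phi>\<close>.\<close>

definition reduction :: "('v, 'a, 'p, 'u, 's) dyn_theory \<Rightarrow> ('v, 'a, 'p) calculus \<Rightarrow>
    (('v, 'a, 'p) fml \<Rightarrow> ('w, 'b, 'q) fml) \<Rightarrow> (('w, 'b, 'q) fml set \<times> ('w, 'b, 'q) fml) set" where
  "reduction \<Delta> C emb =
     {(emb ` \<Phi>, emb F) | \<Phi> F. (\<forall>G\<in>\<Phi>. wf_fml \<Delta> G) \<and> wf_fml \<Delta> F \<and> C \<Phi> F}"


section \<open>Simple heterogeneous theories\<close>

datatype ('a0, 'a1, 'c) het_atom = Atom0 'a0 | Atom1 'a1 | AtomC 'c

record ('v0, 'v1, 'c, 's0, 's1) het_atoms =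
  hatoms :: "'c set"
  hatom_eval :: "'c \<Rightarrow> ('s0 \<times> 's1) set"
  hatom_fv :: "'c \<Rightarrow> ('v0 + 'v1) set"

definition het_val :: "('v0, 'a0, 'p0, 'u, 's0) dyn_theory \<Rightarrow> ('v1, 'a1, 'p1, 'u, 's1) dyn_theory \<Rightarrow>
    's0 \<times> 's1 \<Rightarrow> 'v0 + 'v1 \<Rightarrow> 'u" where
  "het_val \<Delta>0 \<Delta>1 \<mu> = case_sum (val \<Delta>0 (fst \<mu>)) (val \<Delta>1 (snd \<mu>))"

definition het_atoms_ok :: "('v0, 'a0, 'p0, 'u, 's0) dyn_theory \<Rightarrow>
    ('v1, 'a1, 'p1, 'u, 's1) dyn_theory \<Rightarrow> ('v0, 'v1, 'c, 's0, 's1) het_atoms \<Rightarrow> bool" where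
  "het_atoms_ok \<Delta>0 \<Delta>1 H \<longleftrightarrow>
     (\<forall>c\<in>hatoms H. finite (hatom_fv H c) \<and>
        (\<forall>\<mu> \<nu>. (\<forall>v\<in>hatom_fv H c. het_val \<Delta>0 \<Delta>1 \<mu> v = het_val \<Delta>0 \<Delta>1 \<nu> v) \<longrightarrow>
           (\<mu> \<in> hatom_eval H c \<longleftrightarrow> \<nu> \<in> hatom_eval H c)))"

text \<open>A program of one component leaves the valuation of the other component unchanged; equality
  of the other component state would violate extensionality, since states need not be
  determined by their values.\<close>

definition simple_het :: "('v0, 'a0, 'p0, 'u, 's0) dyn_theory \<Rightarrow>
    ('v1, 'a1, 'p1, 'u, 's1) dyn_theory \<Rightarrow> ('v0, 'v1, 'c, 's0, 's1) het_atoms \<Rightarrow>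
    ('v0 + 'v1, ('a0, 'a1, 'c) het_atom, 'p0 + 'p1, 'u, 's0 \<times> 's1) dyn_theory" where
  "simple_het \<Delta>0 \<Delta>1 H =
     \<lparr> universe = universe \<Delta>0 \<union> universe \<Delta>1,
       val = het_val \<Delta>0 \<Delta>1,
       atoms = Atom0 ` atoms \<Delta>0 \<union> Atom1 ` atoms \<Delta>1 \<union> AtomC ` hatoms H,
       atom_eval = (\<lambda>a. case a of
           Atom0 b \<Rightarrow> {\<mu>. fst \<mu> \<in> atom_eval \<Delta>0 b}
         | Atom1 b \<Rightarrow> {\<mu>. snd \<mu> \<in> atom_eval \<Delta>1 b}
         | AtomC c \<Rightarrow> hatom_eval H c),
       atom_fv = (\<lambda>a. case a of
           Atom0 b \<Rightarrow> Inl ` atom_fv \<Delta>0 b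
         | Atom1 b \<Rightarrow> Inr ` atom_fv \<Delta>1 b
         | AtomC c \<Rightarrow> hatom_fv H c),
       progs = Inl ` progs \<Delta>0 \<union> Inr ` progs \<Delta>1,
       prog_rel = (\<lambda>p. case p of
           Inl q \<Rightarrow> {(\<mu>, \<nu>). (fst \<mu>, fst \<nu>) \<in> prog_rel \<Delta>0 q \<and> agree \<Delta>1 UNIV (snd \<mu>) (snd \<nu>)}
         | Inr q \<Rightarrow> {(\<mu>, \<nu>). agree \<Delta>0 UNIV (fst \<mu>) (fst \<nu>) \<and> (snd \<mu>, snd \<nu>) \<in> prog_rel \<Delta>1 q}),
       prog_fv = (\<lambda>p. case p of
           Inl q \<Rightarrow> Inl ` prog_fv \<Delta>0 q
         | Inr q \<Rightarrow> Inr ` prog_fv \<Delta>1 q) \<rparr>"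

definition emb0 :: "('v0, 'a0, 'p0) fml \<Rightarrow> ('v0 + 'v1, ('a0, 'a1, 'c) het_atom, 'p0 + 'p1) fml" where
  "emb0 = map_fml Inl Atom0 Inl"

definition emb1 :: "('v1, 'a1, 'p1) fml \<Rightarrow> ('v0 + 'v1, ('a0, 'a1, 'c) het_atom, 'p0 + 'p1) fml" where
  "emb1 = map_fml Inr Atom1 Inr"

definition simple_het_calculus :: "('v0, 'a0, 'p0, 'u, 's0) dyn_theory \<Rightarrow> ('v0, 'a0, 'p0) calculus \<Rightarrow>
    ('v1, 'a1, 'p1, 'u, 's1) dyn_theory \<Rightarrow> ('v1, 'a1, 'p1) calculus \<Rightarrow>
    ('v0, 'v1, 'c, 's0, 's1) het_atoms \<Rightarrow>
    ('v0 + 'v1, ('a0, 'a1, 'c) het_atom, 'p0 + 'p1) calculus" where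
  "simple_het_calculus \<Delta>0 C0 \<Delta>1 C1 H =
     derives (simple_het \<Delta>0 \<Delta>1 H) {} (reduction \<Delta>0 C0 emb0 \<union> reduction \<Delta>1 C1 emb1)"

definition communicating :: "('v0, 'a0, 'p0, 'u, 's0) dyn_theory \<Rightarrow> ('v0, 'a0, 'p0, 'u) nat_data \<Rightarrow>
    ('v1, 'a1, 'p1, 'u, 's1) dyn_theory \<Rightarrow> ('v1, 'a1, 'p1, 'u) nat_data \<Rightarrow>
    ('v0, 'v1, 'c, 's0, 's1) het_atoms \<Rightarrow> bool" where
  "communicating \<Delta>0 N0 \<Delta>1 N1 H \<longleftrightarrow>
     inductively_expressive \<Delta>0 N0 \<and> fol_expressive \<Delta>0 \<and>
     inductively_expressive \<Delta>1 N1 \<and> fol_expressive \<Delta>1 \<and>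
     (\<exists>nat_eq_sh. \<forall>v\<in>nat_vars N0. \<forall>w\<in>nat_vars N1.
        fo_fml (simple_het \<Delta>0 \<Delta>1 H) (nat_eq_sh v w) \<and>
        (\<forall>\<mu>. sat (simple_het \<Delta>0 \<Delta>1 H) \<mu> (nat_eq_sh v w) \<longleftrightarrow>
           u2n N0 (val (simple_het \<Delta>0 \<Delta>1 H) \<mu> (Inl v)) =
           u2n N1 (val (simple_het \<Delta>0 \<Delta>1 H) \<mu> (Inr w)))) \<and>
     (\<exists>eq. equality_predicate (simple_het \<Delta>0 \<Delta>1 H) eq)"

text \<open>The data for inductive expressivity that the combination inherits from a component;
  only variables of that component occur as arguments.\<close>

definition nat_data0 :: "('v0, 'a0, 'p0, 'u) nat_data \<Rightarrow>
    ('v0 + 'v1, ('a0, 'a1, 'c) het_atom, 'p0 + 'p1, 'u) nat_data" where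
  "nat_data0 N =
     \<lparr> u2n = u2n N,
       nat_vars = Inl ` nat_vars N,
       nat_pos = (\<lambda>v. emb0 (nat_pos N (projl v))),
       nat_eq = (\<lambda>v w. emb0 (nat_eq N (projl v) (projl w))),
       nat_succ = (\<lambda>v w. emb0 (nat_succ N (projl v) (projl w))) \<rparr>"

definition nat_data1 :: "('v1, 'a1, 'p1, 'u) nat_data \<Rightarrow>
    ('v0 + 'v1, ('a0, 'a1, 'c) het_atom, 'p0 + 'p1, 'u) nat_data" where
  "nat_data1 N =
     \<lparr> u2n = u2n N,
       nat_vars = Inr ` nat_vars N,
       nat_pos = (\<lambda>v. emb1 (nat_pos N (projr v))),
       nat_eq = (\<lambda>v w. emb1 (nat_eq N (projr v) (projr w))),
       nat_succ = (\<lambda>v w. emb1 (nat_succ N (projr v) (projr w))) \<rparr>"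


section \<open>Havoc lifting\<close>

datatype ('v, 'p) havoc_prog = Prog 'p | Havoc 'v

definition havoc :: "('v, 'a, 'p, 'u, 's) dyn_theory \<Rightarrow>
    ('v, 'a, ('v, 'p) havoc_prog, 'u, 's) dyn_theory" where
  "havoc \<Delta> =
     \<lparr> universe = universe \<Delta>,
       val = val \<Delta>,
       atoms = atoms \<Delta>,
       atom_eval = atom_eval \<Delta>,
       atom_fv = atom_fv \<Delta>,
       progs = Prog ` progs \<Delta> \<union> range Havoc,
       prog_rel = (\<lambda>p. case p of
           Prog q \<Rightarrow> prog_rel \<Delta> q
         | Havoc v \<Rightarrow> {(\<mu>, \<nu>). agree \<Delta> (- {v}) \<mu> \<nu>}),
       prog_fv = (\<lambda>p. case p of Prog q \<Rightarrow> prog_fv \<Delta> q | Havoc v \<Rightarrow> {}) \<rparr>"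

definition emb_havoc :: "('v, 'a, 'p) fml \<Rightarrow> ('v, 'a, ('v, 'p) havoc_prog) fml" where
  "emb_havoc = map_fml id id Prog"

definition havoc_axioms :: "('v, 'a, 'p, 'u, 's) dyn_theory \<Rightarrow>
    ('v, 'a, ('v, 'p) havoc_prog) fml set" where
  "havoc_axioms \<Delta> = {Iff (Box (Havoc v) F) (All v F) | v F. wf_fml (havoc \<Delta>) F}"

definition havoc_calculus :: "('v, 'a, 'p, 'u, 's) dyn_theory \<Rightarrow> ('v, 'a, 'p) calculus \<Rightarrow>
    ('v, 'a, ('v, 'p) havoc_prog) calculus" where
  "havoc_calculus \<Delta> C = derives (havoc \<Delta>) (havoc_axioms \<Delta>) (reduction \<Delta> C emb_havoc)"

definition nat_data_havoc :: "('v, 'a, 'p, 'u) nat_data \<Rightarrow>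
    ('v, 'a, ('v, 'p) havoc_prog, 'u) nat_data" where
  "nat_data_havoc N =
     \<lparr> u2n = u2n N,
       nat_vars = nat_vars N,
       nat_pos = (\<lambda>v. emb_havoc (nat_pos N v)),
       nat_eq = (\<lambda>v w. emb_havoc (nat_eq N v w)),
       nat_succ = (\<lambda>v w. emb_havoc (nat_succ N v w)) \<rparr>"


section \<open>Regular closure\<close>

datatype ('v, 'a, 'p) reg_prog =
    Base 'p
  | Test "('v, 'a, 'p) fml"
  | Seq "('v, 'a, 'p) reg_prog" "('v, 'a, 'p) reg_prog"
  | Choice "('v, 'a, 'p) reg_prog" "('v, 'a, 'p) reg_prog"
  | Star "('v, 'a, 'p) reg_prog"

primrec reg_wf :: "('v, 'a, 'p, 'u, 's) dyn_theory \<Rightarrow> ('v, 'a, 'p) reg_prog \<Rightarrow> bool" where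
  "reg_wf \<Delta> (Base p) = (p \<in> progs \<Delta>)"
| "reg_wf \<Delta> (Test \<phi>) = fo_fml \<Delta> \<phi>"
| "reg_wf \<Delta> (Seq \<alpha> \<beta>) = (reg_wf \<Delta> \<alpha> \<and> reg_wf \<Delta> \<beta>)"
| "reg_wf \<Delta> (Choice \<alpha> \<beta>) = (reg_wf \<Delta> \<alpha> \<and> reg_wf \<Delta> \<beta>)"
| "reg_wf \<Delta> (Star \<alpha>) = reg_wf \<Delta> \<alpha>"

text \<open>Zero iterations of a loop reach every state with the same values, as required by
  extensionality.\<close>

primrec reg_rel :: "('v, 'a, 'p, 'u, 's) dyn_theory \<Rightarrow> ('v, 'a, 'p) reg_prog \<Rightarrow> ('s \<times> 's) set" where
  "reg_rel \<Delta> (Base p) = prog_rel \<Delta> p"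
| "reg_rel \<Delta> (Test \<phi>) = {(\<mu>, \<nu>). sat \<Delta> \<mu> \<phi> \<and> agree \<Delta> UNIV \<mu> \<nu>}"
| "reg_rel \<Delta> (Seq \<alpha> \<beta>) = reg_rel \<Delta> \<alpha> O reg_rel \<Delta> \<beta>"
| "reg_rel \<Delta> (Choice \<alpha> \<beta>) = reg_rel \<Delta> \<alpha> \<union> reg_rel \<Delta> \<beta>"
| "reg_rel \<Delta> (Star \<alpha>) = (reg_rel \<Delta> \<alpha>)\<^sup>* O {(\<mu>, \<nu>). agree \<Delta> UNIV \<mu> \<nu>}"

primrec reg_fv :: "('v, 'a, 'p, 'u, 's) dyn_theory \<Rightarrow> ('v, 'a, 'p) reg_prog \<Rightarrow> 'v set" where
  "reg_fv \<Delta> (Base p) = prog_fv \<Delta> p"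
| "reg_fv \<Delta> (Test \<phi>) = FV \<Delta> \<phi>"
| "reg_fv \<Delta> (Seq \<alpha> \<beta>) = reg_fv \<Delta> \<alpha> \<union> reg_fv \<Delta> \<beta>"
| "reg_fv \<Delta> (Choice \<alpha> \<beta>) = reg_fv \<Delta> \<alpha> \<union> reg_fv \<Delta> \<beta>"
| "reg_fv \<Delta> (Star \<alpha>) = reg_fv \<Delta> \<alpha>"

definition regular :: "('v, 'a, 'p, 'u, 's) dyn_theory \<Rightarrow>
    ('v, 'a, ('v, 'a, 'p) reg_prog, 'u, 's) dyn_theory" where
  "regular \<Delta> =
     \<lparr> universe = universe \<Delta>,
       val = val \<Delta>,
       atoms = atoms \<Delta>,
       atom_eval = atom_eval \<Delta>,
       atom_fv = atom_fv \<Delta>,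
       progs = {\<alpha>. reg_wf \<Delta> \<alpha>},
       prog_rel = reg_rel \<Delta>,
       prog_fv = reg_fv \<Delta> \<rparr>"

definition emb_reg :: "('v, 'a, 'p) fml \<Rightarrow> ('v, 'a, ('v, 'a, 'p) reg_prog) fml" where
  "emb_reg = map_fml id id Base"

inductive_set reg_axioms :: "('v, 'a, 'p, 'u, 's) dyn_theory \<Rightarrow>
    ('v, 'a, ('v, 'a, 'p) reg_prog) fml set"
  for \<Delta> :: "('v, 'a, 'p, 'u, 's) dyn_theory"
where
  test: "fo_fml \<Delta> \<phi> \<Longrightarrow> wf_fml (regular \<Delta>) F \<Longrightarrow>
    Iff (Box (Test \<phi>) F) (Imp (emb_reg \<phi>) F) \<in> reg_axioms \<Delta>"
| seq: "reg_wf \<Delta> \<alpha> \<Longrightarrow> reg_wf \<Delta> \<beta> \<Longrightarrow> wf_fml (regular \<Delta>) F \<Longrightarrow>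
    Iff (Box (Seq \<alpha> \<beta>) F) (Box \<alpha> (Box \<beta> F)) \<in> reg_axioms \<Delta>"
| choice: "reg_wf \<Delta> \<alpha> \<Longrightarrow> reg_wf \<Delta> \<beta> \<Longrightarrow> wf_fml (regular \<Delta>) F \<Longrightarrow>
    Iff (Box (Choice \<alpha> \<beta>) F) (Conj (Box \<alpha> F) (Box \<beta> F)) \<in> reg_axioms \<Delta>"
| star: "reg_wf \<Delta> \<alpha> \<Longrightarrow> wf_fml (regular \<Delta>) F \<Longrightarrow>
    Iff (Box (Star \<alpha>) F) (Conj F (Box \<alpha> (Box (Star \<alpha>) F))) \<in> reg_axioms \<Delta>"
| induction: "reg_wf \<Delta> \<alpha> \<Longrightarrow> wf_fml (regular \<Delta>) F \<Longrightarrow>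
    Imp (Box (Star \<alpha>) (Imp F (Box \<alpha> F))) (Imp F (Box (Star \<alpha>) F)) \<in> reg_axioms \<Delta>"

text \<open>
  Loop convergence, schematically
  \<open>[\<alpha>*] \<forall>v>0 (\<phi>(v) \<longrightarrow> \<langle>\<alpha>\<rangle> \<phi>(v - 1)) \<longrightarrow> \<forall>v (\<phi>(v) \<longrightarrow> \<langle>\<alpha>*\<rangle> \<exists>v\<le>0 \<phi>(v))\<close>,
  where \<open>\<phi>(v - 1)\<close> is expressed through the natural number predicates and an auxiliary variable \<open>w\<close>.
\<close>

definition convergence_axioms :: "('v, 'a, 'p, 'u, 's) dyn_theory \<Rightarrow> ('v, 'a, 'p, 'u) nat_data \<Rightarrow>
    ('v, 'a, ('v, 'a, 'p) reg_prog) fml set" where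
  "convergence_axioms \<Delta> N =
     {Imp (Box (Star \<alpha>) (All v (Imp (Conj (emb_reg (nat_pos N v)) F)
             (Dia \<alpha> (Ex w (Conj (emb_reg (nat_succ N w v))
                (All v (Imp (emb_reg (nat_eq N v w)) F))))))))
          (All v (Imp F (Dia (Star \<alpha>) (Ex v (Conj (Neg (emb_reg (nat_pos N v))) F)))))
      | \<alpha> F v w. reg_wf \<Delta> \<alpha> \<and> wf_fml (regular \<Delta>) F \<and>
          v \<in> nat_vars N \<and> w \<in> nat_vars N \<and> v \<noteq> w \<and>
          v \<notin> Vars (regular \<Delta>) \<alpha> \<and> w \<notin> Vars (regular \<Delta>) \<alpha> \<and> w \<notin> FV (regular \<Delta>) F}"

definition regular_calculus :: "('v, 'a, 'p, 'u, 's) dyn_theory \<Rightarrow> ('v, 'a, 'p, 'u) nat_data \<Rightarrow>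
    ('v, 'a, 'p) calculus \<Rightarrow> ('v, 'a, ('v, 'a, 'p) reg_prog) calculus" where
  "regular_calculus \<Delta> N C =
     derives (regular \<Delta>) (reg_axioms \<Delta> \<union> convergence_axioms \<Delta> N) (reduction \<Delta> C emb_reg)"


section \<open>Fully heterogeneous theories\<close>

type_synonym ('v0, 'v1, 'p0, 'p1) hero_base = "('v0 + 'v1, 'p0 + 'p1) havoc_prog"

type_synonym ('v0, 'v1, 'a0, 'a1, 'c, 'p0, 'p1) hero_prog =
  "('v0 + 'v1, ('a0, 'a1, 'c) het_atom, ('v0, 'v1, 'p0, 'p1) hero_base) reg_prog"

definition hero :: "('v0, 'a0, 'p0, 'u, 's0) dyn_theory \<Rightarrow> ('v1, 'a1, 'p1, 'u, 's1) dyn_theory \<Rightarrow>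
    ('v0, 'v1, 'c, 's0, 's1) het_atoms \<Rightarrow>
    ('v0 + 'v1, ('a0, 'a1, 'c) het_atom, ('v0, 'v1, 'a0, 'a1, 'c, 'p0, 'p1) hero_prog,
     'u, 's0 \<times> 's1) dyn_theory" where
  "hero \<Delta>0 \<Delta>1 H = regular (havoc (simple_het \<Delta>0 \<Delta>1 H))"

text \<open>The argument \<open>N\<close> supplies the natural number predicates of the loop convergence axiom.\<close>

definition hero_calculus :: "('v0, 'a0, 'p0, 'u, 's0) dyn_theory \<Rightarrow> ('v0, 'a0, 'p0) calculus \<Rightarrow>
    ('v1, 'a1, 'p1, 'u, 's1) dyn_theory \<Rightarrow> ('v1, 'a1, 'p1) calculus \<Rightarrow>
    ('v0, 'v1, 'c, 's0, 's1) het_atoms \<Rightarrow>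
    ('v0 + 'v1, ('a0, 'a1, 'c) het_atom, 'p0 + 'p1, 'u) nat_data \<Rightarrow>
    ('v0 + 'v1, ('a0, 'a1, 'c) het_atom, ('v0, 'v1, 'a0, 'a1, 'c, 'p0, 'p1) hero_prog) calculus" where
  "hero_calculus \<Delta>0 C0 \<Delta>1 C1 H N =
     regular_calculus (havoc (simple_het \<Delta>0 \<Delta>1 H)) (nat_data_havoc N)
       (havoc_calculus (simple_het \<Delta>0 \<Delta>1 H) (simple_het_calculus \<Delta>0 C0 \<Delta>1 C1 H))"

end

(*
  By induction on programs, every formula [p]F with F first-order is provably equivalent to a
  first-order formula; hence so is every formula, and a valid formula follows from its valid
  first-order equivalent.  For programs of a component the first-order rendition is imported and
  transported through (K), (V) and (B) to postconditions that mention both components.  For loops,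
  reachability in n iterations is definable with one code per variable, each formed in the
  component of that variable; the communicating number predicates keep the positions in these
  codes synchronised.  The induction and convergence axioms then yield both directions.
  The component calculi need not be sound, so the semantic equivalences are carried along
  separately and are not read off from derivability.
*)
theory Submission
  imports Defs
begin

section \<open>First-order definability\<close>

text \<open>Atoms and programs are opaque and there is no substitution, so a formula cannot be
  instantiated at other variables. The proof therefore works with state predicates that some
  first-order formula defines; a value is passed to a formula by equating a bound variable with a
  twin. Three features of the semantics shape the statements. States are not determined by their
  values, so agreement on all variables has to stand in for equality of states. Semantic free
  variables control only the change of a single variable, so runs are transported only between
  states that differ in finitely many variables; this is where finite coincidence sets and finite
  support enter. A decoding formula says nothing about values that are not codes, so the description
  of a loop must be correct for every value of the code variables. On the side of the calculus, all
  valid first-order formulas are premises: a first-order implication is established by comparing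
  states, and derivations serve mainly to pass through boxes.\<close>

lemma agree_refl [simp]: "agree \<Delta> W \<mu> \<mu>"
  by (simp add: agree_def)

lemma agree_sym: "agree \<Delta> W \<mu> \<nu> \<Longrightarrow> agree \<Delta> W \<nu> \<mu>"
  by (simp add: agree_def)

lemma agree_trans: "agree \<Delta> W \<mu> \<nu> \<Longrightarrow> agree \<Delta> W \<nu> \<omega> \<Longrightarrow> agree \<Delta> W \<mu> \<omega>"
  by (simp add: agree_def)

lemma agree_mono: "agree \<Delta> W \<mu> \<nu> \<Longrightarrow> V \<subseteq> W \<Longrightarrow> agree \<Delta> V \<mu> \<nu>"
  by (auto simp: agree_def)

text \<open>Definability is a property of state predicates, so that formulas can be composed without
  being written down; a witness is extracted only where the calculus needs one.\<close>

definition definable :: "('v, 'a, 'p, 'u, 's) dyn_theory \<Rightarrow> ('s \<Rightarrow> bool) \<Rightarrow> bool" where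
  "definable \<Delta> P \<longleftrightarrow> (\<exists>F. fo_fml \<Delta> F \<and> (\<forall>\<mu>. sat \<Delta> \<mu> F = P \<mu>))"

lemma definable_sat: "fo_fml \<Delta> F \<Longrightarrow> definable \<Delta> (\<lambda>\<mu>. sat \<Delta> \<mu> F)"
  unfolding definable_def by blast

lemma definable_not: "definable \<Delta> P \<Longrightarrow> definable \<Delta> (\<lambda>\<mu>. \<not> P \<mu>)"
  unfolding definable_def by (elim exE, rule_tac x = "Neg F" in exI) (simp add: fo_fml_def)

lemma definable_conj: "definable \<Delta> P \<Longrightarrow> definable \<Delta> Q \<Longrightarrow> definable \<Delta> (\<lambda>\<mu>. P \<mu> \<and> Q \<mu>)"
  unfolding definable_def by (elim exE, rule_tac x = "Conj F Fa" in exI) (simp add: fo_fml_def)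

lemma definable_imp:
  assumes "definable \<Delta> P" "definable \<Delta> Q"
  shows "definable \<Delta> (\<lambda>\<mu>. P \<mu> \<longrightarrow> Q \<mu>)"
  using definable_not[OF definable_conj[OF assms(1) definable_not[OF assms(2)]]] by simp

lemma definable_all:
  "definable \<Delta> P \<Longrightarrow> definable \<Delta> (\<lambda>\<mu>. \<forall>\<nu>. agree \<Delta> (- {v}) \<mu> \<nu> \<longrightarrow> P \<nu>)"
  unfolding definable_def by (elim exE, rule_tac x = "All v F" in exI) (simp add: fo_fml_def)

text \<open>States and atoms only. Facts on transition relations are passed to the lemmas as
  explicit assumptions such as \<open>ext\<close>, \<open>bound\<close> and
  \<open>single\<close>.\<close>

locale fo_theory =
  fixes \<Delta> :: "('v, 'a, 'p, 'u, 's) dyn_theory"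
  assumes interpolation: "\<exists>\<omega>. agree \<Delta> W \<omega> \<mu> \<and> agree \<Delta> (- W) \<omega> \<nu>"
    and atom_finite: "a \<in> atoms \<Delta> \<Longrightarrow> finite (atom_fv \<Delta> a)"
    and atom_coincidence: "a \<in> atoms \<Delta> \<Longrightarrow> agree \<Delta> (atom_fv \<Delta> a) \<mu> \<nu> \<Longrightarrow>
      \<mu> \<in> atom_eval \<Delta> a \<longleftrightarrow> \<nu> \<in> atom_eval \<Delta> a"
begin

lemma interpolate: "\<exists>\<omega>. \<forall>x. val \<Delta> \<omega> x = (if x \<in> W then val \<Delta> \<mu> x else val \<Delta> \<nu> x)"
proof -
  obtain \<omega> where "agree \<Delta> W \<omega> \<mu>" "agree \<Delta> (- W) \<omega> \<nu>" using interpolation by blast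
  then show ?thesis by (intro exI[of _ \<omega>]) (auto simp: agree_def)
qed

text \<open>Atoms have finite coincidence sets and connectives only unite them. At a quantifier, a
  variant of \<nu> is matched by a variant of \<mu> with the same value of \<open>v\<close>, which
  interpolation provides. Finiteness of the set is what leaves fresh variables.\<close>

lemma fo_coincidence:
  assumes "fo_fml \<Delta> F"
  shows "\<exists>A. finite A \<and> (\<forall>\<mu> \<nu>. agree \<Delta> A \<mu> \<nu> \<longrightarrow> sat \<Delta> \<mu> F = sat \<Delta> \<nu> F)"
  using assms
proof (induction F)
  case (Atom a)
  then show ?case using atom_finite[of a] atom_coincidence[of a] by (auto simp: fo_fml_def)
next
  case (Neg F)
  then show ?case by (simp add: fo_fml_def)
next
  case (Conj F G)
  then obtain A B where "finite A" "finite B"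
    "\<forall>\<mu> \<nu>. agree \<Delta> A \<mu> \<nu> \<longrightarrow> sat \<Delta> \<mu> F = sat \<Delta> \<nu> F"
    "\<forall>\<mu> \<nu>. agree \<Delta> B \<mu> \<nu> \<longrightarrow> sat \<Delta> \<mu> G = sat \<Delta> \<nu> G"
    by (auto simp: fo_fml_def)
  moreover have "agree \<Delta> A \<mu> \<nu> \<and> agree \<Delta> B \<mu> \<nu>" if "agree \<Delta> (A \<union> B) \<mu> \<nu>" for \<mu> \<nu>
    using that by (auto simp: agree_def)
  ultimately show ?case by (intro exI[of _ "A \<union> B"]) (metis finite_UnI sat.simps(3))
next
  case (All v F)
  then obtain A where A: "finite A" "\<forall>\<mu> \<nu>. agree \<Delta> A \<mu> \<nu> \<longrightarrow> sat \<Delta> \<mu> F = sat \<Delta> \<nu> F"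
    by (auto simp: fo_fml_def)
  have *: "sat \<Delta> \<nu> (All v F)" if ag: "agree \<Delta> A \<mu> \<nu>" and s: "sat \<Delta> \<mu> (All v F)" for \<mu> \<nu>
  proof (simp, intro allI impI)
    fix \<nu>' assume n: "agree \<Delta> (- {v}) \<nu> \<nu>'"
    obtain \<mu>' where m: "\<forall>x. val \<Delta> \<mu>' x = (if x \<in> {v} then val \<Delta> \<nu>' x else val \<Delta> \<mu> x)"
      using interpolate[of "{v}" \<nu>' \<mu>] by blast
    then have "sat \<Delta> \<mu>' F" using s by (auto simp: agree_def)
    moreover have "agree \<Delta> A \<mu>' \<nu>'" using m n ag by (auto simp: agree_def)
    ultimately show "sat \<Delta> \<nu>' F" using A by blast
  qed
  have "sat \<Delta> \<mu> (All v F) = sat \<Delta> \<nu> (All v F)" if "agree \<Delta> A \<mu> \<nu>" for \<mu> \<nu>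
    using *[OF that] *[OF agree_sym[OF that]] by blast
  then show ?case using A(1) by blast
next
  case (Box p F)
  then show ?case by (simp add: fo_fml_def)
qed

text \<open>A variable outside a finite coincidence set cannot be semantically free. This bounds the
  variables of a test.\<close>

lemma fo_FV_finite:
  assumes "fo_fml \<Delta> F"
  shows "finite (FV \<Delta> F)"
proof -
  obtain A where A: "finite A" "\<forall>\<mu> \<nu>. agree \<Delta> A \<mu> \<nu> \<longrightarrow> sat \<Delta> \<mu> F = sat \<Delta> \<nu> F"
    using fo_coincidence[OF assms] by blast
  have "v \<in> A" if fv: "v \<in> FV \<Delta> F" for v
  proof (rule ccontr)
    assume "v \<notin> A"
    then have sub: "A \<subseteq> - {v}" by auto
    obtain \<mu> \<nu> where *: "agree \<Delta> (- {v}) \<mu> \<nu>" "sat \<Delta> \<mu> F" "\<not> sat \<Delta> \<nu> F"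
      using fv by (auto simp: FV_def)
    show False using A(2) agree_mono[OF *(1) sub] *(2,3) by blast
  qed
  then have "FV \<Delta> F \<subseteq> A" by blast
  then show ?thesis using A(1) finite_subset by metis
qed

text \<open>States with equal values may still be different states; first-order formulas cannot tell
  them apart.\<close>

lemma definable_ext: "definable \<Delta> P \<Longrightarrow> agree \<Delta> UNIV \<mu> \<nu> \<Longrightarrow> P \<mu> = P \<nu>"
proof -
  assume "definable \<Delta> P" and a: "agree \<Delta> UNIV \<mu> \<nu>"
  then obtain F where F: "fo_fml \<Delta> F" "\<forall>\<mu>. sat \<Delta> \<mu> F = P \<mu>" by (auto simp: definable_def)
  then obtain A where "\<forall>\<mu> \<nu>. agree \<Delta> A \<mu> \<nu> \<longrightarrow> sat \<Delta> \<mu> F = sat \<Delta> \<nu> F"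
    using fo_coincidence by blast
  then show ?thesis using F(2) agree_mono[OF a subset_UNIV] by blast
qed

lemma fo_ext: "fo_fml \<Delta> F \<Longrightarrow> agree \<Delta> UNIV \<mu> \<nu> \<Longrightarrow> sat \<Delta> \<mu> F = sat \<Delta> \<nu> F"
  using definable_ext definable_sat by blast

section \<open>Changing finitely many variables\<close>

lemma agree_insert_split:
  "agree \<Delta> (- insert v D) \<mu> \<omega> \<longleftrightarrow> (\<exists>\<nu>. agree \<Delta> (- {v}) \<mu> \<nu> \<and> agree \<Delta> (- D) \<nu> \<omega>)"
proof (rule iffI)
  assume a: "agree \<Delta> (- insert v D) \<mu> \<omega>"
  \<comment> \<open>The intermediate state changes only \<open>v\<close>, and already to its final
    value.\<close>
  obtain \<nu> where "\<forall>x. val \<Delta> \<nu> x = (if x \<in> {v} then val \<Delta> \<omega> x else val \<Delta> \<mu> x)"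
    using interpolate[of "{v}" \<omega> \<mu>] by blast
  then show "\<exists>\<nu>. agree \<Delta> (- {v}) \<mu> \<nu> \<and> agree \<Delta> (- D) \<nu> \<omega>"
    using a by (intro exI[of _ \<nu>]) (auto simp: agree_def)
next
  assume "\<exists>\<nu>. agree \<Delta> (- {v}) \<mu> \<nu> \<and> agree \<Delta> (- D) \<nu> \<omega>"
  then obtain \<nu> where n: "agree \<Delta> (- {v}) \<mu> \<nu>" "agree \<Delta> (- D) \<nu> \<omega>" by blast
  have "agree \<Delta> (- insert v D) \<mu> \<nu>" by (rule agree_mono[OF n(1)]) auto
  moreover have "agree \<Delta> (- insert v D) \<nu> \<omega>" by (rule agree_mono[OF n(2)]) auto
  ultimately show "agree \<Delta> (- insert v D) \<mu> \<omega>" by (rule agree_trans)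
qed

lemma definable_alls:
  assumes "finite D" "definable \<Delta> P"
  shows "definable \<Delta> (\<lambda>\<mu>. \<forall>\<nu>. agree \<Delta> (- D) \<mu> \<nu> \<longrightarrow> P \<nu>)"
  using assms
proof (induction D)
  case empty
  \<comment> \<open>An empty block still ranges over all states with the same values, hence the
    appeal to \<open>definable_ext\<close>.\<close>
  have "(\<forall>\<nu>. agree \<Delta> (- {}) \<mu> \<nu> \<longrightarrow> P \<nu>) = P \<mu>" for \<mu>
    using definable_ext[OF empty] agree_refl[of \<Delta> UNIV \<mu>] by auto
  then show ?case using empty by simp
next
  case (insert v D)
  have "(\<forall>\<omega>. agree \<Delta> (- insert v D) \<mu> \<omega> \<longrightarrow> P \<omega>) =
      (\<forall>\<nu>. agree \<Delta> (- {v}) \<mu> \<nu> \<longrightarrow> (\<forall>\<omega>. agree \<Delta> (- D) \<nu> \<omega> \<longrightarrow> P \<omega>))" for \<mu>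
    using agree_insert_split by blast
  then show ?case using definable_all[OF insert.IH[OF insert.prems], of v] by simp
qed

lemma definable_exs:
  assumes "finite D" "definable \<Delta> P"
  shows "definable \<Delta> (\<lambda>\<mu>. \<exists>\<nu>. agree \<Delta> (- D) \<mu> \<nu> \<and> P \<nu>)"
  using definable_not[OF definable_alls[OF assms(1) definable_not[OF assms(2)]]] by simp

text \<open>Nonempty, because the syntax has no constant for truth.\<close>

lemma definable_ball:
  assumes "finite X" "X \<noteq> {}" "\<And>x. x \<in> X \<Longrightarrow> definable \<Delta> (P x)"
  shows "definable \<Delta> (\<lambda>\<mu>. \<forall>x\<in>X. P x \<mu>)"
  using assms
proof (induction X rule: finite_ne_induct)
  case (insert x X)
  then show ?case using definable_conj[of \<Delta> "P x" "\<lambda>\<mu>. \<forall>x\<in>X. P x \<mu>"] by simp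
qed simp

text \<open>Interpolation sets one variable at a time; attainability supplies for each a state in
  which it has the desired value.\<close>

lemma assign:
  assumes "finite D" "\<And>y. y \<in> D \<Longrightarrow> h y \<in> attainable \<Delta> y"
  shows "\<exists>\<nu>. agree \<Delta> (- D) \<mu> \<nu> \<and> (\<forall>y\<in>D. val \<Delta> \<nu> y = h y)"
  using assms
proof (induction D)
  case empty
  show ?case by (rule exI[of _ \<mu>]) simp
next
  case (insert v D)
  then obtain \<nu> where n: "agree \<Delta> (- D) \<mu> \<nu>" "\<forall>y\<in>D. val \<Delta> \<nu> y = h y" by auto
  obtain \<rho> where r: "h v = val \<Delta> \<rho> v"
    using insert.prems[of v] by (auto simp: attainable_def)
  obtain \<omega> where "\<forall>x. val \<Delta> \<omega> x = (if x \<in> {v} then val \<Delta> \<rho> x else val \<Delta> \<nu> x)"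
    using interpolate[of "{v}" \<rho> \<nu>] by blast
  then show ?case using n r insert.hyps by (intro exI[of _ \<omega>]) (auto simp: agree_def)
qed

text \<open>\<open>FVp\<close> speaks about changes of one variable. A change on \<open>D\<close> is
  decomposed into single ones and the run is transported along them. The case of no change needs
  \<open>ext\<close>, as \<mu> and \<nu> may differ as states.\<close>

lemma finite_change:
  assumes "finite D" "agree \<Delta> (- D) \<mu> \<nu>" "(\<mu>, \<omega>) \<in> R"
    and ext: "\<And>\<mu> \<mu>' \<omega>. agree \<Delta> UNIV \<mu> \<mu>' \<Longrightarrow> (\<mu>, \<omega>) \<in> R \<Longrightarrow> (\<mu>', \<omega>) \<in> R"
    and single: "\<And>v \<mu> \<nu> \<omega>. v \<in> D \<Longrightarrow> agree \<Delta> (- {v}) \<mu> \<nu> \<Longrightarrow> (\<mu>, \<omega>) \<in> R \<Longrightarrow>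
      \<exists>\<omega>'. (\<nu>, \<omega>') \<in> R \<and> agree \<Delta> (- {v}) \<omega> \<omega>'"
  shows "\<exists>\<omega>'. (\<nu>, \<omega>') \<in> R \<and> agree \<Delta> (- D) \<omega> \<omega>'"
  using assms(1-3) single
proof (induction D arbitrary: \<mu> \<omega>)
  case empty
  then show ?case using ext[of \<mu> \<nu> \<omega>] agree_refl by auto
next
  case (insert v D)
  obtain \<mu>1 where m: "agree \<Delta> (- {v}) \<mu> \<mu>1" "agree \<Delta> (- D) \<mu>1 \<nu>"
    using insert.prems(1) agree_insert_split by blast
  obtain \<omega>1 where w: "(\<mu>1, \<omega>1) \<in> R" "agree \<Delta> (- {v}) \<omega> \<omega>1"
    using insert.prems(3)[OF _ m(1) insert.prems(2)] by blast
  obtain \<omega>2 where "(\<nu>, \<omega>2) \<in> R" "agree \<Delta> (- D) \<omega>1 \<omega>2"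
    using insert.IH[OF m(2) w(1)] insert.prems(3) by blast
  then show ?case using w(2) agree_insert_split by blast
qed

text \<open>The transport is applied to the steps in order; corresponding intermediate states always
  differ at most on \<open>D\<close>.\<close>

lemma finite_change_pow:
  assumes "finite D" "agree \<Delta> (- D) \<mu> \<nu>" "(\<mu>, \<omega>) \<in> R ^^ n"
    and ext: "\<And>\<mu> \<mu>' \<omega>. agree \<Delta> UNIV \<mu> \<mu>' \<Longrightarrow> (\<mu>, \<omega>) \<in> R \<Longrightarrow> (\<mu>', \<omega>) \<in> R"
    and single: "\<And>v \<mu> \<nu> \<omega>. v \<in> D \<Longrightarrow> agree \<Delta> (- {v}) \<mu> \<nu> \<Longrightarrow> (\<mu>, \<omega>) \<in> R \<Longrightarrow>
      \<exists>\<omega>'. (\<nu>, \<omega>') \<in> R \<and> agree \<Delta> (- {v}) \<omega> \<omega>'"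
  shows "\<exists>\<omega>'. (\<nu>, \<omega>') \<in> R ^^ n \<and> agree \<Delta> (- D) \<omega> \<omega>'"
  using assms(3)
proof (induction n arbitrary: \<omega>)
  case 0
  then show ?case using assms(2) by auto
next
  case (Suc n)
  then obtain \<mu>1 where m: "(\<mu>, \<mu>1) \<in> R ^^ n" "(\<mu>1, \<omega>) \<in> R" by auto
  obtain \<nu>1 where n: "(\<nu>, \<nu>1) \<in> R ^^ n" "agree \<Delta> (- D) \<mu>1 \<nu>1" using Suc.IH[OF m(1)] by blast
  have "\<exists>\<omega>'. (\<nu>1, \<omega>') \<in> R \<and> agree \<Delta> (- D) \<omega> \<omega>'"
    by (rule finite_change[where R = R, OF assms(1) n(2) m(2)]; rule ext single; assumption)
  then show ?case using n(1) by auto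
qed

section \<open>Fresh twins\<close>

lemma fresh_twin:
  assumes "infinite {w. twin \<Delta> v w}" "finite A"
  obtains w where "twin \<Delta> v w" "w \<notin> A"
proof -
  have "infinite ({w. twin \<Delta> v w} - A)" using assms by simp
  then show ?thesis using that infinite_imp_nonempty by blast
qed

text \<open>Each new twin also avoids those chosen earlier, which keeps the map injective.\<close>

lemma fresh_twin_map:
  assumes "\<And>x. infinite {w. twin \<Delta> (f x) w}" "finite X" "finite A"
  shows "\<exists>g. inj_on g X \<and> (\<forall>x\<in>X. twin \<Delta> (f x) (g x) \<and> g x \<notin> A)"
  using assms(2)
proof (induction X)
  case (insert x X)
  then obtain g where g: "inj_on g X" "\<forall>x\<in>X. twin \<Delta> (f x) (g x) \<and> g x \<notin> A" by blast
  obtain w where w: "twin \<Delta> (f x) w" "w \<notin> A \<union> g ` X"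
    using fresh_twin[OF assms(1)[of x], of "A \<union> g ` X"] insert.hyps assms(3) by auto
  have "inj_on (g(x := w)) (insert x X)"
    using g(1) w(2) insert.hyps(2) by (auto simp: inj_on_def)
  moreover have "\<forall>y\<in>insert x X. twin \<Delta> (f y) ((g(x := w)) y) \<and> (g(x := w)) y \<notin> A"
    using g(2) w by auto
  ultimately show ?case by blast
qed simp

end

section \<open>Bounded iteration\<close>

text \<open>\<open>definable_less\<close> will come from Goedel expressivity, the other predicates
  from inductive expressivity. Asking for definability lets embedded formulas of a component
  serve.\<close>

locale counting = fo_theory +
  fixes num :: "'c \<Rightarrow> nat" and NV :: "'a set"
  assumes NV_infinite: "infinite NV"
    and NV_onto: "v \<in> NV \<Longrightarrow> num ` attainable \<Delta> v = UNIV"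
    and definable_pos: "v \<in> NV \<Longrightarrow> definable \<Delta> (\<lambda>\<mu>. 0 < num (val \<Delta> \<mu> v))"
    and definable_num_eq: "v \<in> NV \<Longrightarrow> w \<in> NV \<Longrightarrow>
      definable \<Delta> (\<lambda>\<mu>. num (val \<Delta> \<mu> v) = num (val \<Delta> \<mu> w))"
    and definable_succ: "v \<in> NV \<Longrightarrow> w \<in> NV \<Longrightarrow>
      definable \<Delta> (\<lambda>\<mu>. num (val \<Delta> \<mu> v) + 1 = num (val \<Delta> \<mu> w))"
    and definable_less: "v \<in> NV \<Longrightarrow> w \<in> NV \<Longrightarrow>
      definable \<Delta> (\<lambda>\<mu>. num (val \<Delta> \<mu> v) < num (val \<Delta> \<mu> w))"
begin

lemma num_attained:
  assumes "v \<in> NV"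
  shows "\<exists>u\<in>attainable \<Delta> v. num u = k"
  using NV_onto[OF assms] by (metis UNIV_I imageE)

lemma fresh_NV:
  assumes "finite A"
  obtains v where "v \<in> NV" "v \<notin> A"
proof -
  have "infinite (NV - A)" using assms NV_infinite by simp
  then show ?thesis using that infinite_imp_nonempty by blast
qed

end

text \<open>
  The relation \<open>dec z n k u\<close> reads \<open>u\<close> as an entry at position \<open>k\<close> of a sequence of length \<open>n\<close>
  coded by \<open>z\<close>.  Nothing is known about it when \<open>z\<close> is not a code.
\<close>

definition sequence_decoder :: "('v, 'a, 'p, 'u, 's) dyn_theory \<Rightarrow> ('u \<Rightarrow> nat) \<Rightarrow> 'v set \<Rightarrow> 'v \<Rightarrow>
    'v \<Rightarrow> ('u \<Rightarrow> nat \<Rightarrow> nat \<Rightarrow> 'u \<Rightarrow> bool) \<Rightarrow> 'v set \<Rightarrow> bool" where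
  "sequence_decoder \<Delta> num NV x w dec A \<longleftrightarrow> finite A \<and>
     (\<forall>g c d. twin \<Delta> w g \<longrightarrow> g \<notin> A \<longrightarrow> c \<in> NV - A \<longrightarrow> d \<in> NV - A \<longrightarrow>
       definable \<Delta> (\<lambda>\<mu>. dec (val \<Delta> \<mu> g) (num (val \<Delta> \<mu> c)) (num (val \<Delta> \<mu> d)) (val \<Delta> \<mu> x))) \<and>
     (\<forall>us. set us \<subseteq> attainable \<Delta> x \<longrightarrow> (\<exists>z\<in>attainable \<Delta> w. \<forall>k u.
       1 \<le> k \<and> k \<le> length us \<and> u \<in> attainable \<Delta> x \<longrightarrow> (dec z (length us) k u \<longleftrightarrow> u = us ! (k - 1))))"

text \<open>All codes are read with length and position variables from the one set
  \<open>NV\<close>, whatever component the coded variable belongs to; this keeps the codes of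
  different variables in step. The set \<open>A\<close> lists the variables that the decoding
  formula occupies and that its arguments must avoid.\<close>

locale sequence_coding = counting +
  assumes twins_infinite: "infinite {w. twin \<Delta> v w}"
    and coding: "\<exists>w dec A. sequence_decoder \<Delta> num NV x w dec A"
begin

text \<open>
  A run of \<open>m\<close> steps is witnessed by one code per relevant variable.  The entries of a non-code
  need not be unique, so the formula demands that \<^emph>\<open>every\<close> state matching the codes at
  position \<open>k\<close> has a successor matching them at position \<open>k + 1\<close>.
\<close>

lemma definable_iterate:
  fixes R :: "('e \<times> 'e) set"
  assumes X: "finite X" "X \<noteq> {}"
    and ext: "\<And>\<mu> \<mu>' \<omega>. agree \<Delta> UNIV \<mu> \<mu>' \<Longrightarrow> (\<mu>, \<omega>) \<in> R \<Longrightarrow> (\<mu>', \<omega>) \<in> R"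
    and bound: "\<And>\<mu> \<omega>. (\<mu>, \<omega>) \<in> R \<Longrightarrow> agree \<Delta> (- X) \<mu> \<omega>"
    and single: "\<And>v \<mu> \<nu> \<omega>. v \<notin> X \<Longrightarrow> agree \<Delta> (- {v}) \<mu> \<nu> \<Longrightarrow> (\<mu>, \<omega>) \<in> R \<Longrightarrow>
      \<exists>\<omega>'. (\<nu>, \<omega>') \<in> R \<and> agree \<Delta> (- {v}) \<omega> \<omega>'"
    and dia: "\<And>P. definable \<Delta> P \<Longrightarrow> definable \<Delta> (\<lambda>\<mu>. \<exists>\<omega>. (\<mu>, \<omega>) \<in> R \<and> P \<omega>)"
    and Q: "definable \<Delta> Q" "\<And>\<mu> \<nu>. agree \<Delta> X \<mu> \<nu> \<Longrightarrow> Q \<mu> = Q \<nu>"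
    and v: "v \<in> NV" "v \<notin> X"
  shows "definable \<Delta> (\<lambda>\<mu>. \<exists>\<omega>. (\<mu>, \<omega>) \<in> R ^^ num (val \<Delta> \<mu> v) \<and> Q \<omega>)"
proof -
  obtain w dec A where code: "\<And>x. sequence_decoder \<Delta> num NV x (w x) (dec x) (A x)"
    using coding by metis
  have fin: "finite (A x)" for x using code[of x] by (simp add: sequence_decoder_def)
  have dec_def: "definable \<Delta> (\<lambda>\<mu>. dec x (val \<Delta> \<mu> g) (num (val \<Delta> \<mu> c)) (num (val \<Delta> \<mu> d)) (val \<Delta> \<mu> x))"
    if "twin \<Delta> (w x) g" "g \<notin> A x" "c \<in> NV - A x" "d \<in> NV - A x" for x g c d
    using code[of x] that unfolding sequence_decoder_def by blast
  define B where "B = X \<union> {v} \<union> \<Union> (A ` X)"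
  have B: "finite B" using X fin by (simp add: B_def)
  \<comment> \<open>\<open>c\<close> will hold the length, \<open>d\<close> the current position,
    \<open>e\<close> the position after it, and \<open>g x\<close> the code for \<open>x\<close>.
    Avoiding \<open>B\<close> keeps them away from \<open>X\<close>, from \<open>v\<close> and from
    the variables of the decoders.\<close>
  obtain c where c: "c \<in> NV" "c \<notin> B" using fresh_NV[OF B] .
  obtain d where d: "d \<in> NV" "d \<notin> insert c B" using fresh_NV[of "insert c B"] B by blast
  obtain e where e: "e \<in> NV" "e \<notin> insert d (insert c B)"
    using fresh_NV[of "insert d (insert c B)"] B by blast
  obtain g where g: "inj_on g X" "\<forall>x\<in>X. twin \<Delta> (w x) (g x) \<and> g x \<notin> insert e (insert d (insert c B))"
    using fresh_twin_map[OF twins_infinite X(1), of "insert e (insert d (insert c B))" w] B by blast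
  define n where "n \<mu> x = num (val \<Delta> \<mu> x)" for \<mu> x
  define cur where "cur \<omega> k = (\<forall>x\<in>X. dec x (val \<Delta> \<omega> (g x)) (n \<omega> c) k (val \<Delta> \<omega> x))" for \<omega> k
  have cur_cong: "cur \<omega> k = cur \<omega>' k" if "agree \<Delta> (insert c (X \<union> g ` X)) \<omega> \<omega>'" for \<omega> \<omega>' k
    using that by (auto simp: cur_def n_def agree_def)
  have def_cur: "definable \<Delta> (\<lambda>\<omega>. cur \<omega> (n \<omega> f))" if "f \<in> NV" "f \<notin> B" for f
    unfolding cur_def n_def
    by (rule definable_ball[OF X]) (use that g(2) c in \<open>auto intro!: dec_def simp: B_def\<close>)
  \<comment> \<open>There is no successor term, so \<open>e\<close> is bound to the successor of
    \<open>d\<close>.\<close>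
  have def_cur_Suc: "definable \<Delta> (\<lambda>\<omega>. cur \<omega> (n \<omega> d + 1))"
  proof -
    have "cur \<omega> (n \<omega> d + 1) \<longleftrightarrow>
      (\<exists>\<nu>. agree \<Delta> (- {e}) \<omega> \<nu> \<and> n \<nu> d + 1 = n \<nu> e \<and> cur \<nu> (n \<nu> e))" for \<omega>
    proof -
      have 1: "cur \<nu> k = cur \<omega> k \<and> n \<nu> d = n \<omega> d" if "agree \<Delta> (- {e}) \<omega> \<nu>" for \<nu> k
        using cur_cong[of \<omega> \<nu> k] that e g(2) unfolding B_def agree_def n_def by auto
      obtain u where u: "u \<in> attainable \<Delta> e" "num u = n \<omega> d + 1" using num_attained e by blast
      obtain \<nu> where "agree \<Delta> (- {e}) \<omega> \<nu>" "val \<Delta> \<nu> e = u"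
        using assign[of "{e}" "\<lambda>_. u" \<omega>] u by auto
      then show ?thesis using 1 u by (metis n_def)
    qed
    moreover have "definable \<Delta> (\<lambda>\<nu>. n \<nu> d + 1 = n \<nu> e \<and> cur \<nu> (n \<nu> e))"
      using definable_conj[OF definable_succ def_cur] d e unfolding n_def by auto
    ultimately show ?thesis using definable_exs[of "{e}"] by simp
  qed
  \<comment> \<open>The number 1 is reached as the successor of a \<open>d\<close> bound to 0, the
    one number that positivity isolates.\<close>
  have def_cur_1: "definable \<Delta> (\<lambda>\<omega>. cur \<omega> 1)"
  proof -
    have "cur \<omega> 1 \<longleftrightarrow> (\<exists>\<nu>. agree \<Delta> (- {d}) \<omega> \<nu> \<and> \<not> 0 < n \<nu> d \<and> cur \<nu> (n \<nu> d + 1))" for \<omega>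
    proof -
      have 1: "cur \<nu> k = cur \<omega> k" if "agree \<Delta> (- {d}) \<omega> \<nu>" for \<nu> k
        using cur_cong[of \<omega> \<nu> k] that d g(2) unfolding B_def agree_def n_def by auto
      obtain u where u: "u \<in> attainable \<Delta> d" "num u = 0" using num_attained d by blast
      obtain \<nu> where "agree \<Delta> (- {d}) \<omega> \<nu>" "val \<Delta> \<nu> d = u"
        using assign[of "{d}" "\<lambda>_. u" \<omega>] u by auto
      then show ?thesis using 1 u by (metis n_def add_0 neq0_conv)
    qed
    moreover have "definable \<Delta> (\<lambda>\<nu>. \<not> 0 < n \<nu> d \<and> cur \<nu> (n \<nu> d + 1))"
      using definable_conj[OF definable_not[OF definable_pos] def_cur_Suc] d unfolding n_def by auto
    ultimately show ?thesis using definable_exs[of "{d}"] by simp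
  qed
  \<comment> \<open>The guard restricts \<open>d\<close> to 1, ..., m when the length
    \<open>c\<close> is m + 1. Steps of \<open>R\<close> do not change \<open>d\<close>, as it lies
    outside \<open>X\<close>.\<close>
  define step where "step \<omega> \<longleftrightarrow> (0 < n \<omega> d \<and> n \<omega> d < n \<omega> c \<and> cur \<omega> (n \<omega> d) \<longrightarrow>
      (\<exists>\<omega>'. (\<omega>, \<omega>') \<in> R \<and> cur \<omega>' (n \<omega>' d + 1)))" for \<omega>
  have def_step: "definable \<Delta> step"
    unfolding step_def using d c
    by (auto intro!: definable_imp definable_conj dia def_cur_Suc[simplified] def_cur
        definable_pos[folded n_def] definable_less[folded n_def])
  \<comment> \<open>A run of m steps visits m + 1 states, so the length exceeds the value of
    \<open>v\<close> by one, and the last position is the length itself.\<close>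
  define Phi where "Phi \<nu> \<longleftrightarrow> n \<nu> v + 1 = n \<nu> c \<and> cur \<nu> 1 \<and>
      (\<forall>\<omega>. agree \<Delta> (- insert d X) \<nu> \<omega> \<longrightarrow> step \<omega>) \<and>
      (\<forall>\<omega>. agree \<Delta> (- X) \<nu> \<omega> \<longrightarrow> (cur \<omega> (n \<omega> c) \<longrightarrow> Q \<omega>))" for \<nu>
  have def_Phi: "definable \<Delta> Phi"
    unfolding Phi_def using X c v(1)
    by (auto intro!: definable_conj definable_alls definable_imp def_step def_cur def_cur_1[simplified] Q(1)
        definable_succ[folded n_def, simplified])
  define D where "D = insert c (g ` X)"
  have D: "finite D" "D \<inter> X = {}" "v \<notin> D" using X c g(2) by (auto simp: D_def B_def)
  \<comment> \<open>Neither codes nor counters lie in \<open>X\<close>, so resetting them does not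
    disturb a run.\<close>
  have change_pow: "\<exists>\<omega>'. (\<nu>, \<omega>') \<in> R ^^ m \<and> agree \<Delta> (- D') \<omega> \<omega>'"
    if "finite D'" "D' \<inter> X = {}" "agree \<Delta> (- D') \<mu> \<nu>" "(\<mu>, \<omega>) \<in> R ^^ m" for D' \<mu> \<nu> \<omega> m
    by (rule finite_change_pow[OF that(1,3,4)], rule ext, assumption, assumption,
        rule single, use that(2) in auto)
  have "(\<exists>\<omega>. (\<mu>, \<omega>) \<in> R ^^ n \<mu> v \<and> Q \<omega>) \<longleftrightarrow> (\<exists>\<nu>. agree \<Delta> (- D) \<mu> \<nu> \<and> Phi \<nu>)" for \<mu>
  proof
    assume "\<exists>\<nu>. agree \<Delta> (- D) \<mu> \<nu> \<and> Phi \<nu>"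
    then obtain \<nu> where ag: "agree \<Delta> (- D) \<mu> \<nu>" and Phi: "Phi \<nu>" by blast
    have nv: "n \<nu> v = n \<mu> v" using ag D(3) by (simp add: agree_def n_def)
    have nc: "n \<nu> c = n \<mu> v + 1" using Phi nv by (simp add: Phi_def)
    \<comment> \<open>After \<open>i\<close> steps the state matches position \<open>i + 1\<close>.
      To use \<open>step\<close>, \<open>d\<close> is first set to that position; since
      \<open>d\<close> lies outside \<open>X\<close>, the step is then transported back to the state
      with the old \<open>d\<close>.\<close>
    have "i \<le> n \<mu> v \<Longrightarrow> \<exists>\<omega>. (\<nu>, \<omega>) \<in> R ^^ i \<and> agree \<Delta> (- X) \<nu> \<omega> \<and> cur \<omega> (i + 1)" for i
    proof (induction i)
      case 0
      then show ?case using Phi by (intro exI[of _ \<nu>]) (simp add: Phi_def)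
    next
      case (Suc i)
      then obtain \<omega> where w: "(\<nu>, \<omega>) \<in> R ^^ i" "agree \<Delta> (- X) \<nu> \<omega>" "cur \<omega> (i + 1)" by auto
      obtain u where u: "u \<in> attainable \<Delta> d" "num u = i + 1" using num_attained d by blast
      obtain \<omega>1 where w1: "agree \<Delta> (- {d}) \<omega> \<omega>1" "val \<Delta> \<omega>1 d = u"
        using assign[of "{d}" "\<lambda>_. u" \<omega>] u by auto
      have nd: "n \<omega>1 d = i + 1" using u w1 by (simp add: n_def)
      have "agree \<Delta> (- insert d X) \<nu> \<omega>1" using w(2) w1(1) by (auto simp: agree_def)
      then have "step \<omega>1" using Phi by (simp add: Phi_def)
      moreover have "cur \<omega>1 (i + 1)"
      proof -
        have "agree \<Delta> (insert c (X \<union> g ` X)) \<omega> \<omega>1"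
          by (rule agree_mono[OF w1(1)]) (use d g(2) in \<open>auto simp: B_def\<close>)
        then show ?thesis using cur_cong w(3) by blast
      qed
      moreover have "n \<omega>1 c = n \<mu> v + 1"
        using nc w(2) w1(1) c d by (auto simp: agree_def n_def B_def)
      ultimately obtain \<omega>2 where w2: "(\<omega>1, \<omega>2) \<in> R" "cur \<omega>2 (n \<omega>2 d + 1)"
        using Suc.prems nd by (auto simp: step_def)
      have "d \<notin> X" using d by (simp add: B_def)
      then have "n \<omega>2 d = n \<omega>1 d" using bound[OF w2(1)] by (simp add: agree_def n_def)
      then have c2: "cur \<omega>2 (Suc i + 1)" using w2(2) nd by simp
      obtain \<omega>3 where w3: "(\<omega>, \<omega>3) \<in> R" "agree \<Delta> (- {d}) \<omega>2 \<omega>3"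
        using single[OF \<open>d \<notin> X\<close> agree_sym[OF w1(1)] w2(1)] by blast
      have "agree \<Delta> (insert c (X \<union> g ` X)) \<omega>2 \<omega>3"
        by (rule agree_mono[OF w3(2)]) (use d g(2) in \<open>auto simp: B_def\<close>)
      then have "cur \<omega>3 (Suc i + 1)" using cur_cong c2 by blast
      moreover have "(\<nu>, \<omega>3) \<in> R ^^ Suc i" using w(1) w3(1) by auto
      moreover have "agree \<Delta> (- X) \<nu> \<omega>3" using agree_trans[OF w(2) bound[OF w3(1)]] .
      ultimately show ?case by blast
    qed
    then obtain \<omega> where w: "(\<nu>, \<omega>) \<in> R ^^ n \<mu> v" "agree \<Delta> (- X) \<nu> \<omega>" "cur \<omega> (n \<mu> v + 1)"
      by blast
    have "n \<omega> c = n \<mu> v + 1" using nc w(2) c by (auto simp: agree_def n_def B_def)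
    then have "Q \<omega>" using Phi w by (simp add: Phi_def)
    \<comment> \<open>Back from \<nu> to \<mu>: the two differ only in the codes and the
      length.\<close>
    moreover obtain \<omega>' where w': "(\<mu>, \<omega>') \<in> R ^^ n \<mu> v" "agree \<Delta> (- D) \<omega> \<omega>'"
      using change_pow[OF D(1,2) agree_sym[OF ag] w(1)] by blast
    moreover have "agree \<Delta> X \<omega> \<omega>'" by (rule agree_mono[OF w'(2)]) (use D(2) in auto)
    ultimately show "\<exists>\<omega>. (\<mu>, \<omega>) \<in> R ^^ n \<mu> v \<and> Q \<omega>" using Q(2) by blast
  next
    assume "\<exists>\<omega>. (\<mu>, \<omega>) \<in> R ^^ n \<mu> v \<and> Q \<omega>"
    then obtain f where f: "f 0 = \<mu>" "Q (f (n \<mu> v))" "\<And>i. i < n \<mu> v \<Longrightarrow> (f i, f (Suc i)) \<in> R"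
      unfolding relpow_fun_conv by auto
    \<comment> \<open>Entry \<open>i\<close> of the list, counted from 0, is position
      \<open>i + 1\<close> of the code.\<close>
    define us where "us x = map (\<lambda>i. val \<Delta> (f i) x) [0..<n \<mu> v + 1]" for x
    have len: "length (us x) = n \<mu> v + 1" for x by (simp add: us_def)
    have "set (us x) \<subseteq> attainable \<Delta> x" for x by (auto simp: us_def attainable_def)
    then have "\<exists>z\<in>attainable \<Delta> (w x). \<forall>k u. 1 \<le> k \<and> k \<le> n \<mu> v + 1 \<and> u \<in> attainable \<Delta> x \<longrightarrow>
        (dec x z (n \<mu> v + 1) k u \<longleftrightarrow> u = us x ! (k - 1))" for x
      using code[of x] len[of x] unfolding sequence_decoder_def by metis
    then obtain z where z: "\<And>x. z x \<in> attainable \<Delta> (w x)"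
      "\<And>x k u. 1 \<le> k \<Longrightarrow> k \<le> n \<mu> v + 1 \<Longrightarrow> u \<in> attainable \<Delta> x \<Longrightarrow>
        dec x (z x) (n \<mu> v + 1) k u \<longleftrightarrow> u = us x ! (k - 1)"
      by metis
    obtain m where m: "m \<in> attainable \<Delta> c" "num m = n \<mu> v + 1" using num_attained c by blast
    define h where "h y = (if y = c then m else z (the_inv_into X g y))" for y
    have hg: "h (g x) = z x" if "x \<in> X" for x
      using that g by (auto simp: h_def the_inv_into_f_f)
    have "h y \<in> attainable \<Delta> y" if "y \<in> D" for y
    proof (cases "y = c")
      case False
      then obtain x where x: "x \<in> X" "y = g x" using \<open>y \<in> D\<close> by (auto simp: D_def)
      then show ?thesis using hg z(1)[of x] g(2) by (auto simp: twin_def)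
    qed (simp add: h_def m)
    then obtain \<nu> where nu: "agree \<Delta> (- D) \<mu> \<nu>" "\<forall>y\<in>D. val \<Delta> \<nu> y = h y"
      using assign[OF D(1)] by blast
    have gval: "val \<Delta> \<nu> (g x) = z x" if "x \<in> X" for x using nu(2) hg that by (simp add: D_def)
    have cval: "n \<nu> c = n \<mu> v + 1" using nu(2) m by (simp add: D_def h_def n_def)
    \<comment> \<open>Entries of genuine codes are unique, so matching position \<open>k\<close>
      means carrying the values of state \<open>k - 1\<close> of the run.\<close>
    have cur_iff: "cur \<omega> k \<longleftrightarrow> agree \<Delta> X (f (k - 1)) \<omega>"
      if "agree \<Delta> D \<nu> \<omega>" "1 \<le> k" "k \<le> n \<mu> v + 1" for \<omega> k
    proof -
      have "dec x (val \<Delta> \<omega> (g x)) (n \<omega> c) k (val \<Delta> \<omega> x) \<longleftrightarrow> val \<Delta> \<omega> x = val \<Delta> (f (k - 1)) x"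
        if x: "x \<in> X" for x
      proof -
        have "val \<Delta> \<omega> (g x) = z x" "n \<omega> c = n \<mu> v + 1"
          using \<open>agree \<Delta> D \<nu> \<omega>\<close> x gval cval by (auto simp: agree_def D_def n_def)
        moreover have "val \<Delta> \<omega> x \<in> attainable \<Delta> x" by (auto simp: attainable_def)
        moreover have "us x ! (k - 1) = val \<Delta> (f (k - 1)) x"
          unfolding us_def using \<open>1 \<le> k\<close> \<open>k \<le> n \<mu> v + 1\<close> by (subst nth_map) (auto simp del: upt_Suc)
        ultimately show ?thesis using z(2)[OF \<open>1 \<le> k\<close> \<open>k \<le> n \<mu> v + 1\<close>] by auto
      qed
      then show ?thesis by (auto simp: cur_def agree_def)
    qed
    have fX: "agree \<Delta> (- X) \<mu> (f i)" if "i \<le> n \<mu> v" for i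
      using that
    proof (induction i)
      case (Suc i)
      then have "agree \<Delta> (- X) \<mu> (f i)" by auto
      then show ?case using agree_trans[OF _ bound[OF f(3)]] Suc.prems by auto
    qed (simp add: f(1))
    have "Phi \<nu>"
      unfolding Phi_def
    proof (intro conjI allI impI)
      show "n \<nu> v + 1 = n \<nu> c" using cval nu(1) D(3) by (simp add: agree_def n_def)
      show "cur \<nu> 1"
        using cur_iff[of \<nu> 1] nu(1) f(1) D(2) by (auto simp: agree_def)
    next
      fix \<omega> assume w: "agree \<Delta> (- insert d X) \<nu> \<omega>"
      have dD: "d \<notin> D" using d g(2) by (auto simp: D_def B_def)
      have wD: "agree \<Delta> D \<nu> \<omega>" by (rule agree_mono[OF w]) (use D(2) dD in auto)
      have wc: "n \<omega> c = n \<mu> v + 1" using wD cval by (simp add: agree_def n_def D_def)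
      show "step \<omega>"
        unfolding step_def
      proof (intro impI, elim conjE)
        assume k: "0 < n \<omega> d" "n \<omega> d < n \<omega> c" and "cur \<omega> (n \<omega> d)"
        define k where "k = n \<omega> d - 1"
        have k': "n \<omega> d = Suc k" "k < n \<mu> v" using k wc by (auto simp: k_def)
        have 1: "agree \<Delta> X (f k) \<omega>" using cur_iff[OF wD, of "Suc k"] k' \<open>cur \<omega> (n \<omega> d)\<close> by simp
        have 2: "agree \<Delta> (- X) \<mu> (f k)" using fX k'(2) by simp
        \<comment> \<open>On \<open>X\<close> the two states agree through the codes, elsewhere
          because the run has changed nothing there; only \<open>d\<close>, the length and the codes
          may differ.\<close>
        have "agree \<Delta> (- insert d D) (f k) \<omega>"
          unfolding agree_def
        proof
          fix y assume y: "y \<in> - insert d D"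
          show "val \<Delta> (f k) y = val \<Delta> \<omega> y"
          proof (cases "y \<in> X")
            case True
            then show ?thesis using 1 by (simp add: agree_def)
          next
            case False
            have "val \<Delta> \<mu> y = val \<Delta> (f k) y" using 2 False by (simp add: agree_def)
            moreover have "val \<Delta> \<mu> y = val \<Delta> \<nu> y" using nu(1) y by (simp add: agree_def)
            moreover have "val \<Delta> \<nu> y = val \<Delta> \<omega> y" using w y False by (simp add: agree_def)
            ultimately show ?thesis by simp
          qed
        qed
        moreover have "finite (insert d D)" "insert d D \<inter> X = {}" using D d by (auto simp: B_def)
        \<comment> \<open>One step is written as a power so that \<open>change_pow\<close>
          applies.\<close>
        moreover have "(f k, f (Suc k)) \<in> R ^^ 1" using f(3) k'(2) by simp
        ultimately have "\<exists>\<omega>'. (\<omega>, \<omega>') \<in> R ^^ 1 \<and> agree \<Delta> (- insert d D) (f (Suc k)) \<omega>'"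
          by (intro change_pow)
        then obtain \<omega>' where w': "(\<omega>, \<omega>') \<in> R" "agree \<Delta> (- insert d D) (f (Suc k)) \<omega>'"
          unfolding relpow_1 by blast
        have b: "agree \<Delta> (- X) \<omega> \<omega>'" using bound[OF w'(1)] .
        have "agree \<Delta> D \<omega> \<omega>'" by (rule agree_mono[OF b]) (use D(2) in auto)
        then have "agree \<Delta> D \<nu> \<omega>'" by (rule agree_trans[OF wD])
        moreover have "n \<omega>' d = Suc k" using b k' d by (simp add: agree_def n_def B_def)
        moreover have "agree \<Delta> X (f (Suc k)) \<omega>'"
          by (rule agree_mono[OF w'(2)]) (use \<open>insert d D \<inter> X = {}\<close> in auto)
        ultimately have "cur \<omega>' (n \<omega>' d + 1)" using cur_iff[of \<omega>' "Suc k + 1"] k'(2) by simp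
        then show "\<exists>\<omega>'. (\<omega>, \<omega>') \<in> R \<and> cur \<omega>' (n \<omega>' d + 1)" using w'(1) by blast
      qed
    next
      fix \<omega> assume w: "agree \<Delta> (- X) \<nu> \<omega>" and cw: "cur \<omega> (n \<omega> c)"
      have wD: "agree \<Delta> D \<nu> \<omega>" by (rule agree_mono[OF w]) (use D(2) in auto)
      then have "n \<omega> c = n \<mu> v + 1" using cval by (simp add: agree_def n_def D_def)
      then have "agree \<Delta> X (f (n \<mu> v)) \<omega>" using cur_iff[OF wD, of "n \<mu> v + 1"] cw by simp
      then show "Q \<omega>" using Q(2) f(2) by blast
    qed
    then show "\<exists>\<nu>. agree \<Delta> (- D) \<mu> \<nu> \<and> Phi \<nu>" using nu(1) by blast
  qed
  then show ?thesis using definable_exs[OF D(1) def_Phi] by (simp add: n_def)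
qed

end

section \<open>Derivations relative to the valid first-order formulas\<close>

definition alls :: "'v list \<Rightarrow> ('v, 'a, 'p) fml \<Rightarrow> ('v, 'a, 'p) fml" where
  "alls vs F = foldr All vs F"

lemma alls_Nil [simp]: "alls [] F = F"
  by (simp add: alls_def)

lemma alls_Cons [simp]: "alls (v # vs) F = All v (alls vs F)"
  by (simp add: alls_def)

lemma wf_alls [simp]: "wf_fml \<Delta> (alls vs F) = wf_fml \<Delta> F"
  by (induction vs) auto

lemma first_order_alls [simp]: "first_order (alls vs F) = first_order F"
  by (induction vs) auto

text \<open>If \<open>v\<close> is free in neither \<open>p\<close> nor \<open>F\<close>, a run from
  \<nu> that violates \<open>F\<close> is matched by one from \<mu> whose end state differs only at
  \<open>v\<close> and violates \<open>F\<close> too.\<close>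

lemma FV_Box: "FV \<Delta> (Box p F) \<subseteq> FVp \<Delta> p \<union> FV \<Delta> F"
proof
  fix v assume "v \<in> FV \<Delta> (Box p F)"
  then obtain \<mu> \<nu> \<omega> where *: "agree \<Delta> (- {v}) \<mu> \<nu>" "sat \<Delta> \<mu> (Box p F)" "(\<nu>, \<omega>) \<in> prog_rel \<Delta> p" "\<not> sat \<Delta> \<omega> F"
    by (auto simp: FV_def)
  show "v \<in> FVp \<Delta> p \<union> FV \<Delta> F"
  proof (rule ccontr)
    assume v: "v \<notin> FVp \<Delta> p \<union> FV \<Delta> F"
    have "\<exists>\<omega>'. (\<mu>, \<omega>') \<in> prog_rel \<Delta> p \<and> agree \<Delta> (- {v}) \<omega> \<omega>'"
      using v *(3) agree_sym[OF *(1)] unfolding FVp_def by blast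
    then obtain \<omega>' where w: "(\<mu>, \<omega>') \<in> prog_rel \<Delta> p" "agree \<Delta> (- {v}) \<omega> \<omega>'" by blast
    then have "sat \<Delta> \<omega>' F" using *(2) by simp
    then have "sat \<Delta> \<omega> F" using v agree_sym[OF w(2)] unfolding FV_def by blast
    then show False using *(4) by simp
  qed
qed

text \<open>Agreement is symmetric, so the two witnessing states can be exchanged; the second
  inclusion is the first one at \<open>Neg F\<close>.\<close>

lemma FV_Neg [simp]: "FV \<Delta> (Neg F) = FV \<Delta> F"
proof -
  have "v \<in> FV \<Delta> (Neg F)" if "v \<in> FV \<Delta> F" for v F
    using that agree_sym[of \<Delta>] by (force simp: FV_def)
  then have "FV \<Delta> F \<subseteq> FV \<Delta> (Neg F)" "FV \<Delta> (Neg F) \<subseteq> FV \<Delta> (Neg (Neg F))" by blast+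
  moreover have "FV \<Delta> (Neg (Neg F)) = FV \<Delta> F" by (simp add: FV_def)
  ultimately show ?thesis by blast
qed

text \<open>Axioms and imported inferences are left open; extensions of the locale add those that
  concern particular programs.\<close>

locale relative_calculus = fo_theory +
  fixes Ax :: "('a, 'b, 'c) fml set" and R :: "(('a, 'b, 'c) fml set \<times> ('a, 'b, 'c) fml) set"
    and \<Gamma> :: "('a, 'b, 'c) fml set"
  assumes fo_premises: "fo_fml \<Delta> F \<Longrightarrow> valid \<Delta> F \<Longrightarrow> F \<in> \<Gamma>"
begin

abbreviation prv :: "('a, 'b, 'c) fml \<Rightarrow> bool" where
  "prv \<equiv> derives \<Delta> Ax R \<Gamma>"

section \<open>Derived propositional, first-order and modal rules\<close>

lemma prv_fo: "fo_fml \<Delta> F \<Longrightarrow> valid \<Delta> F \<Longrightarrow> prv F"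
  by (simp add: fo_premises derives.premise)

lemma prv_taut1:
  assumes "prv F" "wf_fml \<Delta> F" "wf_fml \<Delta> H" "\<And>I. prop_eval I F \<Longrightarrow> prop_eval I H"
  shows "prv H"
  by (rule derives.modus_ponens[OF assms(1) derives.propositional]) (use assms(2-4) in \<open>auto simp: tautology_def\<close>)

lemma prv_taut2:
  assumes "prv F" "prv G" "wf_fml \<Delta> F" "wf_fml \<Delta> G" "wf_fml \<Delta> H"
    "\<And>I. prop_eval I F \<Longrightarrow> prop_eval I G \<Longrightarrow> prop_eval I H"
  shows "prv H"
proof (rule derives.modus_ponens[OF assms(2)], rule derives.modus_ponens[OF assms(1)], rule derives.propositional)
  show "wf_fml \<Delta> (Imp F (Imp G H))" using assms(3-5) by simp
  show "tautology (Imp F (Imp G H))" using assms(6) by (simp add: tautology_def)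
qed

lemma prv_taut3:
  assumes "prv F" "prv G" "prv K" "wf_fml \<Delta> F" "wf_fml \<Delta> G" "wf_fml \<Delta> K" "wf_fml \<Delta> H"
    "\<And>I. prop_eval I F \<Longrightarrow> prop_eval I G \<Longrightarrow> prop_eval I K \<Longrightarrow> prop_eval I H"
  shows "prv H"
proof -
  have "prv (Conj F G)" by (rule prv_taut2[OF assms(1,2)]; ((simp only: prop_eval.simps; blast) | (use assms in simp)))
  then show ?thesis by (rule prv_taut2[OF _ assms(3)]; ((simp only: prop_eval.simps; blast) | (use assms in simp)))
qed

lemma prv_trans:
  assumes "prv (Imp F G)" "prv (Imp G H)" "wf_fml \<Delta> F" "wf_fml \<Delta> G" "wf_fml \<Delta> H"
  shows "prv (Imp F H)"
  by (rule prv_taut2[OF assms(1,2)]; ((simp only: prop_eval.simps; blast) | (use assms(3-) in simp)))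

lemma prv_iff:
  assumes "prv (Imp F G)" "prv (Imp G F)" "wf_fml \<Delta> F" "wf_fml \<Delta> G"
  shows "prv (Iff F G)"
  by (rule prv_taut2[OF assms(1,2)]; ((simp only: prop_eval.simps; blast) | (use assms(3-) in simp)))

lemma prv_iffD1:
  assumes "prv (Iff F G)" "wf_fml \<Delta> F" "wf_fml \<Delta> G"
  shows "prv (Imp F G)"
  by (rule prv_taut1[OF assms(1)]; ((simp only: prop_eval.simps; blast) | (use assms(2-) in simp)))

lemma prv_iffD2:
  assumes "prv (Iff F G)" "wf_fml \<Delta> F" "wf_fml \<Delta> G"
  shows "prv (Imp G F)"
  by (rule prv_taut1[OF assms(1)]; ((simp only: prop_eval.simps; blast) | (use assms(2-) in simp)))

lemma prv_iff_trans:
  assumes "prv (Iff F G)" "prv (Iff G H)" "wf_fml \<Delta> F" "wf_fml \<Delta> G" "wf_fml \<Delta> H"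
  shows "prv (Iff F H)"
  by (rule prv_taut2[OF assms(1,2)]; ((simp only: prop_eval.simps; blast) | (use assms(3-) in simp)))

lemma prv_fo_imp:
  assumes "fo_fml \<Delta> F" "fo_fml \<Delta> G" "\<And>\<mu>. sat \<Delta> \<mu> F \<Longrightarrow> sat \<Delta> \<mu> G"
  shows "prv (Imp F G)"
  by (rule prv_fo) (use assms in \<open>auto simp: fo_fml_def valid_def\<close>)

lemma box_mono:
  assumes "p \<in> progs \<Delta>" "prv (Imp F G)" "wf_fml \<Delta> F" "wf_fml \<Delta> G"
  shows "prv (Imp (Box p F) (Box p G))"
  by (rule derives.modus_ponens[OF derives.G[OF assms(1,2)] derives.K]) (use assms(1,3,4) in auto)

lemma all_mono:
  assumes "prv (Imp F G)" "wf_fml \<Delta> F" "wf_fml \<Delta> G"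
  shows "prv (Imp (All v F) (All v G))"
  by (rule derives.modus_ponens[OF derives.all_gen[OF assms(1)] derives.all_distrib]) (use assms(2,3) in auto)

lemma box_cong:
  assumes "p \<in> progs \<Delta>" "prv (Iff F G)" "wf_fml \<Delta> F" "wf_fml \<Delta> G"
  shows "prv (Iff (Box p F) (Box p G))"
proof (rule prv_iff)
  show "prv (Imp (Box p F) (Box p G))" by (rule box_mono[OF assms(1) prv_iffD1[OF assms(2)]]) (use assms(3,4) in auto)
  show "prv (Imp (Box p G) (Box p F))" by (rule box_mono[OF assms(1) prv_iffD2[OF assms(2)]]) (use assms(3,4) in auto)
qed (use assms(1,3,4) in auto)

lemma all_cong:
  assumes "prv (Iff F G)" "wf_fml \<Delta> F" "wf_fml \<Delta> G"
  shows "prv (Iff (All v F) (All v G))"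
proof (rule prv_iff)
  show "prv (Imp (All v F) (All v G))" by (rule all_mono[OF prv_iffD1[OF assms(1)]]) (use assms(2,3) in auto)
  show "prv (Imp (All v G) (All v F))" by (rule all_mono[OF prv_iffD2[OF assms(1)]]) (use assms(2,3) in auto)
qed (use assms(2,3) in auto)

lemma all_intro:
  assumes "prv (Imp F G)" "v \<notin> FV \<Delta> F" "wf_fml \<Delta> F" "wf_fml \<Delta> G"
  shows "prv (Imp F (All v G))"
  by (rule prv_trans[OF derives.all_vacuous[OF assms(3,2)] all_mono[OF assms(1,3,4)]]) (use assms(3,4) in auto)

lemma alls_intro:
  assumes "prv (Imp F G)" "set vs \<inter> FV \<Delta> F = {}" "wf_fml \<Delta> F" "wf_fml \<Delta> G"
  shows "prv (Imp F (alls vs G))"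
  using assms
proof (induction vs)
  case (Cons v vs)
  then have "prv (Imp F (alls vs G))" by simp
  then show ?case unfolding alls_Cons by (rule all_intro) (use Cons.prems(2-) in auto)
qed simp

lemma alls_mono:
  assumes "prv (Imp F G)" "wf_fml \<Delta> F" "wf_fml \<Delta> G"
  shows "prv (Imp (alls vs F) (alls vs G))"
  using assms
proof (induction vs)
  case (Cons v vs)
  then have "prv (Imp (alls vs F) (alls vs G))" by simp
  then show ?case unfolding alls_Cons by (rule all_mono) (use Cons.prems(2-) in auto)
qed simp

text \<open>Iterates (B) from the innermost quantifier outwards.\<close>

lemma alls_box:
  assumes "p \<in> progs \<Delta>" "set vs \<inter> Vars \<Delta> p = {}" "wf_fml \<Delta> F"
  shows "prv (Imp (alls vs (Box p F)) (Box p (alls vs F)))"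
  using assms
proof (induction vs)
  case Nil
  show ?case by (rule derives.propositional) (use Nil in \<open>auto simp: tautology_def\<close>)
next
  case (Cons v vs)
  have "prv (Imp (alls vs (Box p F)) (Box p (alls vs F)))" using Cons by simp
  then have "prv (Imp (All v (alls vs (Box p F))) (All v (Box p (alls vs F))))"
    by (rule all_mono) (use Cons.prems in auto)
  moreover have "prv (Imp (All v (Box p (alls vs F))) (Box p (All v (alls vs F))))"
    by (rule derives.B) (use Cons.prems in auto)
  ultimately show ?case using prv_trans Cons.prems by simp
qed

section \<open>Elimination of boxes\<close>

lemma sat_alls:
  assumes "fo_fml \<Delta> F"
  shows "sat \<Delta> \<mu> (alls vs F) \<longleftrightarrow> (\<forall>\<nu>. agree \<Delta> (- set vs) \<mu> \<nu> \<longrightarrow> sat \<Delta> \<nu> F)"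
proof (induction vs arbitrary: \<mu>)
  case Nil
  then show ?case using fo_ext[OF assms, of \<mu>] agree_refl[of \<Delta> UNIV \<mu>] by auto
next
  case (Cons v vs)
  then show ?case using agree_insert_split[of v "set vs" \<mu>] by auto
qed

text \<open>First-order postconditions suffice, since boxes will be eliminated from the inside
  out.\<close>

definition box_reducible :: "'c \<Rightarrow> bool" where
  "box_reducible p \<longleftrightarrow> (\<forall>F. fo_fml \<Delta> F \<longrightarrow>
     (\<exists>G. fo_fml \<Delta> G \<and> (\<forall>\<mu>. sat \<Delta> \<mu> G = sat \<Delta> \<mu> (Box p F)) \<and> prv (Iff (Box p F) G)))"

text \<open>Supplies the closure under a single iteration that \<open>definable_iterate\<close> asks
  for.\<close>

lemma definable_dia:
  assumes "box_reducible p" "definable \<Delta> P"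
  shows "definable \<Delta> (\<lambda>\<mu>. \<exists>\<omega>. (\<mu>, \<omega>) \<in> prog_rel \<Delta> p \<and> P \<omega>)"
proof -
  obtain F where F: "fo_fml \<Delta> F" "\<forall>\<mu>. sat \<Delta> \<mu> F = P \<mu>" using assms(2) by (auto simp: definable_def)
  then have "fo_fml \<Delta> (Neg F)" by (simp add: fo_fml_def)
  then obtain G where G: "fo_fml \<Delta> G" "\<forall>\<mu>. sat \<Delta> \<mu> G = sat \<Delta> \<mu> (Box p (Neg F))"
    using assms(1) unfolding box_reducible_def by blast
  then have "fo_fml \<Delta> (Neg G)" by (simp add: fo_fml_def)
  moreover have "sat \<Delta> \<mu> (Neg G) \<longleftrightarrow> (\<exists>\<omega>. (\<mu>, \<omega>) \<in> prog_rel \<Delta> p \<and> P \<omega>)" for \<mu>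
    using G(2) F(2) by simp
  ultimately show ?thesis unfolding definable_def by blast
qed

text \<open>In the box case (G) and (K) first replace the postcondition by its first-order
  equivalent; only then is \<open>box_reducible\<close> applied.\<close>

lemma reducible:
  assumes "\<And>p. p \<in> progs \<Delta> \<Longrightarrow> box_reducible p" "wf_fml \<Delta> F"
  shows "\<exists>G. fo_fml \<Delta> G \<and> (\<forall>\<mu>. sat \<Delta> \<mu> G = sat \<Delta> \<mu> F) \<and> prv (Iff F G)"
  using assms(2)
proof (induction F)
  case (Atom a)
  have "prv (Iff (Atom a) (Atom a))" by (rule derives.propositional) (use Atom in \<open>auto simp: tautology_def\<close>)
  moreover have "fo_fml \<Delta> (Atom a)" using Atom by (simp add: fo_fml_def)
  ultimately show ?case by blast
next
  case (Neg F)
  then obtain G where G: "fo_fml \<Delta> G" "\<forall>\<mu>. sat \<Delta> \<mu> G = sat \<Delta> \<mu> F" "prv (Iff F G)" by auto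
  have "prv (Iff (Neg F) (Neg G))"
    by (rule prv_taut1[OF G(3)]; ((simp only: prop_eval.simps; blast) | (use G(1) Neg.prems in \<open>simp add: fo_fml_def\<close>)))
  then show ?case using G by (intro exI[of _ "Neg G"]) (auto simp: fo_fml_def)
next
  case (Conj F1 F2)
  then obtain G1 G2 where G: "fo_fml \<Delta> G1" "\<forall>\<mu>. sat \<Delta> \<mu> G1 = sat \<Delta> \<mu> F1" "prv (Iff F1 G1)"
    "fo_fml \<Delta> G2" "\<forall>\<mu>. sat \<Delta> \<mu> G2 = sat \<Delta> \<mu> F2" "prv (Iff F2 G2)" by auto
  have "prv (Iff (Conj F1 F2) (Conj G1 G2))"
    by (rule prv_taut2[OF G(3,6)]; ((simp only: prop_eval.simps; blast) | (use G(1,4) Conj.prems in \<open>simp add: fo_fml_def\<close>)))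
  then show ?case using G by (intro exI[of _ "Conj G1 G2"]) (auto simp: fo_fml_def)
next
  case (All v F)
  then obtain G where G: "fo_fml \<Delta> G" "\<forall>\<mu>. sat \<Delta> \<mu> G = sat \<Delta> \<mu> F" "prv (Iff F G)" by auto
  have "prv (Iff (All v F) (All v G))"
    by (rule all_cong[OF G(3)]) (use G(1) All.prems in \<open>auto simp: fo_fml_def\<close>)
  then show ?case using G by (intro exI[of _ "All v G"]) (auto simp: fo_fml_def)
next
  case (Box p F)
  then obtain G where G: "fo_fml \<Delta> G" "\<forall>\<mu>. sat \<Delta> \<mu> G = sat \<Delta> \<mu> F" "prv (Iff F G)" by auto
  have p: "p \<in> progs \<Delta>" "wf_fml \<Delta> F" using Box.prems by auto
  obtain K where K: "fo_fml \<Delta> K" "\<forall>\<mu>. sat \<Delta> \<mu> K = sat \<Delta> \<mu> (Box p G)" "prv (Iff (Box p G) K)"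
    using assms(1)[OF p(1)] G(1) by (auto simp: box_reducible_def)
  have "prv (Iff (Box p F) (Box p G))"
    by (rule box_cong[OF p(1) G(3)]) (use G(1) p in \<open>auto simp: fo_fml_def\<close>)
  then have "prv (Iff (Box p F) K)"
    using prv_iff_trans[OF _ K(3)] p G(1) K(1) by (simp add: fo_fml_def)
  then show ?case using G(2) K(1,2) by (intro exI[of _ K]) auto
qed

lemma relative_completeness:
  assumes "\<And>p. p \<in> progs \<Delta> \<Longrightarrow> box_reducible p" "wf_fml \<Delta> F" "valid \<Delta> F"
  shows "prv F"
proof -
  obtain G where G: "fo_fml \<Delta> G" "\<forall>\<mu>. sat \<Delta> \<mu> G = sat \<Delta> \<mu> F" "prv (Iff F G)"
    using reducible[OF assms(1,2)] by blast
  have "prv G" by (rule prv_fo) (use G assms(3) in \<open>auto simp: valid_def\<close>)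
  then show ?thesis
    by (rule prv_taut2[OF G(3)]; ((simp only: prop_eval.simps; blast) | (use G(1) assms(2) in \<open>simp add: fo_fml_def\<close>)))
qed

text \<open>
  The first-order formula \<open>S\<close> describes the transition relation of \<open>p\<close> between the values of \<open>V\<close>
  before the run and, in the twins \<open>t v\<close>, after it.  With
  \<open>Q = (\<forall>V. (\<forall>v\<in>V. v \<doteq> t v) \<longrightarrow> \<not> F)\<close>, the formula \<open>[p]F\<close> amounts to \<open>\<forall>t(V). \<not> (S \<and> Q)\<close>.
\<close>

lemma box_reducible_rendition:
  assumes p: "p \<in> progs \<Delta>" and V: "finite V" "Vars \<Delta> p \<subseteq> V"
    and ext: "\<And>\<mu> \<mu>' \<omega>. agree \<Delta> UNIV \<mu> \<mu>' \<Longrightarrow> (\<mu>, \<omega>) \<in> prog_rel \<Delta> p \<Longrightarrow> (\<mu>', \<omega>) \<in> prog_rel \<Delta> p"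
    and rendition: "\<And>A. finite A \<Longrightarrow> \<exists>t S E. inj_on t V \<and> t ` V \<inter> (A \<union> V) = {} \<and>
      (\<forall>v\<in>V. twin \<Delta> v (t v)) \<and> fo_fml \<Delta> S \<and> fo_fml \<Delta> E \<and>
      (\<forall>\<mu>. sat \<Delta> \<mu> E \<longleftrightarrow> (\<forall>v\<in>V. val \<Delta> \<mu> v = val \<Delta> \<mu> (t v))) \<and>
      (\<forall>\<mu>. sat \<Delta> \<mu> S = sat \<Delta> \<mu> (Dia p E)) \<and> prv (Iff S (Dia p E))"
  shows "box_reducible p"
  unfolding box_reducible_def
proof (intro allI impI)
  fix F assume F: "fo_fml \<Delta> F"
  obtain A where A: "finite A" "\<And>\<mu> \<nu>. agree \<Delta> A \<mu> \<nu> \<Longrightarrow> sat \<Delta> \<mu> F = sat \<Delta> \<nu> F"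
    using fo_coincidence[OF F] by blast
  obtain t S E where "inj_on t V \<and> t ` V \<inter> (A \<union> V) = {} \<and>
      (\<forall>v\<in>V. twin \<Delta> v (t v)) \<and> fo_fml \<Delta> S \<and> fo_fml \<Delta> E \<and>
      (\<forall>\<mu>. sat \<Delta> \<mu> E \<longleftrightarrow> (\<forall>v\<in>V. val \<Delta> \<mu> v = val \<Delta> \<mu> (t v))) \<and>
      (\<forall>\<mu>. sat \<Delta> \<mu> S = sat \<Delta> \<mu> (Dia p E)) \<and> prv (Iff S (Dia p E))"
    using rendition[OF A(1)] by (elim exE)
  then have t: "inj_on t V" "t ` V \<inter> (A \<union> V) = {}" "\<forall>v\<in>V. twin \<Delta> v (t v)"
    and fo: "fo_fml \<Delta> S" "fo_fml \<Delta> E"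
    and E: "\<And>\<mu>. sat \<Delta> \<mu> E \<longleftrightarrow> (\<forall>v\<in>V. val \<Delta> \<mu> v = val \<Delta> \<mu> (t v))"
    and S: "\<And>\<mu>. sat \<Delta> \<mu> S = sat \<Delta> \<mu> (Dia p E)" "prv (Iff S (Dia p E))"
    by (elim conjE; assumption | blast)+
  obtain vs where vs: "set vs = V" using V(1) finite_list by blast
  define ws where "ws = map t vs"
  have ws: "set ws = t ` V" by (simp add: ws_def vs)
  define Q where "Q = alls vs (Imp E (Neg F))"
  define G where "G = alls ws (Neg (Conj S Q))"
  have wf: "wf_fml \<Delta> F" "wf_fml \<Delta> E" "wf_fml \<Delta> S" "wf_fml \<Delta> Q"
    using F fo by (auto simp: fo_fml_def Q_def)
  have foQ: "fo_fml \<Delta> Q" using F fo by (simp add: fo_fml_def Q_def)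
  have foG: "fo_fml \<Delta> G" using F fo by (simp add: fo_fml_def Q_def G_def)
  have BV: "agree \<Delta> (- V) \<mu> \<omega>" if "(\<mu>, \<omega>) \<in> prog_rel \<Delta> p" for \<mu> \<omega>
    using that V(2) unfolding agree_def Vars_def BVp_def by blast
  have satQ: "sat \<Delta> \<mu> Q \<longleftrightarrow> (\<forall>\<nu>. agree \<Delta> (- V) \<mu> \<nu> \<longrightarrow>
      (\<forall>v\<in>V. val \<Delta> \<nu> v = val \<Delta> \<nu> (t v)) \<longrightarrow> \<not> sat \<Delta> \<nu> F)" for \<mu>
    unfolding Q_def by (subst sat_alls) (use F fo E vs in \<open>auto simp: fo_fml_def\<close>)
  have satG: "sat \<Delta> \<mu> G \<longleftrightarrow> (\<forall>\<nu>. agree \<Delta> (- t ` V) \<mu> \<nu> \<longrightarrow> \<not> (sat \<Delta> \<nu> S \<and> sat \<Delta> \<nu> Q))" for \<mu>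
    unfolding G_def by (subst sat_alls) (use foQ fo ws in \<open>auto simp: fo_fml_def\<close>)
  \<comment> \<open>All of \<open>V\<close> is quantified in \<open>Q\<close>, so a run of
    \<open>p\<close>, which changes only \<open>V\<close>, preserves \<open>Q\<close>.\<close>
  have QV: "sat \<Delta> \<mu> Q = sat \<Delta> \<nu> Q" if "agree \<Delta> (- V) \<mu> \<nu>" for \<mu> \<nu>
  proof -
    have "agree \<Delta> (- V) \<mu> \<omega> = agree \<Delta> (- V) \<nu> \<omega>" for \<omega>
      using agree_trans[OF that] agree_trans[OF agree_sym[OF that]] by blast
    then show ?thesis unfolding satQ by simp
  qed
  have FVQ: "FV \<Delta> Q \<inter> V = {}"
  proof -
    have False if v: "v \<in> FV \<Delta> Q" "v \<in> V" for v
    proof -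
      obtain \<mu> \<nu> where *: "agree \<Delta> (- {v}) \<mu> \<nu>" "sat \<Delta> \<mu> Q \<noteq> sat \<Delta> \<nu> Q"
        using v(1) by (auto simp: FV_def)
      have "agree \<Delta> (- V) \<mu> \<nu>" by (rule agree_mono[OF *(1)]) (use v(2) in auto)
      then show False using QV *(2) by blast
    qed
    then show ?thesis by blast
  qed
  \<comment> \<open>in a state where \<open>V\<close> equals its twins, \<open>Q\<close> is the negation of \<open>F\<close>\<close>
  have EQ: "sat \<Delta> \<mu> Q = (\<not> sat \<Delta> \<mu> F)" if e: "sat \<Delta> \<mu> E" for \<mu>
  proof
    assume "sat \<Delta> \<mu> Q"
    then show "\<not> sat \<Delta> \<mu> F" using e E satQ by auto
  next
    assume f: "\<not> sat \<Delta> \<mu> F"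
    have "\<not> sat \<Delta> \<nu> F" if n: "agree \<Delta> (- V) \<mu> \<nu>" "\<forall>v\<in>V. val \<Delta> \<nu> v = val \<Delta> \<nu> (t v)" for \<nu>
    proof -
      have "val \<Delta> \<nu> x = val \<Delta> \<mu> x" for x
      proof (cases "x \<in> V")
        case True
        then have "t x \<in> - V" using t(2) by blast
        then have "val \<Delta> \<mu> (t x) = val \<Delta> \<nu> (t x)" using n(1) by (simp add: agree_def)
        moreover have "val \<Delta> \<mu> x = val \<Delta> \<mu> (t x)" using e E True by blast
        ultimately show ?thesis using n(2) True by simp
      next
        case False
        then show ?thesis using n(1) by (simp add: agree_def)
      qed
      then have "agree \<Delta> UNIV \<nu> \<mu>" by (simp add: agree_def)
      then show ?thesis using f fo_ext[OF F] by blast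
    qed
    then show "sat \<Delta> \<mu> Q" unfolding satQ by blast
  qed
  \<comment> \<open>The twins avoid \<open>A\<close>, so \<open>F\<close> does not read
    them.\<close>
  have FF: "sat \<Delta> \<mu> F = sat \<Delta> \<nu> F" if "agree \<Delta> (- t ` V) \<mu> \<nu>" for \<mu> \<nu>
    by (rule A(2), rule agree_mono[OF that]) (use t(2) in auto)
  \<comment> \<open>Since twins attain the same values, they can store what \<open>V\<close> holds
    in \<omega>.\<close>
  have copy: "\<exists>\<nu>. agree \<Delta> (- t ` V) \<mu> \<nu> \<and> (\<forall>v\<in>V. val \<Delta> \<nu> (t v) = val \<Delta> \<omega> v)" for \<mu> \<omega>
  proof -
    have "val \<Delta> \<omega> (the_inv_into V t y) \<in> attainable \<Delta> y" if y: "y \<in> t ` V" for y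
    proof -
      obtain v where v: "v \<in> V" "y = t v" using y by blast
      then have "attainable \<Delta> y = attainable \<Delta> v" using t(3) by (simp add: twin_def)
      then show ?thesis using v t(1) by (auto simp: the_inv_into_f_f attainable_def)
    qed
    then obtain \<nu> where n: "agree \<Delta> (- t ` V) \<mu> \<nu>" "\<forall>y\<in>t ` V. val \<Delta> \<nu> y = val \<Delta> \<omega> (the_inv_into V t y)"
      using assign[of "t ` V" "\<lambda>y. val \<Delta> \<omega> (the_inv_into V t y)" \<mu>] V(1) by blast
    then show ?thesis using t(1) by (intro exI[of _ \<nu>]) (auto simp: the_inv_into_f_f)
  qed
  have sem: "sat \<Delta> \<mu> G = sat \<Delta> \<mu> (Box p F)" for \<mu>
  proof
    assume g: "sat \<Delta> \<mu> G"
    \<comment> \<open>The final values are written into the twins beforehand. This does not disturb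
      the run, and in its end state \<open>E\<close> holds.\<close>
    have "sat \<Delta> \<omega> F" if w: "(\<mu>, \<omega>) \<in> prog_rel \<Delta> p" for \<omega>
    proof -
      obtain \<nu> where n: "agree \<Delta> (- t ` V) \<mu> \<nu>" "\<forall>v\<in>V. val \<Delta> \<nu> (t v) = val \<Delta> \<omega> v"
        using copy by blast
      have "\<exists>\<omega>'. (\<nu>, \<omega>') \<in> prog_rel \<Delta> p \<and> agree \<Delta> (- t ` V) \<omega> \<omega>'"
      proof (rule finite_change[OF _ n(1) w])
        show "finite (t ` V)" using V(1) by simp
        show "(\<mu>', \<omega>) \<in> prog_rel \<Delta> p" if "agree \<Delta> UNIV \<mu> \<mu>'" "(\<mu>, \<omega>) \<in> prog_rel \<Delta> p" for \<mu> \<mu>' \<omega>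
          using ext that .
        show "\<exists>\<omega>'. (\<nu>, \<omega>') \<in> prog_rel \<Delta> p \<and> agree \<Delta> (- {v}) \<omega> \<omega>'"
          if "v \<in> t ` V" "agree \<Delta> (- {v}) \<mu> \<nu>" "(\<mu>, \<omega>) \<in> prog_rel \<Delta> p" for v \<mu> \<nu> \<omega>
        proof -
          have "v \<notin> FVp \<Delta> p" using that(1) V(2) t(2) unfolding Vars_def by blast
          then show ?thesis using that(2,3) unfolding FVp_def by blast
        qed
      qed
      then obtain \<omega>' where w': "(\<nu>, \<omega>') \<in> prog_rel \<Delta> p" "agree \<Delta> (- t ` V) \<omega> \<omega>'" by blast
      have e: "sat \<Delta> \<omega>' E"
        unfolding E
      proof
        fix v assume v: "v \<in> V"
        then have "v \<in> - t ` V" "t v \<in> - V" using t(2) by blast+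
        then have "val \<Delta> \<omega> v = val \<Delta> \<omega>' v" "val \<Delta> \<nu> (t v) = val \<Delta> \<omega>' (t v)"
          using w'(2) BV[OF w'(1)] by (simp_all add: agree_def)
        then show "val \<Delta> \<omega>' v = val \<Delta> \<omega>' (t v)" using n(2) v by simp
      qed
      then have "sat \<Delta> \<nu> S" using S(1) w'(1) by auto
      then have "\<not> sat \<Delta> \<nu> Q" using g n(1) satG by blast
      then have "\<not> sat \<Delta> \<omega>' Q" using QV[OF BV[OF w'(1)]] by blast
      then have "sat \<Delta> \<omega>' F" using EQ[OF e] by blast
      then show ?thesis using FF[OF w'(2)] by blast
    qed
    then show "sat \<Delta> \<mu> (Box p F)" by simp
  next
    assume b: "sat \<Delta> \<mu> (Box p F)"
    have False if n: "agree \<Delta> (- t ` V) \<mu> \<nu>" "sat \<Delta> \<nu> S" "sat \<Delta> \<nu> Q" for \<nu>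
    proof -
      \<comment> \<open>By \<open>S\<close> some run from \<nu> ends with \<open>E\<close>. Since
        \<open>Q\<close> persists, its end state violates \<open>F\<close>, and so does that of the
        corresponding run from \<mu>.\<close>
      obtain \<omega> where w: "(\<nu>, \<omega>) \<in> prog_rel \<Delta> p" "sat \<Delta> \<omega> E" using S(1) n(2) by auto
      then have nf: "\<not> sat \<Delta> \<omega> F" using n(3) QV[OF BV[OF w(1)]] EQ[OF w(2)] by blast
      have "\<exists>\<omega>'. (\<mu>, \<omega>') \<in> prog_rel \<Delta> p \<and> agree \<Delta> (- t ` V) \<omega> \<omega>'"
      proof (rule finite_change[OF _ agree_sym[OF n(1)] w(1)])
        show "finite (t ` V)" using V(1) by simp
        show "(\<mu>', \<omega>) \<in> prog_rel \<Delta> p" if "agree \<Delta> UNIV \<mu> \<mu>'" "(\<mu>, \<omega>) \<in> prog_rel \<Delta> p" for \<mu> \<mu>' \<omega>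
          using ext that .
        show "\<exists>\<omega>'. (\<nu>, \<omega>') \<in> prog_rel \<Delta> p \<and> agree \<Delta> (- {v}) \<omega> \<omega>'"
          if "v \<in> t ` V" "agree \<Delta> (- {v}) \<mu> \<nu>" "(\<mu>, \<omega>) \<in> prog_rel \<Delta> p" for v \<mu> \<nu> \<omega>
        proof -
          have "v \<notin> FVp \<Delta> p" using that(1) V(2) t(2) unfolding Vars_def by blast
          then show ?thesis using that(2,3) unfolding FVp_def by blast
        qed
      qed
      then obtain \<omega>' where "(\<mu>, \<omega>') \<in> prog_rel \<Delta> p" "agree \<Delta> (- t ` V) \<omega> \<omega>'" by blast
      then show False using b nf FF[of \<omega> \<omega>'] by auto
    qed
    then show "sat \<Delta> \<mu> G" unfolding satG by blast
  qed
  have tV: "set ws \<inter> FV \<Delta> (Box p F) = {}"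
  proof -
    have "v \<notin> FV \<Delta> F" if "v \<in> t ` V" for v
    proof
      assume "v \<in> FV \<Delta> F"
      then obtain \<mu> \<nu> where *: "agree \<Delta> (- {v}) \<mu> \<nu>" "sat \<Delta> \<mu> F" "\<not> sat \<Delta> \<nu> F" by (auto simp: FV_def)
      have "agree \<Delta> (- t ` V) \<mu> \<nu>" by (rule agree_mono[OF *(1)]) (use that in auto)
      then show False using FF *(2,3) by blast
    qed
    moreover have "t ` V \<inter> FVp \<Delta> p = {}" using V(2) t(2) unfolding Vars_def by blast
    ultimately show ?thesis using FV_Box[of \<Delta> p F] unfolding ws by blast
  qed
  have BVQ: "FV \<Delta> Q \<inter> BVp \<Delta> p = {}" using FVQ V(2) unfolding Vars_def by blast
  have "prv (Imp (Box p F) G)"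
    unfolding G_def
  proof (rule alls_intro[OF _ tV])
    \<comment> \<open>With \<open>Q\<close> carried through \<open>p\<close> by (V),
      \<open>Box p F\<close> yields \<open>Box p (Neg E)\<close>, which the rendition turns into
      \<open>Neg S\<close>.\<close>
    have "prv (Imp Q (Imp F (Neg E)))"
      by (rule prv_fo_imp) (use fo foQ F EQ in \<open>auto simp: fo_fml_def\<close>)
    from box_mono[OF p this] have "prv (Imp (Box p Q) (Box p (Imp F (Neg E))))" using wf by simp
    moreover have "prv (Imp (Box p (Imp F (Neg E))) (Imp (Box p F) (Box p (Neg E))))"
      by (rule derives.K) (use p wf in auto)
    ultimately have 1: "prv (Imp (Box p Q) (Imp (Box p F) (Box p (Neg E))))"
      using prv_trans p wf by simp
    have 2: "prv (Imp Q (Box p Q))" by (rule derives.V[OF p wf(4) BVQ])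
    show "prv (Imp (Box p F) (Neg (Conj S Q)))"
      by (rule prv_taut3[OF S(2) 1 2]; ((simp only: prop_eval.simps; blast) | (use p wf in simp)))
  qed (use p wf in auto)
  moreover have "prv (Imp G (Box p F))"
  proof -
    \<comment> \<open>Both ways of refuting \<open>Conj S Q\<close> give the same boxed formula:
      without \<open>S\<close> no run ends with \<open>E\<close>, and without \<open>Q\<close> its
      negation survives the run.\<close>
    have "prv (Imp (Neg E) (Imp E (Neg Q)))" by (rule derives.propositional) (use wf in \<open>auto simp: tautology_def\<close>)
    from box_mono[OF p this] have 1: "prv (Imp (Box p (Neg E)) (Box p (Imp E (Neg Q))))" using wf by simp
    have "prv (Imp (Neg Q) (Imp E (Neg Q)))" by (rule derives.propositional) (use wf in \<open>auto simp: tautology_def\<close>)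
    from box_mono[OF p this] have "prv (Imp (Box p (Neg Q)) (Box p (Imp E (Neg Q))))" using wf by simp
    moreover have "prv (Imp (Neg Q) (Box p (Neg Q)))" by (rule derives.V[OF p]) (use wf BVQ in auto)
    ultimately have 2: "prv (Imp (Neg Q) (Box p (Imp E (Neg Q))))"
      using prv_trans[of "Neg Q" "Box p (Neg Q)" "Box p (Imp E (Neg Q))"] p wf by simp
    have "prv (Imp (Neg (Conj S Q)) (Box p (Imp E (Neg Q))))"
      by (rule prv_taut3[OF S(2) 1 2]; ((simp only: prop_eval.simps; blast) | (use p wf in simp)))
    then have "prv (Imp G (alls ws (Box p (Imp E (Neg Q)))))"
      unfolding G_def by (rule alls_mono) (use p wf in auto)
    \<comment> \<open>(B) carries the quantified twins into the box, where they can be instantiated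
      by the values of \<open>V\<close> after the run.\<close>
    moreover have "prv (Imp (alls ws (Box p (Imp E (Neg Q)))) (Box p (alls ws (Imp E (Neg Q)))))"
    proof (rule alls_box[OF p])
      show "set ws \<inter> Vars \<Delta> p = {}" using V(2) t(2) unfolding ws by blast
    qed (use wf in auto)
    moreover have "prv (Imp (Box p (alls ws (Imp E (Neg Q)))) (Box p F))"
    proof (rule box_mono[OF p prv_fo_imp])
      fix \<mu> assume a: "sat \<Delta> \<mu> (alls ws (Imp E (Neg Q)))"
      obtain \<nu> where n: "agree \<Delta> (- t ` V) \<mu> \<nu>" "\<forall>v\<in>V. val \<Delta> \<nu> (t v) = val \<Delta> \<mu> v"
        using copy by blast
      have "val \<Delta> \<nu> v = val \<Delta> \<mu> v" if "v \<in> V" for v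
      proof -
        have "v \<in> - t ` V" using that t(2) by blast
        then show ?thesis using n(1) by (simp add: agree_def)
      qed
      then have e: "sat \<Delta> \<nu> E" using n(2) E by simp
      have "fo_fml \<Delta> (Imp E (Neg Q))" using fo foQ by (simp add: fo_fml_def)
      then have "sat \<Delta> \<nu> (Imp E (Neg Q))" using a n(1) sat_alls ws by simp
      then have "sat \<Delta> \<nu> F" using e EQ by simp
      then show "sat \<Delta> \<mu> F" using FF[OF n(1)] by blast
    qed (use wf F fo foQ in \<open>auto simp: fo_fml_def\<close>)
    ultimately show ?thesis
      using prv_trans[of G "alls ws (Box p (Imp E (Neg Q)))" "Box p (alls ws (Imp E (Neg Q)))"]
        prv_trans[of G "Box p (alls ws (Imp E (Neg Q)))" "Box p F"] p wf foG
      by (simp add: fo_fml_def)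
  qed
  ultimately have "prv (Iff (Box p F) G)" using prv_iff p wf foG by (simp add: fo_fml_def)
  then show "\<exists>G. fo_fml \<Delta> G \<and> (\<forall>\<mu>. sat \<Delta> \<mu> G = sat \<Delta> \<mu> (Box p F)) \<and> prv (Iff (Box p F) G)"
    using foG sem by blast
qed

end

section \<open>Regular programs\<close>

lemma regular_simps [simp]:
  "val (regular \<Delta>) = val \<Delta>" "atoms (regular \<Delta>) = atoms \<Delta>" "atom_eval (regular \<Delta>) = atom_eval \<Delta>"
  "atom_fv (regular \<Delta>) = atom_fv \<Delta>" "prog_rel (regular \<Delta>) = reg_rel \<Delta>"
  "progs (regular \<Delta>) = {\<alpha>. reg_wf \<Delta> \<alpha>}"
  by (simp_all add: regular_def)

lemma agree_regular [simp]: "agree (regular \<Delta>) = agree \<Delta>"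
  by (simp add: agree_def fun_eq_iff)

lemma sat_emb_reg [simp]: "sat (regular \<Delta>) \<mu> (emb_reg F) = sat \<Delta> \<mu> F"
  by (induction F arbitrary: \<mu>) (auto simp: emb_reg_def)

lemma wf_emb_reg [simp]: "wf_fml (regular \<Delta>) (emb_reg F) = wf_fml \<Delta> F"
  by (induction F) (auto simp: emb_reg_def)

lemma first_order_emb_reg [simp]: "first_order (emb_reg F) = first_order F"
  by (induction F) (auto simp: emb_reg_def)

lemma fo_emb_reg [simp]: "fo_fml (regular \<Delta>) (emb_reg F) = fo_fml \<Delta> F"
  by (simp add: fo_fml_def)

section \<open>Semantic free and bound variables of regular programs\<close>

lemma FVp_Base: "FVp (regular \<Delta>) (Base p) = FVp \<Delta> p"
  by (simp add: FVp_def)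

lemma FVp_Test: "FVp (regular \<Delta>) (Test \<phi>) \<subseteq> FV \<Delta> \<phi>"
proof
  fix v assume "v \<in> FVp (regular \<Delta>) (Test \<phi>)"
  then obtain \<mu> \<nu> \<omega> where *: "agree \<Delta> (- {v}) \<mu> \<nu>" "sat \<Delta> \<mu> \<phi>" "agree \<Delta> UNIV \<mu> \<omega>"
    "\<not> (\<exists>\<omega>'. (sat \<Delta> \<nu> \<phi> \<and> agree \<Delta> UNIV \<nu> \<omega>') \<and> agree \<Delta> (- {v}) \<omega> \<omega>')"
    by (auto simp: FVp_def)
  have "agree \<Delta> (- {v}) \<omega> \<nu>" using *(1,3) by (simp add: agree_def)
  then have "\<not> sat \<Delta> \<nu> \<phi>" using *(4) agree_refl[of \<Delta> UNIV \<nu>] by blast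
  then show "v \<in> FV \<Delta> \<phi>" using *(1,2) by (auto simp: FV_def)
qed

lemma FVp_Seq: "FVp (regular \<Delta>) (Seq \<alpha> \<beta>) \<subseteq> FVp (regular \<Delta>) \<alpha> \<union> FVp (regular \<Delta>) \<beta>"
proof
  fix v assume "v \<in> FVp (regular \<Delta>) (Seq \<alpha> \<beta>)"
  then obtain \<mu> \<nu> \<omega> where *: "agree \<Delta> (- {v}) \<mu> \<nu>" "(\<mu>, \<omega>) \<in> reg_rel \<Delta> \<alpha> O reg_rel \<Delta> \<beta>"
    "\<not> (\<exists>\<omega>'. (\<nu>, \<omega>') \<in> reg_rel \<Delta> \<alpha> O reg_rel \<Delta> \<beta> \<and> agree \<Delta> (- {v}) \<omega> \<omega>')"
    by (auto simp: FVp_def)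
  obtain \<rho> where r: "(\<mu>, \<rho>) \<in> reg_rel \<Delta> \<alpha>" "(\<rho>, \<omega>) \<in> reg_rel \<Delta> \<beta>" using *(2) by blast
  show "v \<in> FVp (regular \<Delta>) \<alpha> \<union> FVp (regular \<Delta>) \<beta>"
  proof (rule ccontr)
    assume v: "v \<notin> FVp (regular \<Delta>) \<alpha> \<union> FVp (regular \<Delta>) \<beta>"
    have "\<exists>\<rho>'. (\<nu>, \<rho>') \<in> reg_rel \<Delta> \<alpha> \<and> agree \<Delta> (- {v}) \<rho> \<rho>'"
      using v *(1) r(1) by (auto simp: FVp_def)
    then obtain \<rho>' where r': "(\<nu>, \<rho>') \<in> reg_rel \<Delta> \<alpha>" "agree \<Delta> (- {v}) \<rho> \<rho>'" by blast
    have "\<exists>\<omega>'. (\<rho>', \<omega>') \<in> reg_rel \<Delta> \<beta> \<and> agree \<Delta> (- {v}) \<omega> \<omega>'"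
      using v r'(2) r(2) by (auto simp: FVp_def)
    then show False using *(3) r'(1) by blast
  qed
qed

lemma FVp_Choice: "FVp (regular \<Delta>) (Choice \<alpha> \<beta>) \<subseteq> FVp (regular \<Delta>) \<alpha> \<union> FVp (regular \<Delta>) \<beta>"
proof
  fix v assume "v \<in> FVp (regular \<Delta>) (Choice \<alpha> \<beta>)"
  then obtain \<mu> \<nu> \<omega> where *: "agree \<Delta> (- {v}) \<mu> \<nu>" "(\<mu>, \<omega>) \<in> reg_rel \<Delta> \<alpha> \<union> reg_rel \<Delta> \<beta>"
    "\<not> (\<exists>\<omega>'. (\<nu>, \<omega>') \<in> reg_rel \<Delta> \<alpha> \<union> reg_rel \<Delta> \<beta> \<and> agree \<Delta> (- {v}) \<omega> \<omega>')"
    unfolding FVp_def by auto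
  show "v \<in> FVp (regular \<Delta>) \<alpha> \<union> FVp (regular \<Delta>) \<beta>"
    unfolding FVp_def using * by simp blast
qed

text \<open>The run is copied step by step from the changed initial state; the closing change of
  state without change of values needs no counterpart.\<close>

lemma FVp_Star: "FVp (regular \<Delta>) (Star \<alpha>) \<subseteq> FVp (regular \<Delta>) \<alpha>"
proof
  fix v assume "v \<in> FVp (regular \<Delta>) (Star \<alpha>)"
  then obtain \<mu> \<nu> \<omega> where *: "agree \<Delta> (- {v}) \<mu> \<nu>" "(\<mu>, \<omega>) \<in> reg_rel \<Delta> (Star \<alpha>)"
    "\<not> (\<exists>\<omega>'. (\<nu>, \<omega>') \<in> reg_rel \<Delta> (Star \<alpha>) \<and> agree \<Delta> (- {v}) \<omega> \<omega>')"
    by (auto simp: FVp_def)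
  obtain \<rho> where r: "(\<mu>, \<rho>) \<in> (reg_rel \<Delta> \<alpha>)\<^sup>*" "agree \<Delta> UNIV \<rho> \<omega>" using *(2) by auto
  show "v \<in> FVp (regular \<Delta>) \<alpha>"
  proof (rule ccontr)
    assume v: "v \<notin> FVp (regular \<Delta>) \<alpha>"
    from r(1) have "\<exists>\<rho>'. (\<nu>, \<rho>') \<in> (reg_rel \<Delta> \<alpha>)\<^sup>* \<and> agree \<Delta> (- {v}) \<rho> \<rho>'"
    proof (induction rule: rtrancl_induct)
      case base
      then show ?case using *(1) by blast
    next
      case (step y z)
      then obtain y' where y: "(\<nu>, y') \<in> (reg_rel \<Delta> \<alpha>)\<^sup>*" "agree \<Delta> (- {v}) y y'" by blast
      have "\<exists>z'. (y', z') \<in> reg_rel \<Delta> \<alpha> \<and> agree \<Delta> (- {v}) z z'"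
        using v step.hyps(2) y(2) by (auto simp: FVp_def)
      then show ?case using y(1) rtrancl_into_rtrancl by metis
    qed
    then obtain \<rho>' where r': "(\<nu>, \<rho>') \<in> (reg_rel \<Delta> \<alpha>)\<^sup>*" "agree \<Delta> (- {v}) \<rho> \<rho>'" by blast
    have "(\<nu>, \<rho>') \<in> reg_rel \<Delta> (Star \<alpha>)" using r'(1) agree_refl[of \<Delta> UNIV \<rho>'] by auto
    moreover have "agree \<Delta> (- {v}) \<omega> \<rho>'" using r(2) r'(2) by (simp add: agree_def)
    ultimately show False using *(3) by blast
  qed
qed

lemma BVp_Base: "BVp (regular \<Delta>) (Base p) = BVp \<Delta> p"
  by (simp add: BVp_def)

lemma BVp_Test: "BVp (regular \<Delta>) (Test \<phi>) = {}"
  by (auto simp: BVp_def agree_def)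

lemma BVp_Seq: "BVp (regular \<Delta>) (Seq \<alpha> \<beta>) \<subseteq> BVp (regular \<Delta>) \<alpha> \<union> BVp (regular \<Delta>) \<beta>"
proof
  fix v assume "v \<in> BVp (regular \<Delta>) (Seq \<alpha> \<beta>)"
  then obtain \<mu> \<rho> \<omega> where "(\<mu>, \<rho>) \<in> reg_rel \<Delta> \<alpha>" "(\<rho>, \<omega>) \<in> reg_rel \<Delta> \<beta>" "val \<Delta> \<mu> v \<noteq> val \<Delta> \<omega> v"
    by (auto simp: BVp_def)
  then show "v \<in> BVp (regular \<Delta>) \<alpha> \<union> BVp (regular \<Delta>) \<beta>"
    unfolding BVp_def by (cases "val \<Delta> \<mu> v = val \<Delta> \<rho> v") auto
qed

lemma BVp_Choice: "BVp (regular \<Delta>) (Choice \<alpha> \<beta>) = BVp (regular \<Delta>) \<alpha> \<union> BVp (regular \<Delta>) \<beta>"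
  by (auto simp: BVp_def)

lemma BVp_Star: "BVp (regular \<Delta>) (Star \<alpha>) \<subseteq> BVp (regular \<Delta>) \<alpha>"
proof
  fix v assume "v \<in> BVp (regular \<Delta>) (Star \<alpha>)"
  then obtain \<mu> \<omega> where *: "(\<mu>, \<omega>) \<in> reg_rel \<Delta> (Star \<alpha>)" "val \<Delta> \<mu> v \<noteq> val \<Delta> \<omega> v"
    by (auto simp: BVp_def)
  obtain \<rho> where r: "(\<mu>, \<rho>) \<in> (reg_rel \<Delta> \<alpha>)\<^sup>*" "agree \<Delta> UNIV \<rho> \<omega>" using *(1) by auto
  show "v \<in> BVp (regular \<Delta>) \<alpha>"
  proof (rule ccontr)
    assume v: "v \<notin> BVp (regular \<Delta>) \<alpha>"
    from r(1) have "val \<Delta> \<mu> v = val \<Delta> \<rho> v"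
      by (induction rule: rtrancl_induct) (use v in \<open>auto simp: BVp_def\<close>)
    then show False using *(2) r(2) by (simp add: agree_def)
  qed
qed

lemma Vars_Star: "Vars (regular \<Delta>) (Star \<alpha>) \<subseteq> Vars (regular \<Delta>) \<alpha>"
  using FVp_Star[of \<Delta> \<alpha>] BVp_Star[of \<Delta> \<alpha>] unfolding Vars_def by auto

locale regular_calculus_rules = relative_calculus "regular \<Delta>" Ax R \<Gamma>
  for \<Delta> :: "('v, 'a, 'p, 'u, 's) dyn_theory" and Ax R \<Gamma> +
  assumes reg_axioms: "F \<in> reg_axioms \<Delta> \<Longrightarrow> F \<in> Ax"
    and base_Vars_finite: "p \<in> progs \<Delta> \<Longrightarrow> finite (Vars \<Delta> p)"
    and base_ext: "p \<in> progs \<Delta> \<Longrightarrow> agree \<Delta> UNIV \<mu> \<mu>' \<Longrightarrow> (\<mu>, \<omega>) \<in> prog_rel \<Delta> p \<Longrightarrow>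
      (\<mu>', \<omega>) \<in> prog_rel \<Delta> p"
begin

lemma reg_Vars_finite: "reg_wf \<Delta> \<alpha> \<Longrightarrow> finite (Vars (regular \<Delta>) \<alpha>)"
proof (induction \<alpha>)
  case (Base p)
  then show ?case using base_Vars_finite by (simp add: Vars_def FVp_Base BVp_Base)
next
  case (Test \<phi>)
  \<comment> \<open>Coincidence is known for the regular theory, so \<phi> is viewed there.\<close>
  then have "finite (FV (regular \<Delta>) (emb_reg \<phi>))" using fo_FV_finite by simp
  moreover have "FV (regular \<Delta>) (emb_reg \<phi>) = FV \<Delta> \<phi>" by (simp add: FV_def)
  ultimately show ?case using FVp_Test finite_subset by (fastforce simp: Vars_def BVp_Test)
next
  case (Seq \<alpha> \<beta>)
  then show ?case using finite_subset[OF FVp_Seq[of \<Delta> \<alpha> \<beta>]] finite_subset[OF BVp_Seq[of \<Delta> \<alpha> \<beta>]]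
    by (simp add: Vars_def)
next
  case (Choice \<alpha> \<beta>)
  then show ?case using finite_subset[OF FVp_Choice[of \<Delta> \<alpha> \<beta>]] by (simp add: Vars_def BVp_Choice)
next
  case (Star \<alpha>)
  then show ?case using finite_subset[OF Vars_Star[of \<Delta> \<alpha>]] by simp
qed

text \<open>Only the first step reads the initial state, so the loop case splits off that step; with
  no step at all, \<mu>' reaches \<omega> by agreement alone.\<close>

lemma reg_ext:
  "reg_wf \<Delta> \<alpha> \<Longrightarrow> agree \<Delta> UNIV \<mu> \<mu>' \<Longrightarrow> (\<mu>, \<omega>) \<in> reg_rel \<Delta> \<alpha> \<Longrightarrow> (\<mu>', \<omega>) \<in> reg_rel \<Delta> \<alpha>"
proof (induction \<alpha> arbitrary: \<mu> \<mu>' \<omega>)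
  case (Base p)
  then show ?case using base_ext by simp
next
  case (Test \<phi>)
  have "sat \<Delta> \<mu> \<phi> = sat \<Delta> \<mu>' \<phi>" using fo_ext[of "emb_reg \<phi>" \<mu> \<mu>'] Test.prems by simp
  then show ?case using Test.prems agree_trans[OF agree_sym[OF Test.prems(2)]] by auto
next
  case (Seq \<alpha> \<beta>)
  then show ?case by fastforce
next
  case (Choice \<alpha> \<beta>)
  then show ?case by auto
next
  case (Star \<alpha>)
  obtain \<rho> where r: "(\<mu>, \<rho>) \<in> (reg_rel \<Delta> \<alpha>)\<^sup>*" "agree \<Delta> UNIV \<rho> \<omega>" using Star.prems(3) by auto
  from r(1) show ?case
  proof (cases rule: converse_rtranclE)
    case base
    then have "agree \<Delta> UNIV \<mu>' \<omega>" using r(2) agree_trans[OF agree_sym[OF Star.prems(2)]] by simp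
    then show ?thesis by auto
  next
    case (step y)
    then have "(\<mu>', y) \<in> reg_rel \<Delta> \<alpha>" using Star by simp
    then have "(\<mu>', \<rho>) \<in> (reg_rel \<Delta> \<alpha>)\<^sup>*" using step(2) by (rule converse_rtrancl_into_rtrancl)
    then show ?thesis using r(2) by auto
  qed
qed

section \<open>Tests, compositions and choices\<close>

lemma box_reducible_Test:
  assumes "reg_wf \<Delta> (Test \<phi>)"
  shows "box_reducible (Test \<phi>)"
  unfolding box_reducible_def
proof (intro allI impI exI conjI)
  fix F assume F: "fo_fml (regular \<Delta>) F"
  show "fo_fml (regular \<Delta>) (Imp (emb_reg \<phi>) F)" using F assms by (simp add: fo_fml_def)
  show "prv (Iff (Box (Test \<phi>) F) (Imp (emb_reg \<phi>) F))"
    by (rule derives.axiom, rule reg_axioms, rule reg_axioms.test) (use F assms in \<open>auto simp: fo_fml_def\<close>)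
  \<comment> \<open>A test may end in any state with the same values, and \<open>F\<close> holds in
    all of them or in none.\<close>
  show "sat (regular \<Delta>) \<mu> (Imp (emb_reg \<phi>) F) = sat (regular \<Delta>) \<mu> (Box (Test \<phi>) F)" for \<mu>
    using fo_ext[OF F, of \<mu>] agree_refl[of \<Delta> UNIV \<mu>] by auto
qed

lemma box_reducible_Seq:
  assumes wf: "reg_wf \<Delta> \<alpha>" "reg_wf \<Delta> \<beta>" and r: "box_reducible \<alpha>" "box_reducible \<beta>"
  shows "box_reducible (Seq \<alpha> \<beta>)"
  unfolding box_reducible_def
proof (intro allI impI)
  fix F assume F: "fo_fml (regular \<Delta>) F"
  obtain G where G: "fo_fml (regular \<Delta>) G" "\<forall>\<mu>. sat (regular \<Delta>) \<mu> G = sat (regular \<Delta>) \<mu> (Box \<beta> F)"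
    "prv (Iff (Box \<beta> F) G)" using r(2) F unfolding box_reducible_def by blast
  obtain K where K: "fo_fml (regular \<Delta>) K" "\<forall>\<mu>. sat (regular \<Delta>) \<mu> K = sat (regular \<Delta>) \<mu> (Box \<alpha> G)"
    "prv (Iff (Box \<alpha> G) K)" using r(1) G(1) unfolding box_reducible_def by blast
  have wfs: "wf_fml (regular \<Delta>) F" "wf_fml (regular \<Delta>) G" "wf_fml (regular \<Delta>) K"
    using F G(1) K(1) by (auto simp: fo_fml_def)
  have "prv (Iff (Box \<alpha> (Box \<beta> F)) (Box \<alpha> G))" by (rule box_cong[OF _ G(3)]) (use wf wfs in auto)
  then have "prv (Iff (Box \<alpha> (Box \<beta> F)) K)" by (rule prv_iff_trans[OF _ K(3)]) (use wf wfs in auto)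
  moreover have "prv (Iff (Box (Seq \<alpha> \<beta>) F) (Box \<alpha> (Box \<beta> F)))"
    by (rule derives.axiom, rule reg_axioms, rule reg_axioms.seq) (use wf wfs in auto)
  ultimately have "prv (Iff (Box (Seq \<alpha> \<beta>) F) K)"
    using prv_iff_trans[of "Box (Seq \<alpha> \<beta>) F" "Box \<alpha> (Box \<beta> F)" K] wf wfs by simp
  moreover have "\<forall>\<mu>. sat (regular \<Delta>) \<mu> K = sat (regular \<Delta>) \<mu> (Box (Seq \<alpha> \<beta>) F)"
    using G(2) K(2) by auto
  ultimately show "\<exists>K. fo_fml (regular \<Delta>) K \<and>
      (\<forall>\<mu>. sat (regular \<Delta>) \<mu> K = sat (regular \<Delta>) \<mu> (Box (Seq \<alpha> \<beta>) F)) \<and>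
      prv (Iff (Box (Seq \<alpha> \<beta>) F) K)" using K(1) by blast
qed

lemma box_reducible_Choice:
  assumes wf: "reg_wf \<Delta> \<alpha>" "reg_wf \<Delta> \<beta>" and r: "box_reducible \<alpha>" "box_reducible \<beta>"
  shows "box_reducible (Choice \<alpha> \<beta>)"
  unfolding box_reducible_def
proof (intro allI impI)
  fix F assume F: "fo_fml (regular \<Delta>) F"
  obtain G where G: "fo_fml (regular \<Delta>) G" "\<forall>\<mu>. sat (regular \<Delta>) \<mu> G = sat (regular \<Delta>) \<mu> (Box \<beta> F)"
    "prv (Iff (Box \<beta> F) G)" using r(2) F unfolding box_reducible_def by blast
  obtain K where K: "fo_fml (regular \<Delta>) K" "\<forall>\<mu>. sat (regular \<Delta>) \<mu> K = sat (regular \<Delta>) \<mu> (Box \<alpha> F)"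
    "prv (Iff (Box \<alpha> F) K)" using r(1) F unfolding box_reducible_def by blast
  have wfs: "wf_fml (regular \<Delta>) F" "wf_fml (regular \<Delta>) G" "wf_fml (regular \<Delta>) K"
    using F G(1) K(1) by (auto simp: fo_fml_def)
  have "prv (Iff (Box (Choice \<alpha> \<beta>) F) (Conj (Box \<alpha> F) (Box \<beta> F)))"
    by (rule derives.axiom, rule reg_axioms, rule reg_axioms.choice) (use wf wfs in auto)
  then have "prv (Iff (Box (Choice \<alpha> \<beta>) F) (Conj K G))"
    by (rule prv_taut3[OF _ K(3) G(3)]; ((simp only: prop_eval.simps; blast) | (use wf wfs in simp)))
  moreover have "\<forall>\<mu>. sat (regular \<Delta>) \<mu> (Conj K G) = sat (regular \<Delta>) \<mu> (Box (Choice \<alpha> \<beta>) F)"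
    using G(2) K(2) by auto
  moreover have "fo_fml (regular \<Delta>) (Conj K G)" using K(1) G(1) by (simp add: fo_fml_def)
  ultimately show "\<exists>K. fo_fml (regular \<Delta>) K \<and>
      (\<forall>\<mu>. sat (regular \<Delta>) \<mu> K = sat (regular \<Delta>) \<mu> (Box (Choice \<alpha> \<beta>) F)) \<and>
      prv (Iff (Box (Choice \<alpha> \<beta>) F) K)" by blast
qed

end

text \<open>\<open>sequence_coding\<close> works with definability alone; the concrete formulas for
  positivity, equality and successor are fixed as well, because the convergence axiom mentions
  them.\<close>

locale regular_calculus_convergence =
  regular_calculus_rules \<Delta> Ax R \<Gamma> + sequence_coding "regular \<Delta>" "u2n N" "nat_vars N"
  for \<Delta> :: "('v, 'a, 'p, 'u, 's) dyn_theory" and Ax R \<Gamma> and N :: "('v, 'a, 'p, 'u) nat_data" +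
  assumes convergence_axioms: "F \<in> convergence_axioms \<Delta> N \<Longrightarrow> F \<in> Ax"
    and nat_pos: "v \<in> nat_vars N \<Longrightarrow> fo_fml \<Delta> (nat_pos N v) \<and>
      (\<forall>\<mu>. sat \<Delta> \<mu> (nat_pos N v) \<longleftrightarrow> 0 < u2n N (val \<Delta> \<mu> v))"
    and nat_eq: "v \<in> nat_vars N \<Longrightarrow> w \<in> nat_vars N \<Longrightarrow> fo_fml \<Delta> (nat_eq N v w) \<and>
      (\<forall>\<mu>. sat \<Delta> \<mu> (nat_eq N v w) \<longleftrightarrow> u2n N (val \<Delta> \<mu> v) = u2n N (val \<Delta> \<mu> w))"
    and nat_succ: "v \<in> nat_vars N \<Longrightarrow> w \<in> nat_vars N \<Longrightarrow> fo_fml \<Delta> (nat_succ N v w) \<and>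
      (\<forall>\<mu>. sat \<Delta> \<mu> (nat_succ N v w) \<longleftrightarrow> u2n N (val \<Delta> \<mu> v) + 1 = u2n N (val \<Delta> \<mu> w))"
begin

text \<open>
  The loop invariant is \<open>\<not> \<exists>v \<phi>(v)\<close> and the loop variant is \<open>\<phi>(v)\<close>, where \<open>\<phi>(v)\<close> says that some
  run of exactly \<open>v\<close> iterations violates the postcondition.
\<close>

lemma box_reducible_Star:
  assumes wf: "reg_wf \<Delta> \<alpha>" and red: "box_reducible \<alpha>"
  shows "box_reducible (Star \<alpha>)"
  unfolding box_reducible_def
proof (intro allI impI)
  fix F assume F: "fo_fml (regular \<Delta>) F"
  obtain A where A: "finite A" "\<And>\<mu> \<nu>. agree \<Delta> A \<mu> \<nu> \<Longrightarrow> sat (regular \<Delta>) \<mu> F = sat (regular \<Delta>) \<nu> F"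
    using fo_coincidence[OF F] by auto
  \<comment> \<open>\<open>undefined\<close> makes \<open>X\<close> nonempty, as
    \<open>definable_iterate\<close> demands.\<close>
  define X where "X = insert undefined (Vars (regular \<Delta>) \<alpha> \<union> A)"
  have X: "finite X" "X \<noteq> {}" using A(1) reg_Vars_finite[OF wf] by (auto simp: X_def)
  obtain v where v: "v \<in> nat_vars N" "v \<notin> X" using fresh_NV[OF X(1)] .
  obtain w where w: "w \<in> nat_vars N" "w \<notin> insert v X" using fresh_NV[of "insert v X"] X(1) by blast
  define R' where "R' = reg_rel \<Delta> \<alpha>"
  define n where "n \<mu> x = u2n N (val \<Delta> \<mu> x)" for \<mu> x
  have ext: "(\<mu>', \<omega>) \<in> R'" if "agree \<Delta> UNIV \<mu> \<mu>'" "(\<mu>, \<omega>) \<in> R'" for \<mu> \<mu>' \<omega>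
    using reg_ext[OF wf] that by (simp add: R'_def)
  have bound: "agree \<Delta> (- X) \<mu> \<omega>" if "(\<mu>, \<omega>) \<in> R'" for \<mu> \<omega>
    using that unfolding agree_def R'_def X_def Vars_def BVp_def by auto
  have single: "\<exists>\<omega>'. (\<nu>, \<omega>') \<in> R' \<and> agree \<Delta> (- {x}) \<omega> \<omega>'"
    if "x \<notin> X" "agree \<Delta> (- {x}) \<mu> \<nu>" "(\<mu>, \<omega>) \<in> R'" for x \<mu> \<nu> \<omega>
    using that unfolding R'_def X_def Vars_def FVp_def by auto
  have dia: "definable (regular \<Delta>) (\<lambda>\<mu>. \<exists>\<omega>. (\<mu>, \<omega>) \<in> R' \<and> P \<omega>)" if "definable (regular \<Delta>) P" for P
    using definable_dia[OF red that] by (simp add: R'_def)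
  define bad where "bad \<mu> k \<longleftrightarrow> (\<exists>\<omega>. (\<mu>, \<omega>) \<in> R' ^^ k \<and> \<not> sat (regular \<Delta>) \<omega> F)" for \<mu> k
  have FX: "sat (regular \<Delta>) \<mu> F = sat (regular \<Delta>) \<nu> F" if "agree \<Delta> X \<mu> \<nu>" for \<mu> \<nu>
    by (rule A(2), rule agree_mono[OF that]) (auto simp: X_def)
  have "definable (regular \<Delta>) (\<lambda>\<mu>. \<exists>\<omega>. (\<mu>, \<omega>) \<in> R' ^^ u2n N (val (regular \<Delta>) \<mu> v) \<and> \<not> sat (regular \<Delta>) \<omega> F)"
  proof (rule definable_iterate[OF X])
    show "definable (regular \<Delta>) (\<lambda>\<omega>. \<not> sat (regular \<Delta>) \<omega> F)"
      by (rule definable_not, rule definable_sat, rule F)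
  qed (use ext bound single dia FX v in \<open>auto\<close>)
  then obtain \<phi> where \<phi>: "fo_fml (regular \<Delta>) \<phi>" "\<And>\<mu>. sat (regular \<Delta>) \<mu> \<phi> \<longleftrightarrow> bad \<mu> (n \<mu> v)"
    unfolding definable_def bad_def n_def by auto
  \<comment> \<open>\<open>bad\<close> is not affected by finite changes outside \<open>X\<close>,
    such as those of the counters \<open>v\<close> and \<open>w\<close>.\<close>
  have change: "bad \<nu> k" if "finite D" "D \<inter> X = {}" "agree \<Delta> (- D) \<mu> \<nu>" "bad \<mu> k" for D \<mu> \<nu> k
  proof -
    obtain \<omega> where o: "(\<mu>, \<omega>) \<in> R' ^^ k" "\<not> sat (regular \<Delta>) \<omega> F" using \<open>bad \<mu> k\<close> by (auto simp: bad_def)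
    have "\<exists>\<omega>'. (\<nu>, \<omega>') \<in> R' ^^ k \<and> agree (regular \<Delta>) (- D) \<omega> \<omega>'"
    proof (rule finite_change_pow[OF \<open>finite D\<close> _ o(1)])
      show "agree (regular \<Delta>) (- D) \<mu> \<nu>" using \<open>agree \<Delta> (- D) \<mu> \<nu>\<close> by simp
      show "(\<mu>', \<omega>) \<in> R'" if "agree (regular \<Delta>) UNIV \<mu> \<mu>'" "(\<mu>, \<omega>) \<in> R'" for \<mu> \<mu>' \<omega>
        using ext that by simp
      show "\<exists>\<omega>'. (\<nu>, \<omega>') \<in> R' \<and> agree (regular \<Delta>) (- {x}) \<omega> \<omega>'"
        if "x \<in> D" "agree (regular \<Delta>) (- {x}) \<mu> \<nu>" "(\<mu>, \<omega>) \<in> R'" for x \<mu> \<nu> \<omega>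
      proof -
        have "x \<notin> X" using \<open>x \<in> D\<close> \<open>D \<inter> X = {}\<close> by blast
        then show ?thesis using single[OF _ _ that(3)] that(2) by simp
      qed
    qed
    then obtain \<omega>' where o': "(\<nu>, \<omega>') \<in> R' ^^ k" "agree \<Delta> (- D) \<omega> \<omega>'" by auto
    have "agree \<Delta> X \<omega> \<omega>'" by (rule agree_mono[OF o'(2)]) (use \<open>D \<inter> X = {}\<close> in auto)
    then show ?thesis using FX o(2) o'(1) by (auto simp: bad_def)
  qed
  have set_num: "\<exists>\<nu>. agree \<Delta> (- {x}) \<mu> \<nu> \<and> n \<nu> x = k" if x: "x \<in> nat_vars N" for x \<mu> k
  proof -
    obtain u where u: "u \<in> attainable (regular \<Delta>) x" "u2n N u = k" using num_attained[OF x] by blast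
    then show ?thesis using assign[of "{x}" "\<lambda>_. u" \<mu>] by (auto simp: n_def)
  qed
  have Ex: "sat (regular \<Delta>) \<mu> (Ex v \<phi>) \<longleftrightarrow> (\<exists>k. bad \<mu> k)" for \<mu>
  proof
    assume "sat (regular \<Delta>) \<mu> (Ex v \<phi>)"
    then obtain \<nu> where "agree \<Delta> (- {v}) \<mu> \<nu>" "bad \<nu> (n \<nu> v)" using \<phi>(2) by auto
    then show "\<exists>k. bad \<mu> k" using change[of "{v}" \<nu> \<mu>] v(2) agree_sym by fastforce
  next
    assume "\<exists>k. bad \<mu> k"
    then obtain k where k: "bad \<mu> k" by blast
    obtain \<nu> where nu: "agree \<Delta> (- {v}) \<mu> \<nu>" "n \<nu> v = k" using set_num v(1) by blast
    have "bad \<nu> k" by (rule change[OF _ _ nu(1) k]) (use v(2) in auto)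
    then show "sat (regular \<Delta>) \<mu> (Ex v \<phi>)" using \<phi>(2) nu by auto
  qed
  define G where "G = Neg (Ex v \<phi>)"
  have foG: "fo_fml (regular \<Delta>) G" using \<phi>(1) by (simp add: G_def fo_fml_def)
  have satG: "sat (regular \<Delta>) \<mu> G \<longleftrightarrow> \<not> (\<exists>k. bad \<mu> k)" for \<mu>
    using Ex[of \<mu>] unfolding G_def by simp
  have sem: "sat (regular \<Delta>) \<mu> G = sat (regular \<Delta>) \<mu> (Box (Star \<alpha>) F)" for \<mu>
  proof -
    have "(\<exists>\<omega>. (\<mu>, \<omega>) \<in> reg_rel \<Delta> (Star \<alpha>) \<and> \<not> sat (regular \<Delta>) \<omega> F) \<longleftrightarrow> (\<exists>k. bad \<mu> k)"
    proof
      assume "\<exists>\<omega>. (\<mu>, \<omega>) \<in> reg_rel \<Delta> (Star \<alpha>) \<and> \<not> sat (regular \<Delta>) \<omega> F"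
      then obtain \<omega> \<rho> where o: "(\<mu>, \<rho>) \<in> R'\<^sup>*" "agree \<Delta> UNIV \<rho> \<omega>" "\<not> sat (regular \<Delta>) \<omega> F"
        by (auto simp: R'_def)
      \<comment> \<open>A loop ends with a change of state that keeps all values; \<open>F\<close>
        does not notice it.\<close>
      then have "\<not> sat (regular \<Delta>) \<rho> F" using fo_ext[OF F, of \<rho> \<omega>] by simp
      then show "\<exists>k. bad \<mu> k" using rtrancl_imp_relpow[OF o(1)] unfolding bad_def by blast
    next
      assume "\<exists>k. bad \<mu> k"
      then obtain \<omega> where "(\<mu>, \<omega>) \<in> R'\<^sup>*" "\<not> sat (regular \<Delta>) \<omega> F"
        unfolding bad_def using relpow_imp_rtrancl by metis
      then show "\<exists>\<omega>. (\<mu>, \<omega>) \<in> reg_rel \<Delta> (Star \<alpha>) \<and> \<not> sat (regular \<Delta>) \<omega> F"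
        by (intro exI[of _ \<omega>]) (auto simp: R'_def intro: relcompI)
    qed
    then show ?thesis unfolding satG by auto
  qed
  have wfs: "wf_fml (regular \<Delta>) F" "wf_fml (regular \<Delta>) \<phi>" "wf_fml (regular \<Delta>) G"
    using F \<phi>(1) foG by (auto simp: fo_fml_def)
  \<comment> \<open>The first iteration is split off here, while \<open>relpow\<close> splits off
    the last.\<close>
  have bad_Suc: "bad \<mu> (Suc k) \<longleftrightarrow> (\<exists>\<nu>. (\<mu>, \<nu>) \<in> R' \<and> bad \<nu> k)" for \<mu> k
    unfolding bad_def relpow.simps relpow_commute[symmetric] by blast
  have "prv (Imp G (Box (Star \<alpha>) F))"
  proof -
    \<comment> \<open>Reducing the body at the invariant turns its preservation into a first-order
      implication.\<close>
    obtain K where K: "fo_fml (regular \<Delta>) K" "\<forall>\<mu>. sat (regular \<Delta>) \<mu> K = sat (regular \<Delta>) \<mu> (Box \<alpha> G)"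
      "prv (Iff (Box \<alpha> G) K)" using red foG unfolding box_reducible_def by blast
    have wK: "wf_fml (regular \<Delta>) K" using K(1) by (simp add: fo_fml_def)
    have "prv (Imp G K)"
    proof (rule prv_fo_imp[OF foG K(1)])
      fix \<mu> assume "sat (regular \<Delta>) \<mu> G"
      then have "\<not> bad \<mu> (Suc k)" for k using satG by blast
      then have "\<forall>\<nu>. (\<mu>, \<nu>) \<in> R' \<longrightarrow> sat (regular \<Delta>) \<nu> G" unfolding satG bad_Suc by blast
      then show "sat (regular \<Delta>) \<mu> K" using K(2) by (simp add: R'_def)
    qed
    moreover have "prv (Imp K (Box \<alpha> G))" by (rule prv_iffD2[OF K(3)]) (use wf wfs wK in auto)
    ultimately have "prv (Imp G (Box \<alpha> G))" by (rule prv_trans) (use wf wfs wK in auto)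
    then have "prv (Box (Star \<alpha>) (Imp G (Box \<alpha> G)))" by (rule derives.G[rotated]) (use wf in simp)
    moreover have "prv (Imp (Box (Star \<alpha>) (Imp G (Box \<alpha> G))) (Imp G (Box (Star \<alpha>) G)))"
      by (rule derives.axiom, rule reg_axioms, rule reg_axioms.induction) (use wf wfs in auto)
    ultimately have 1: "prv (Imp G (Box (Star \<alpha>) G))" by (rule derives.modus_ponens)
    have "prv (Imp G F)"
    proof (rule prv_fo_imp[OF foG F])
      fix \<mu> assume "sat (regular \<Delta>) \<mu> G"
      then have "\<not> bad \<mu> 0" using satG by blast
      then show "sat (regular \<Delta>) \<mu> F" by (simp add: bad_def)
    qed
    then have "prv (Imp (Box (Star \<alpha>) G) (Box (Star \<alpha>) F))"
      by (rule box_mono[rotated]) (use wf wfs in auto)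
    then show ?thesis by (rule prv_trans[OF 1]) (use wf wfs in auto)
  qed
  moreover have "prv (Imp (Box (Star \<alpha>) F) G)"
  proof -
    define pos where "pos = (emb_reg (nat_pos N v) :: ('v, 'a, ('v, 'a, 'p) reg_prog) fml)"
    define suc where "suc = (emb_reg (nat_succ N w v) :: ('v, 'a, ('v, 'a, 'p) reg_prog) fml)"
    define eq where "eq = (emb_reg (nat_eq N v w) :: ('v, 'a, ('v, 'a, 'p) reg_prog) fml)"
    have fos: "fo_fml (regular \<Delta>) pos" "fo_fml (regular \<Delta>) suc" "fo_fml (regular \<Delta>) eq"
      using nat_pos nat_succ nat_eq v(1) w(1) by (simp_all add: pos_def suc_def eq_def)
    have sats: "sat (regular \<Delta>) \<mu> pos \<longleftrightarrow> 0 < n \<mu> v" "sat (regular \<Delta>) \<mu> suc \<longleftrightarrow> n \<mu> w + 1 = n \<mu> v"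
      "sat (regular \<Delta>) \<mu> eq \<longleftrightarrow> n \<mu> v = n \<mu> w" for \<mu>
      using nat_pos nat_succ nat_eq v(1) w(1) by (simp_all add: pos_def suc_def eq_def n_def)
    \<comment> \<open>\<psi> is \<phi> at \<open>v - 1\<close> in the shape required by the
      convergence axiom; \<chi> is \<phi> at \<open>v = 0\<close>, a violation in the very state
      reached.\<close>
    define \<psi> where "\<psi> = Ex w (Conj suc (All v (Imp eq \<phi>)))"
    define \<chi> where "\<chi> = Ex v (Conj (Neg pos) \<phi>)"
    have fo': "fo_fml (regular \<Delta>) \<psi>" "fo_fml (regular \<Delta>) (Neg \<psi>)" "fo_fml (regular \<Delta>) \<chi>"
      "fo_fml (regular \<Delta>) (Neg \<chi>)" "fo_fml (regular \<Delta>) (Conj pos \<phi>)"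
      using fos \<phi>(1) by (simp_all add: \<psi>_def \<chi>_def fo_fml_def)
    then have wf': "wf_fml (regular \<Delta>) \<psi>" "wf_fml (regular \<Delta>) \<chi>" "wf_fml (regular \<Delta>) pos"
      using fos by (simp_all add: fo_fml_def)
    have wX: "w \<notin> X" "w \<noteq> v" using w(2) by auto
    have sat\<psi>: "sat (regular \<Delta>) \<mu> \<psi>" if "bad \<mu> k" "n \<mu> v = Suc k" for \<mu> k
    proof -
      obtain \<nu> where nu: "agree \<Delta> (- {w}) \<mu> \<nu>" "n \<nu> w = k" using set_num w(1) by blast
      have "n \<nu> v = Suc k" using nu(1) that(2) wX by (simp add: agree_def n_def)
      then have "sat (regular \<Delta>) \<nu> suc" using sats nu(2) by simp
      moreover have "sat (regular \<Delta>) \<rho> \<phi>"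
        if r: "agree \<Delta> (- {v}) \<nu> \<rho>" "sat (regular \<Delta>) \<rho> eq" for \<rho>
      proof -
        have "n \<rho> w = k" using r(1) nu(2) wX by (simp add: agree_def n_def)
        then have nk: "n \<rho> v = k" using r(2) sats by simp
        have "agree \<Delta> (- {v, w}) \<mu> \<rho>" using nu(1) r(1) by (simp add: agree_def)
        then have "bad \<rho> k" using change[OF _ _ _ \<open>bad \<mu> k\<close>, of "{v, w}" \<rho>] v(2) wX by simp
        then show ?thesis using \<phi>(2) nk by simp
      qed
      ultimately have "sat (regular \<Delta>) \<nu> (Conj suc (All v (Imp eq \<phi>)))" by auto
      then show ?thesis using nu(1) unfolding \<psi>_def by auto
    qed
    \<comment> \<open>A diamond is a negated box, so the reduction is applied to the postcondition
      \<open>Neg \<psi>\<close>.\<close>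
    obtain K where K: "fo_fml (regular \<Delta>) K" "\<forall>\<mu>. sat (regular \<Delta>) \<mu> K = sat (regular \<Delta>) \<mu> (Box \<alpha> (Neg \<psi>))"
      "prv (Iff (Box \<alpha> (Neg \<psi>)) K)" using red fo'(2) unfolding box_reducible_def by blast
    have wK: "wf_fml (regular \<Delta>) K" using K(1) by (simp add: fo_fml_def)
    have "prv (Imp (Conj pos \<phi>) (Neg K))"
    proof (rule prv_fo_imp[OF fo'(5)])
      show "fo_fml (regular \<Delta>) (Neg K)" using K(1) by (simp add: fo_fml_def)
      fix \<mu> assume a: "sat (regular \<Delta>) \<mu> (Conj pos \<phi>)"
      define k where "k = n \<mu> v - 1"
      have k: "n \<mu> v = Suc k" "bad \<mu> (Suc k)" using a sats \<phi>(2) by (auto simp: k_def)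
      then obtain \<nu> where nu: "(\<mu>, \<nu>) \<in> R'" "bad \<nu> k" using bad_Suc by blast
      have "n \<nu> v = Suc k" using bound[OF nu(1)] v(2) k(1) by (simp add: agree_def n_def)
      then have "sat (regular \<Delta>) \<nu> \<psi>" using sat\<psi> nu(2) by blast
      then show "sat (regular \<Delta>) \<mu> (Neg K)" using K(2) nu(1) by (auto simp: R'_def)
    qed
    then have "prv (Imp (Conj pos \<phi>) (Dia \<alpha> \<psi>))"
      by (rule prv_taut2[OF _ K(3)]; ((simp only: prop_eval.simps; blast) | (use wf wfs wf' wK in simp)))
    then have "prv (All v (Imp (Conj pos \<phi>) (Dia \<alpha> \<psi>)))" by (rule derives.all_gen)
    then have 1: "prv (Box (Star \<alpha>) (All v (Imp (Conj pos \<phi>) (Dia \<alpha> \<psi>))))"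
      by (rule derives.G[rotated]) (use wf in simp)
    have wFV: "w \<notin> FV (regular \<Delta>) \<phi>"
    proof
      assume "w \<in> FV (regular \<Delta>) \<phi>"
      then obtain \<mu> \<nu> where m: "agree \<Delta> (- {w}) \<mu> \<nu>" "bad \<mu> (n \<mu> v)" "\<not> bad \<nu> (n \<nu> v)"
        using \<phi>(2) by (auto simp: FV_def)
      have "n \<mu> v = n \<nu> v" using m(1) wX by (simp add: agree_def n_def)
      then show False using change[OF _ _ m(1,2)] m(3) wX by simp
    qed
    have "prv (Imp (Box (Star \<alpha>) (All v (Imp (Conj pos \<phi>) (Dia \<alpha> \<psi>))))
        (All v (Imp \<phi> (Dia (Star \<alpha>) \<chi>))))"
    proof (rule derives.axiom, rule convergence_axioms)
      show "Imp (Box (Star \<alpha>) (All v (Imp (Conj pos \<phi>) (Dia \<alpha> \<psi>))))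
          (All v (Imp \<phi> (Dia (Star \<alpha>) \<chi>))) \<in> convergence_axioms \<Delta> N"
        unfolding convergence_axioms_def mem_Collect_eq pos_def \<psi>_def suc_def eq_def \<chi>_def
        by (rule exI[of _ \<alpha>], rule exI[of _ \<phi>], rule exI[of _ v], rule exI[of _ w])
          (use wf wfs v w wFV in \<open>auto simp: X_def\<close>)
    qed
    from derives.modus_ponens[OF 1 this] have 2: "prv (All v (Imp \<phi> (Dia (Star \<alpha>) \<chi>)))" .
    have "prv (Imp (All v (Imp \<phi> (Dia (Star \<alpha>) \<chi>))) (Imp \<phi> (Dia (Star \<alpha>) \<chi>)))"
      by (rule derives.all_inst) (use wf wfs wf' in simp)
    from derives.modus_ponens[OF 2 this] have 3: "prv (Imp \<phi> (Dia (Star \<alpha>) \<chi>))" .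
    \<comment> \<open>A violation after zero more iterations is one in the current state, which
      \<open>F\<close> excludes. Boxed over the loop, this refutes the diamond obtained from
      convergence.\<close>
    have "prv (Imp F (Neg \<chi>))"
    proof (rule prv_fo_imp[OF F fo'(4)])
      fix \<mu> assume f: "sat (regular \<Delta>) \<mu> F"
      have False if r: "agree \<Delta> (- {v}) \<mu> \<nu>" "n \<nu> v = 0" "bad \<nu> (n \<nu> v)" for \<nu>
      proof -
        have "\<not> sat (regular \<Delta>) \<nu> F" using r(2,3) by (simp add: bad_def)
        moreover have "agree \<Delta> X \<mu> \<nu>" by (rule agree_mono[OF r(1)]) (use v(2) in auto)
        ultimately show False using f FX by blast
      qed
      then show "sat (regular \<Delta>) \<mu> (Neg \<chi>)" using sats \<phi>(2) by (auto simp: \<chi>_def)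
    qed
    then have 4: "prv (Imp (Box (Star \<alpha>) F) (Box (Star \<alpha>) (Neg \<chi>)))"
      by (rule box_mono[rotated]) (use wf wfs wf' in auto)
    have 5: "prv (Imp (Box (Star \<alpha>) F) (Neg \<phi>))"
      by (rule prv_taut2[OF 3 4]; ((simp only: prop_eval.simps; blast) | (use wf wfs wf' in simp)))
    \<comment> \<open>As \<open>Box (Star \<alpha>) F\<close> does not depend on \<open>v\<close>,
      the refutation of \<phi> can be generalized over the number of iterations.\<close>
    have "v \<notin> FV (regular \<Delta>) F"
    proof
      assume "v \<in> FV (regular \<Delta>) F"
      then obtain \<mu> \<nu> where m: "agree \<Delta> (- {v}) \<mu> \<nu>" "sat (regular \<Delta>) \<mu> F" "\<not> sat (regular \<Delta>) \<nu> F"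
        by (auto simp: FV_def)
      have "agree \<Delta> X \<mu> \<nu>" by (rule agree_mono[OF m(1)]) (use v(2) in auto)
      then show False using FX m(2,3) by blast
    qed
    then have "v \<notin> FV (regular \<Delta>) (Box (Star \<alpha>) F)"
      using FV_Box[of "regular \<Delta>" "Star \<alpha>" F] FVp_Star[of \<Delta> \<alpha>] v(2) unfolding X_def Vars_def by blast
    then have 6: "prv (Imp (Box (Star \<alpha>) F) (All v (Neg \<phi>)))"
      using all_intro[OF 5] wf wfs by simp
    show ?thesis unfolding G_def
      by (rule prv_taut1[OF 6]; ((simp only: prop_eval.simps; blast) | (use wf wfs wf' in simp)))
  qed
  ultimately have "prv (Iff (Box (Star \<alpha>) F) G)" using prv_iff wf wfs by simp
  then show "\<exists>G. fo_fml (regular \<Delta>) G \<and>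
      (\<forall>\<mu>. sat (regular \<Delta>) \<mu> G = sat (regular \<Delta>) \<mu> (Box (Star \<alpha>) F)) \<and>
      prv (Iff (Box (Star \<alpha>) F) G)" using foG sem by blast
qed

lemma box_reducible_regular:
  assumes base: "\<And>p. p \<in> progs \<Delta> \<Longrightarrow> box_reducible (Base p)"
  shows "reg_wf \<Delta> \<alpha> \<Longrightarrow> box_reducible \<alpha>"
proof (induction \<alpha>)
  case (Base p)
  then show ?case using base by simp
next
  case (Test \<phi>)
  then show ?case using box_reducible_Test by blast
next
  case (Seq \<alpha> \<beta>)
  then show ?case using box_reducible_Seq by simp
next
  case (Choice \<alpha> \<beta>)
  then show ?case using box_reducible_Choice by simp
next
  case (Star \<alpha>)
  then show ?case using box_reducible_Star by simp
qed

end

section \<open>Components of a combined theory\<close>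

lemma dynamic_theory_fo:
  assumes "dynamic_theory \<Delta>"
  shows "fo_theory \<Delta>"
  by unfold_locales (use assms in \<open>simp_all add: dynamic_theory_def\<close>)

lemma dynamic_theory_ext:
  assumes "dynamic_theory \<Delta>" "p \<in> progs \<Delta>" "agree \<Delta> UNIV \<mu> \<mu>'" "agree \<Delta> UNIV \<nu> \<nu>'"
    "(\<mu>, \<nu>) \<in> prog_rel \<Delta> p"
  shows "(\<mu>', \<nu>') \<in> prog_rel \<Delta> p"
proof -
  have "\<forall>\<mu> \<mu>' \<nu> \<nu>'. agree \<Delta> UNIV \<mu> \<mu>' \<and> agree \<Delta> UNIV \<nu> \<nu>' \<and> (\<mu>, \<nu>) \<in> prog_rel \<Delta> p \<longrightarrow>
      (\<mu>', \<nu>') \<in> prog_rel \<Delta> p"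
    using assms(1,2) unfolding dynamic_theory_def by (elim conjE) (drule (1) bspec, elim conjE)
  then show ?thesis using assms(3-5) by blast
qed

lemma eq_vec_sem:
  assumes "equality_predicate \<Delta> eq" "list_all2 (twin \<Delta>) vs ws" "vs \<noteq> []"
  shows "fo_fml \<Delta> (eq_vec eq vs ws) \<and>
    (\<forall>\<mu>. sat \<Delta> \<mu> (eq_vec eq vs ws) \<longleftrightarrow> list_all2 (\<lambda>v w. val \<Delta> \<mu> v = val \<Delta> \<mu> w) vs ws)"
  using assms(2,3)
proof (induction vs ws rule: list_all2_induct)
  case (Cons v vs w ws)
  then have vw: "fo_fml \<Delta> (eq v w)" "\<And>\<mu>. sat \<Delta> \<mu> (eq v w) \<longleftrightarrow> val \<Delta> \<mu> v = val \<Delta> \<mu> w"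
    using assms(1) by (auto simp: equality_predicate_def)
  show ?case
  proof (cases vs)
    case Nil
    then have "ws = []" using Cons.hyps(2) by simp
    then show ?thesis using Nil vw by simp
  next
    case (Cons v' vs')
    then obtain w' ws' where "ws = w' # ws'" using Cons.hyps(2) by (auto simp: list_all2_Cons1)
    then show ?thesis using Cons Cons.IH vw by (simp add: fo_fml_def)
  qed
qed simp

text \<open>The common pattern of both components, treated once: variables, atoms and programs of
  \<Theta> are renamed into \<Delta>, and \<pi> projects the states. \<open>replace\<close>
  exchanges the \<Theta>-part of a state while keeping the values of all foreign variables.\<close>

locale component = fo_theory \<Delta>
  for \<Delta> :: "('v, 'a, 'p, 'u, 's) dyn_theory" +
  fixes \<Theta> :: "('w, 'b, 'q, 'u, 't) dyn_theory"
    and i :: "'w \<Rightarrow> 'v" and f :: "'b \<Rightarrow> 'a" and q :: "'q \<Rightarrow> 'p" and \<pi> :: "'s \<Rightarrow> 't"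
  assumes dynamic: "dynamic_theory \<Theta>"
    and inj_i: "inj i"
    and val_i: "val \<Delta> \<mu> (i v) = val \<Theta> (\<pi> \<mu>) v"
    and replace: "\<exists>\<nu>. \<pi> \<nu> = \<rho> \<and> (\<forall>x. x \<notin> range i \<longrightarrow> val \<Delta> \<nu> x = val \<Delta> \<mu> x)"
    and atoms_f: "b \<in> atoms \<Theta> \<Longrightarrow> f b \<in> atoms \<Delta>"
    and eval_f: "\<mu> \<in> atom_eval \<Delta> (f b) \<longleftrightarrow> \<pi> \<mu> \<in> atom_eval \<Theta> b"
    and progs_q: "p \<in> progs \<Theta> \<Longrightarrow> q p \<in> progs \<Delta>"
    and rel_q: "(\<mu>, \<nu>) \<in> prog_rel \<Delta> (q p) \<longleftrightarrow> (\<pi> \<mu>, \<pi> \<nu>) \<in> prog_rel \<Theta> p \<and>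
      (\<forall>x. x \<notin> range i \<longrightarrow> val \<Delta> \<mu> x = val \<Delta> \<nu> x)"
begin

definition emb :: "('w, 'b, 'q) fml \<Rightarrow> ('v, 'a, 'p) fml" where
  "emb = map_fml i f q"

lemma emb_simps [simp]:
  "emb (Atom b) = Atom (f b)" "emb (Neg F) = Neg (emb F)" "emb (Conj F G) = Conj (emb F) (emb G)"
  "emb (All v F) = All (i v) (emb F)" "emb (Box p F) = Box (q p) (emb F)"
  by (simp_all add: emb_def)

lemma agree_i:
  "agree \<Delta> (- {i v}) \<mu> \<nu> \<longleftrightarrow> agree \<Theta> (- {v}) (\<pi> \<mu>) (\<pi> \<nu>) \<and>
    (\<forall>x. x \<notin> range i \<longrightarrow> val \<Delta> \<mu> x = val \<Delta> \<nu> x)"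
proof (intro iffI conjI allI impI)
  assume a: "agree \<Delta> (- {i v}) \<mu> \<nu>"
  show "agree \<Theta> (- {v}) (\<pi> \<mu>) (\<pi> \<nu>)"
    unfolding agree_def
  proof
    fix w assume "w \<in> - {v}"
    then have "i w \<in> - {i v}" using inj_i by (auto dest: injD)
    then have "val \<Delta> \<mu> (i w) = val \<Delta> \<nu> (i w)" using a by (simp add: agree_def)
    then show "val \<Theta> (\<pi> \<mu>) w = val \<Theta> (\<pi> \<nu>) w" by (simp add: val_i)
  qed
  show "val \<Delta> \<mu> x = val \<Delta> \<nu> x" if "x \<notin> range i" for x
    using a that by (auto simp: agree_def)
next
  assume a: "agree \<Theta> (- {v}) (\<pi> \<mu>) (\<pi> \<nu>) \<and> (\<forall>x. x \<notin> range i \<longrightarrow> val \<Delta> \<mu> x = val \<Delta> \<nu> x)"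
  show "agree \<Delta> (- {i v}) \<mu> \<nu>"
    unfolding agree_def
  proof
    fix x assume x: "x \<in> - {i v}"
    show "val \<Delta> \<mu> x = val \<Delta> \<nu> x"
    proof (cases "x \<in> range i")
      case True
      then obtain w where "x = i w" by blast
      then show ?thesis using a x by (auto simp: val_i agree_def)
    qed (use a in blast)
  qed
qed

text \<open>A \<Theta>-state reached by a quantifier or a program is lifted by
  \<open>replace\<close> with the foreign values kept, which is what the embedded quantifier or
  program permits.\<close>

lemma sat_emb: "sat \<Delta> \<mu> (emb F) = sat \<Theta> (\<pi> \<mu>) F"
proof (induction F arbitrary: \<mu>)
  case (Atom a)
  then show ?case by (simp add: eval_f)
next
  case (All v F)
  have "(\<forall>\<nu>. agree \<Delta> (- {i v}) \<mu> \<nu> \<longrightarrow> sat \<Theta> (\<pi> \<nu>) F) =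
      (\<forall>\<rho>. agree \<Theta> (- {v}) (\<pi> \<mu>) \<rho> \<longrightarrow> sat \<Theta> \<rho> F)"
    using replace[of _ \<mu>] by (metis agree_i)
  then show ?case using All by simp
next
  case (Box p F)
  have "(\<forall>\<nu>. (\<mu>, \<nu>) \<in> prog_rel \<Delta> (q p) \<longrightarrow> sat \<Theta> (\<pi> \<nu>) F) =
      (\<forall>\<rho>. (\<pi> \<mu>, \<rho>) \<in> prog_rel \<Theta> p \<longrightarrow> sat \<Theta> \<rho> F)"
    using replace[of _ \<mu>] by (metis rel_q)
  then show ?case using Box by simp
qed simp_all

lemma wf_emb: "wf_fml \<Theta> F \<Longrightarrow> wf_fml \<Delta> (emb F)"
  by (induction F) (auto simp: atoms_f progs_q)

lemma first_order_emb: "first_order (emb F) = first_order F"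
  by (induction F) auto

lemma fo_emb: "fo_fml \<Theta> F \<Longrightarrow> fo_fml \<Delta> (emb F)"
  by (simp add: fo_fml_def wf_emb first_order_emb)

lemma attainable_i: "attainable \<Delta> (i v) = attainable \<Theta> v"
proof
  show "attainable \<Delta> (i v) \<subseteq> attainable \<Theta> v" by (auto simp: attainable_def val_i)
  show "attainable \<Theta> v \<subseteq> attainable \<Delta> (i v)"
  proof
    fix u assume "u \<in> attainable \<Theta> v"
    then obtain \<rho> where r: "u = val \<Theta> \<rho> v" by (auto simp: attainable_def)
    obtain \<nu> where "\<pi> \<nu> = \<rho>" using replace by blast
    then have "u = val \<Delta> \<nu> (i v)" using r by (simp add: val_i)
    then show "u \<in> attainable \<Delta> (i v)" by (auto simp: attainable_def)
  qed
qed

lemma twin_i: "twin \<Delta> (i v) (i w) = twin \<Theta> v w"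
  by (simp add: twin_def attainable_i)

lemma twins_infinite_i:
  assumes "infinite {w. twin \<Theta> v w}"
  shows "infinite {x. twin \<Delta> (i v) x}"
proof
  assume "finite {x. twin \<Delta> (i v) x}"
  then have "finite (i ` {w. twin \<Theta> v w})" by (rule finite_subset[rotated]) (auto simp: twin_i)
  then show False using assms finite_imageD[OF _ inj_on_subset[OF inj_i subset_UNIV]] by blast
qed

lemma ext_q:
  assumes "p \<in> progs \<Theta>" "agree \<Delta> UNIV \<mu> \<mu>'" "(\<mu>, \<omega>) \<in> prog_rel \<Delta> (q p)"
  shows "(\<mu>', \<omega>) \<in> prog_rel \<Delta> (q p)"
proof -
  have "agree \<Theta> UNIV (\<pi> \<mu>) (\<pi> \<mu>')" using assms(2) by (simp add: agree_def flip: val_i)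
  then have "(\<pi> \<mu>', \<pi> \<omega>) \<in> prog_rel \<Theta> p"
    using dynamic_theory_ext[OF dynamic assms(1) _ agree_refl] assms(3) rel_q by blast
  then show ?thesis using assms(2,3) by (simp add: rel_q agree_def)
qed

text \<open>Programs of \<Theta> pass foreign values on unchanged, so foreign variables are neither
  free nor bound; for the others a witness projects to \<Theta>.\<close>

lemma Vars_q:
  assumes p: "p \<in> progs \<Theta>"
  shows "Vars \<Delta> (q p) \<subseteq> i ` Vars \<Theta> p"
proof -
  have "x \<in> i ` FVp \<Theta> p" if "x \<in> FVp \<Delta> (q p)" for x
  proof -
    from that obtain \<mu> \<nu> \<omega> where *: "agree \<Delta> (- {x}) \<mu> \<nu>" "(\<mu>, \<omega>) \<in> prog_rel \<Delta> (q p)"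
      "\<not> (\<exists>\<omega>'. (\<nu>, \<omega>') \<in> prog_rel \<Delta> (q p) \<and> agree \<Delta> (- {x}) \<omega> \<omega>')"
      unfolding FVp_def by blast
    have rel: "(\<pi> \<mu>, \<pi> \<omega>) \<in> prog_rel \<Theta> p" "\<And>y. y \<notin> range i \<Longrightarrow> val \<Delta> \<mu> y = val \<Delta> \<omega> y"
      using *(2) rel_q by blast+
    show ?thesis
    proof (cases "x \<in> range i")
      case False
      have "val \<Delta> \<mu> (i w) = val \<Delta> \<nu> (i w)" for w using *(1) False by (auto simp: agree_def)
      then have "agree \<Theta> UNIV (\<pi> \<mu>) (\<pi> \<nu>)" by (simp add: agree_def val_i)
      \<comment> \<open>A foreign change is invisible to \<Theta> up to a state with equal values;
        extensionality then allows the same end state.\<close>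
      then have r: "(\<pi> \<nu>, \<pi> \<omega>) \<in> prog_rel \<Theta> p"
        using dynamic_theory_ext[OF dynamic p _ agree_refl rel(1)] by blast
      obtain \<omega>' where w': "\<pi> \<omega>' = \<pi> \<omega>" "\<forall>y. y \<notin> range i \<longrightarrow> val \<Delta> \<omega>' y = val \<Delta> \<nu> y"
        using replace by blast
      have "(\<nu>, \<omega>') \<in> prog_rel \<Delta> (q p)" using r w' by (simp add: rel_q)
      moreover have "val \<Delta> \<omega> y = val \<Delta> \<omega>' y" if y: "y \<noteq> x" for y
      proof (cases "y \<in> range i")
        case True
        then show ?thesis using w'(1) by (auto simp: val_i)
      next
        case False
        moreover have "val \<Delta> \<mu> y = val \<Delta> \<nu> y" using *(1) y by (simp add: agree_def)
        ultimately show ?thesis using w'(2) rel(2) by simp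
      qed
      ultimately show ?thesis using *(3) by (auto simp: agree_def)
    next
      case True
      then obtain w where w: "x = i w" by blast
      have "w \<in> FVp \<Theta> p"
      proof (rule ccontr)
        assume "w \<notin> FVp \<Theta> p"
        moreover have "agree \<Theta> (- {w}) (\<pi> \<mu>) (\<pi> \<nu>)" using *(1) agree_i w by simp
        ultimately obtain \<rho> where r: "(\<pi> \<nu>, \<rho>) \<in> prog_rel \<Theta> p" "agree \<Theta> (- {w}) (\<pi> \<omega>) \<rho>"
          using rel(1) unfolding FVp_def by blast
        obtain \<omega>' where w': "\<pi> \<omega>' = \<rho>" "\<forall>y. y \<notin> range i \<longrightarrow> val \<Delta> \<omega>' y = val \<Delta> \<nu> y"
          using replace by blast
        have "(\<nu>, \<omega>') \<in> prog_rel \<Delta> (q p)" using r w' by (simp add: rel_q)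
        moreover have "val \<Delta> \<omega> y = val \<Delta> \<omega>' y" if y: "y \<notin> range i" for y
        proof -
          have "val \<Delta> \<mu> y = val \<Delta> \<nu> y" using *(1) y w agree_i by blast
          then show ?thesis using w'(2) rel(2) y by simp
        qed
        ultimately show False using *(3) r(2) w'(1) w agree_i by blast
      qed
      then show ?thesis using w by blast
    qed
  qed
  moreover have "x \<in> i ` BVp \<Theta> p" if "x \<in> BVp \<Delta> (q p)" for x
  proof -
    from that obtain \<mu> \<omega> where *: "(\<mu>, \<omega>) \<in> prog_rel \<Delta> (q p)" "val \<Delta> \<mu> x \<noteq> val \<Delta> \<omega> x"
      unfolding BVp_def by blast
    then have "x \<in> range i" using rel_q by blast
    then obtain w where "x = i w" by blast
    then show ?thesis using * by (auto simp: BVp_def rel_q val_i)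
  qed
  ultimately show ?thesis unfolding Vars_def by blast
qed

section \<open>Numbers and sequence codes of a component\<close>

lemma counting_component:
  assumes "goedel_expressive \<Theta> N"
  shows "counting \<Delta> (u2n N) (i ` nat_vars N)"
proof -
  have ind: "infinite (nat_vars N)" "\<And>v. v \<in> nat_vars N \<Longrightarrow> u2n N ` attainable \<Theta> v = UNIV"
    "\<And>v. v \<in> nat_vars N \<Longrightarrow> fo_fml \<Theta> (nat_pos N v) \<and> (\<forall>\<mu>. sat \<Theta> \<mu> (nat_pos N v) \<longleftrightarrow> 0 < u2n N (val \<Theta> \<mu> v))"
    "\<And>v w. v \<in> nat_vars N \<Longrightarrow> w \<in> nat_vars N \<Longrightarrow> fo_fml \<Theta> (nat_eq N v w) \<and>
      (\<forall>\<mu>. sat \<Theta> \<mu> (nat_eq N v w) \<longleftrightarrow> u2n N (val \<Theta> \<mu> v) = u2n N (val \<Theta> \<mu> w))"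
    "\<And>v w. v \<in> nat_vars N \<Longrightarrow> w \<in> nat_vars N \<Longrightarrow> fo_fml \<Theta> (nat_succ N v w) \<and>
      (\<forall>\<mu>. sat \<Theta> \<mu> (nat_succ N v w) \<longleftrightarrow> u2n N (val \<Theta> \<mu> v) + 1 = u2n N (val \<Theta> \<mu> w))"
    using assms unfolding goedel_expressive_def inductively_expressive_def by simp_all
  obtain nat_less where less: "\<And>v w. v \<in> nat_vars N \<Longrightarrow> w \<in> nat_vars N \<Longrightarrow> fo_fml \<Theta> (nat_less v w) \<and>
        (\<forall>\<mu>. sat \<Theta> \<mu> (nat_less v w) \<longleftrightarrow> u2n N (val \<Theta> \<mu> v) < u2n N (val \<Theta> \<mu> w))"
    using assms unfolding goedel_expressive_def by blast
  have def_emb: "definable \<Delta> P" if "fo_fml \<Theta> F" "\<And>\<mu>. sat \<Theta> (\<pi> \<mu>) F = P \<mu>" for F P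
    unfolding definable_def using that fo_emb sat_emb by blast
  show ?thesis
  proof unfold_locales
    show "infinite (i ` nat_vars N)"
      using ind(1) finite_imageD[OF _ inj_on_subset[OF inj_i subset_UNIV]] by blast
    fix x assume "x \<in> i ` nat_vars N"
    then obtain v where v: "v \<in> nat_vars N" "x = i v" by blast
    show "u2n N ` attainable \<Delta> x = UNIV" using ind(2) v by (simp add: attainable_i)
    show "definable \<Delta> (\<lambda>\<mu>. 0 < u2n N (val \<Delta> \<mu> x))"
      using ind(3)[OF v(1)] by (intro def_emb[of "nat_pos N v"]) (auto simp: v(2) val_i)
    fix y assume "y \<in> i ` nat_vars N"
    then obtain w where w: "w \<in> nat_vars N" "y = i w" by blast
    show "definable \<Delta> (\<lambda>\<mu>. u2n N (val \<Delta> \<mu> x) = u2n N (val \<Delta> \<mu> y))"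
      using ind(4)[OF v(1) w(1)] by (intro def_emb[of "nat_eq N v w"]) (auto simp: v(2) w(2) val_i)
    show "definable \<Delta> (\<lambda>\<mu>. u2n N (val \<Delta> \<mu> x) + 1 = u2n N (val \<Delta> \<mu> y))"
      using ind(5)[OF v(1) w(1)] by (intro def_emb[of "nat_succ N v w"]) (auto simp: v(2) w(2) val_i)
    show "definable \<Delta> (\<lambda>\<mu>. u2n N (val \<Delta> \<mu> x) < u2n N (val \<Delta> \<mu> y))"
      using less[OF v(1) w(1)] by (intro def_emb[of "nat_less v w"]) (auto simp: v(2) w(2) val_i)
  qed
qed

text \<open>
  A decoding formula is only specified for one tuple of variables at a time, and its code may depend
  on that tuple.  So a single tuple is fixed, and other arguments are copied into it; the set \<open>A\<close>
  contains the tuple and whatever else the formula may read.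
\<close>

lemma decoder_component:
  assumes sup: "supports_goedelization \<Theta> N x"
    and N: "infinite (nat_vars N)" "\<And>v. v \<in> nat_vars N \<Longrightarrow> u2n N ` attainable \<Theta> v = UNIV"
    and twins: "\<And>v. infinite {w. twin \<Theta> v w}"
    and link: "\<And>n c. n \<in> nat_vars N \<Longrightarrow> c \<in> NV \<Longrightarrow>
      definable \<Delta> (\<lambda>\<mu>. u2n N (val \<Delta> \<mu> (i n)) = num (val \<Delta> \<mu> c))"
    and eq: "\<And>y z. twin \<Delta> y z \<Longrightarrow> definable \<Delta> (\<lambda>\<mu>. val \<Delta> \<mu> y = val \<Delta> \<mu> z)"
  shows "\<exists>w dec A. sequence_decoder \<Delta> num NV (i x) w dec A"
proof -
  obtain w G where wG: "\<forall>w' n j v'. twin \<Theta> w w' \<and> twin \<Theta> x v' \<and> n \<in> nat_vars N \<and> j \<in> nat_vars N \<and>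
        distinct [w', n, j, v'] \<longrightarrow> fo_fml \<Theta> (G w' n j v') \<and>
        (\<forall>us. set us \<subseteq> attainable \<Theta> x \<longrightarrow> (\<exists>z\<in>attainable \<Theta> w. \<forall>\<mu>.
              val \<Theta> \<mu> w' = z \<and> u2n N (val \<Theta> \<mu> n) = length us \<and>
              1 \<le> u2n N (val \<Theta> \<mu> j) \<and> u2n N (val \<Theta> \<mu> j) \<le> length us \<longrightarrow>
              (sat \<Theta> \<mu> (G w' n j v') \<longleftrightarrow> val \<Theta> \<mu> v' = us ! (u2n N (val \<Theta> \<mu> j) - 1))))"
    using sup unfolding supports_goedelization_def by (elim exE)
  interpret \<Theta>: fo_theory \<Theta> by (rule dynamic_theory_fo[OF dynamic])
  obtain n where n: "n \<in> nat_vars N" using N(1) infinite_imp_nonempty by blast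
  have "infinite (nat_vars N - {n})" using N(1) by simp
  then obtain j where j: "j \<in> nat_vars N" "j \<noteq> n" using infinite_imp_nonempty by blast
  obtain g where g: "twin \<Theta> w g" "g \<notin> {n, j}" using \<Theta>.fresh_twin[OF twins, of "{n, j}"] by blast
  obtain y where y: "twin \<Theta> x y" "y \<notin> {n, j, g}" using \<Theta>.fresh_twin[OF twins, of "{n, j, g}"] by blast
  have dist: "distinct [g, n, j, y]" using j g y by auto
  define E where "E = emb (G g n j y)"
  have Gfo: "fo_fml \<Theta> (G g n j y)" using wG g(1) y(1) n j(1) dist by blast
  have code: "\<exists>z\<in>attainable \<Theta> w. \<forall>\<mu>.
              val \<Theta> \<mu> g = z \<and> u2n N (val \<Theta> \<mu> n) = length us \<and>
              1 \<le> u2n N (val \<Theta> \<mu> j) \<and> u2n N (val \<Theta> \<mu> j) \<le> length us \<longrightarrow>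
              (sat \<Theta> \<mu> (G g n j y) \<longleftrightarrow> val \<Theta> \<mu> y = us ! (u2n N (val \<Theta> \<mu> j) - 1))"
    if "set us \<subseteq> attainable \<Theta> x" for us
    using wG g(1) y(1) n j(1) dist that by blast
  have E: "fo_fml \<Delta> E" using Gfo by (simp add: E_def fo_emb)
  obtain A0 where A0: "finite A0" "\<And>\<mu> \<nu>. agree \<Delta> A0 \<mu> \<nu> \<Longrightarrow> sat \<Delta> \<mu> E = sat \<Delta> \<nu> E"
    using fo_coincidence[OF E] by blast
  define A where "A = A0 \<union> {i g, i n, i j, i y}"
  have A: "finite A" using A0(1) by (simp add: A_def)
  \<comment> \<open>Reading is made a relation between values, with some state as intermediary; this
    frees it from the variables that carry the arguments.\<close>
  define dec where "dec z m k u \<longleftrightarrow> (\<exists>\<mu>. val \<Delta> \<mu> (i g) = z \<and> u2n N (val \<Delta> \<mu> (i n)) = m \<and>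
      u2n N (val \<Delta> \<mu> (i j)) = k \<and> val \<Delta> \<mu> (i y) = u \<and> sat \<Delta> \<mu> E)" for z m k u
  have 1: "definable \<Delta> (\<lambda>\<mu>. dec (val \<Delta> \<mu> g') (num (val \<Delta> \<mu> c)) (num (val \<Delta> \<mu> d)) (val \<Delta> \<mu> y'))"
    if h: "twin \<Delta> (i w) g'" "twin \<Delta> (i x) y'" "c \<in> NV" "d \<in> NV" "{g', y', c, d} \<inter> A = {}" for g' y' c d
  proof -
    define P where "P \<nu> \<longleftrightarrow> val \<Delta> \<nu> (i g) = val \<Delta> \<nu> g' \<and> u2n N (val \<Delta> \<nu> (i n)) = num (val \<Delta> \<nu> c) \<and>
        u2n N (val \<Delta> \<nu> (i j)) = num (val \<Delta> \<nu> d) \<and> val \<Delta> \<nu> (i y) = val \<Delta> \<nu> y' \<and> sat \<Delta> \<nu> E" for \<nu>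
    have tw: "twin \<Delta> (i g) g'" "twin \<Delta> (i y) y'"
      using h(1,2) g(1) y(1) by (auto simp: twin_def attainable_i)
    have defP: "definable \<Delta> P"
      unfolding P_def by (intro definable_conj eq tw link n j(1) h(3,4) definable_sat E)
    \<comment> \<open>\<nu> takes the values of the witness on \<open>A\<close>, while the arguments
      outside \<open>A\<close> stay in place and are copied by \<open>eq\<close> and
      \<open>link\<close>. The twins may be foreign to \<Theta>, so \<open>eq\<close> has to cover
      all pairs of twins of \<Delta>.\<close>
    have "dec (val \<Delta> \<mu> g') (num (val \<Delta> \<mu> c)) (num (val \<Delta> \<mu> d)) (val \<Delta> \<mu> y') \<longleftrightarrow>
        (\<exists>\<nu>. agree \<Delta> (- A) \<mu> \<nu> \<and> P \<nu>)" for \<mu>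
    proof
      assume "dec (val \<Delta> \<mu> g') (num (val \<Delta> \<mu> c)) (num (val \<Delta> \<mu> d)) (val \<Delta> \<mu> y')"
      then obtain \<rho> where r: "val \<Delta> \<rho> (i g) = val \<Delta> \<mu> g'" "u2n N (val \<Delta> \<rho> (i n)) = num (val \<Delta> \<mu> c)"
        "u2n N (val \<Delta> \<rho> (i j)) = num (val \<Delta> \<mu> d)" "val \<Delta> \<rho> (i y) = val \<Delta> \<mu> y'" "sat \<Delta> \<rho> E"
        by (auto simp: dec_def)
      obtain \<nu> where nu: "\<forall>v. val \<Delta> \<nu> v = (if v \<in> A then val \<Delta> \<rho> v else val \<Delta> \<mu> v)"
        using interpolate[of A \<rho> \<mu>] by blast
      have "agree \<Delta> A0 \<rho> \<nu>" using nu by (simp add: agree_def A_def)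
      then have "sat \<Delta> \<nu> E" using A0(2) r(5) by blast
      moreover have "i g \<in> A" "i n \<in> A" "i j \<in> A" "i y \<in> A" "g' \<notin> A" "y' \<notin> A" "c \<notin> A" "d \<notin> A"
        using h(5) by (auto simp: A_def)
      ultimately have "P \<nu>" using nu r by (simp add: P_def)
      moreover have "agree \<Delta> (- A) \<mu> \<nu>" using nu by (simp add: agree_def)
      ultimately show "\<exists>\<nu>. agree \<Delta> (- A) \<mu> \<nu> \<and> P \<nu>" by blast
    next
      assume "\<exists>\<nu>. agree \<Delta> (- A) \<mu> \<nu> \<and> P \<nu>"
      then obtain \<nu> where nu: "agree \<Delta> (- A) \<mu> \<nu>" "P \<nu>" by blast
      have "val \<Delta> \<nu> g' = val \<Delta> \<mu> g'" "val \<Delta> \<nu> y' = val \<Delta> \<mu> y'" "val \<Delta> \<nu> c = val \<Delta> \<mu> c"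
        "val \<Delta> \<nu> d = val \<Delta> \<mu> d"
        using nu(1) h(5) by (auto simp: agree_def)
      then show "dec (val \<Delta> \<mu> g') (num (val \<Delta> \<mu> c)) (num (val \<Delta> \<mu> d)) (val \<Delta> \<mu> y')"
        using nu(2) unfolding dec_def P_def by (intro exI[of _ \<nu>]) simp
    qed
    then show ?thesis using definable_exs[OF A defP] by simp
  qed
  \<comment> \<open>The variable \<open>i x\<close> itself may lie in \<open>A\<close>, so its value
    is handed over through a fresh twin \<open>y'\<close>.\<close>
  have 2: "definable \<Delta> (\<lambda>\<mu>. dec (val \<Delta> \<mu> g') (num (val \<Delta> \<mu> c)) (num (val \<Delta> \<mu> d)) (val \<Delta> \<mu> (i x)))"
    if h: "twin \<Delta> (i w) g'" "g' \<notin> A" "c \<in> NV - A" "d \<in> NV - A" for g' c d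
  proof -
    have fin: "finite (A \<union> {i x, g', c, d})" using A by simp
    obtain y' where y': "twin \<Delta> (i x) y'" "y' \<notin> A \<union> {i x, g', c, d}"
      using fresh_twin[OF twins_infinite_i[OF twins] fin] .
    define P where "P \<nu> \<longleftrightarrow> val \<Delta> \<nu> (i x) = val \<Delta> \<nu> y' \<and>
        dec (val \<Delta> \<nu> g') (num (val \<Delta> \<nu> c)) (num (val \<Delta> \<nu> d)) (val \<Delta> \<nu> y')" for \<nu>
    have defP: "definable \<Delta> P"
      unfolding P_def by (rule definable_conj[OF eq[OF y'(1)] 1]) (use h y' in auto)
    have "dec (val \<Delta> \<mu> g') (num (val \<Delta> \<mu> c)) (num (val \<Delta> \<mu> d)) (val \<Delta> \<mu> (i x)) \<longleftrightarrow>
        (\<exists>\<nu>. agree \<Delta> (- {y'}) \<mu> \<nu> \<and> P \<nu>)" for \<mu>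
    proof -
      have same: "val \<Delta> \<nu> g' = val \<Delta> \<mu> g'" "val \<Delta> \<nu> c = val \<Delta> \<mu> c" "val \<Delta> \<nu> d = val \<Delta> \<mu> d"
        "val \<Delta> \<nu> (i x) = val \<Delta> \<mu> (i x)" if "agree \<Delta> (- {y'}) \<mu> \<nu>" for \<nu>
        using that y'(2) by (auto simp: agree_def)
      have "val \<Delta> \<mu> (i x) \<in> attainable \<Delta> y'" using y'(1) by (auto simp: twin_def attainable_def)
      then obtain \<nu> where nu: "agree \<Delta> (- {y'}) \<mu> \<nu>" "val \<Delta> \<nu> y' = val \<Delta> \<mu> (i x)"
        using assign[of "{y'}" "\<lambda>_. val \<Delta> \<mu> (i x)" \<mu>] by auto
      show ?thesis
      proof
        assume "dec (val \<Delta> \<mu> g') (num (val \<Delta> \<mu> c)) (num (val \<Delta> \<mu> d)) (val \<Delta> \<mu> (i x))"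
        then have "P \<nu>" using same[OF nu(1)] nu(2) by (simp add: P_def)
        then show "\<exists>\<nu>. agree \<Delta> (- {y'}) \<mu> \<nu> \<and> P \<nu>" using nu(1) by blast
      next
        assume "\<exists>\<nu>. agree \<Delta> (- {y'}) \<mu> \<nu> \<and> P \<nu>"
        then obtain \<nu> where m: "agree \<Delta> (- {y'}) \<mu> \<nu>" "P \<nu>" by blast
        then show "dec (val \<Delta> \<mu> g') (num (val \<Delta> \<mu> c)) (num (val \<Delta> \<mu> d)) (val \<Delta> \<mu> (i x))"
          using same[OF m(1)] by (simp add: P_def)
      qed
    qed
    then show ?thesis using definable_exs[of "{y'}", OF _ defP] by simp
  qed
  have 3: "\<exists>z\<in>attainable \<Delta> (i w). \<forall>k u. 1 \<le> k \<and> k \<le> length us \<and> u \<in> attainable \<Delta> (i x) \<longrightarrow>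
      (dec z (length us) k u \<longleftrightarrow> u = us ! (k - 1))" if us: "set us \<subseteq> attainable \<Delta> (i x)" for us
  proof -
    have "set us \<subseteq> attainable \<Theta> x" using us by (simp add: attainable_i)
    from code[OF this] obtain z where z: "z \<in> attainable \<Theta> w"
      "\<And>\<mu>. val \<Theta> \<mu> g = z \<Longrightarrow> u2n N (val \<Theta> \<mu> n) = length us \<Longrightarrow> 1 \<le> u2n N (val \<Theta> \<mu> j) \<Longrightarrow>
        u2n N (val \<Theta> \<mu> j) \<le> length us \<Longrightarrow>
        sat \<Theta> \<mu> (G g n j y) \<longleftrightarrow> val \<Theta> \<mu> y = us ! (u2n N (val \<Theta> \<mu> j) - 1)"
      by blast
    have z': "sat \<Delta> \<mu> E \<longleftrightarrow> val \<Delta> \<mu> (i y) = us ! (k - 1)"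
      if "val \<Delta> \<mu> (i g) = z" "u2n N (val \<Delta> \<mu> (i n)) = length us" "u2n N (val \<Delta> \<mu> (i j)) = k"
        "1 \<le> k" "k \<le> length us" for \<mu> k
      using z(2)[of "\<pi> \<mu>"] that by (simp add: E_def sat_emb val_i)
    have "dec z (length us) k u \<longleftrightarrow> u = us ! (k - 1)"
      if k: "1 \<le> k" "k \<le> length us" and u: "u \<in> attainable \<Delta> (i x)" for k u
    proof
      assume "dec z (length us) k u"
      then show "u = us ! (k - 1)" unfolding dec_def using z' k by auto
    next
      assume uk: "u = us ! (k - 1)"
      \<comment> \<open>Every number is attained, so a state with the given code, length, position
        and entry exists; it witnesses \<open>dec\<close>.\<close>
      obtain un where un: "un \<in> attainable \<Theta> n" "u2n N un = length us"
        using N(2)[OF n] by (metis UNIV_I imageE)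
      obtain uj where uj: "uj \<in> attainable \<Theta> j" "u2n N uj = k"
        using N(2)[OF j(1)] by (metis UNIV_I imageE)
      define h where "h v = (if v = i g then z else if v = i n then un else if v = i j then uj else u)" for v
      have inj: "i g \<noteq> i n" "i g \<noteq> i j" "i g \<noteq> i y" "i n \<noteq> i j" "i n \<noteq> i y" "i j \<noteq> i y"
        using dist inj_i by (auto dest: injD)
      have "h v \<in> attainable \<Delta> v" if "v \<in> {i g, i n, i j, i y}" for v
        using that z(1) un(1) uj(1) u g(1) y(1) inj
        by (auto simp: h_def attainable_i twin_def)
      then obtain \<mu> where mu: "\<forall>v\<in>{i g, i n, i j, i y}. val \<Delta> \<mu> v = h v"
        using assign[of "{i g, i n, i j, i y}" h] by blast
      have vals: "val \<Delta> \<mu> (i g) = z" "val \<Delta> \<mu> (i n) = un" "val \<Delta> \<mu> (i j) = uj" "val \<Delta> \<mu> (i y) = u"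
        using mu inj by (simp_all add: h_def)
      then have "sat \<Delta> \<mu> E" using z' un(2) uj(2) k uk by simp
      then show "dec z (length us) k u" unfolding dec_def using vals un(2) uj(2) by blast
    qed
    moreover have "z \<in> attainable \<Delta> (i w)" using z(1) by (simp add: attainable_i)
    ultimately show ?thesis by blast
  qed
  have "sequence_decoder \<Delta> num NV (i x) (i w) dec A"
    unfolding sequence_decoder_def using A 2 3 by blast
  then show ?thesis by blast
qed

end

text \<open>\<open>prv_emb\<close> is the form in which relative completeness of the component
  calculus is used: embedded validities are derivable.\<close>

locale component_calculus = component \<Delta> \<Theta> i f q \<pi> + relative_calculus \<Delta> Ax R \<Gamma>
  for \<Delta> :: "('v, 'a, 'p, 'u, 's) dyn_theory" and \<Theta> :: "('w, 'b, 'q, 'u, 't) dyn_theory"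
    and i f q \<pi> Ax R \<Gamma> +
  assumes prv_emb: "wf_fml \<Theta> F \<Longrightarrow> valid \<Theta> F \<Longrightarrow> derives \<Delta> Ax R \<Gamma> (map_fml i f q F)"
    and expressive: "fol_expressive \<Theta>"
    and support: "finite_support \<Theta>"
begin

lemma box_reducible_component:
  assumes p: "p \<in> progs \<Theta>"
  shows "box_reducible (q p)"
proof -
  interpret \<Theta>: fo_theory \<Theta> by (rule dynamic_theory_fo[OF dynamic])
  \<comment> \<open>Vectors have to be nonempty, hence \<open>undefined\<close>.\<close>
  define V where "V = insert undefined (Vars \<Theta> p)"
  have V: "finite V" "V \<noteq> {}" using support p by (auto simp: V_def finite_support_def)
  obtain eq where eq: "equality_predicate \<Theta> eq"
    and ren: "\<And>vs ws. twin_vectors \<Theta> vs ws \<Longrightarrow> Vars \<Theta> p \<subseteq> set vs \<Longrightarrow>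
           \<exists>S. fo_fml \<Theta> S \<and> valid \<Theta> (Iff S (Dia p (eq_vec eq vs ws)))"
    using expressive p unfolding fol_expressive_def by blast
  have twins: "infinite {w. twin \<Theta> v w}" for v using expressive by (simp add: fol_expressive_def)
  show ?thesis
  proof (rule box_reducible_rendition)
    show "q p \<in> progs \<Delta>" by (rule progs_q[OF p])
    show "finite (i ` V)" using V(1) by simp
    show "Vars \<Delta> (q p) \<subseteq> i ` V" using Vars_q[OF p] by (auto simp: V_def)
    show "(\<mu>', \<omega>) \<in> prog_rel \<Delta> (q p)" if "agree \<Delta> UNIV \<mu> \<mu>'" "(\<mu>, \<omega>) \<in> prog_rel \<Delta> (q p)" for \<mu> \<mu>' \<omega>
      using ext_q[OF p that] .
    fix A :: "'v set" assume A: "finite A"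
    \<comment> \<open>\<open>A\<close> may contain foreign variables of the postcondition; its
      preimage is what restricts the choice of twins inside \<Theta>.\<close>
    have "finite (i -` A \<union> V)" using A V(1) finite_vimageI[OF A inj_i] by simp
    then obtain t where t: "inj_on t V" "\<forall>x\<in>V. twin \<Theta> x (t x) \<and> t x \<notin> i -` A \<union> V"
      using \<Theta>.fresh_twin_map[of "\<lambda>x. x" V "i -` A \<union> V"] twins V(1) by blast
    obtain vs where vs: "set vs = V" "distinct vs" using finite_distinct_list[OF V(1)] by blast
    define ws where "ws = map t vs"
    have tv: "list_all2 (twin \<Theta>) vs ws" using t(2) vs(1) by (auto simp: ws_def list_all2_map2 list_all2_same)
    have "vs \<noteq> []" using vs(1) V(2) by auto
    have "twin_vectors \<Theta> vs ws"
      unfolding twin_vectors_def using tv \<open>vs \<noteq> []\<close> vs t by (auto simp: ws_def distinct_map)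
    then obtain S where S: "fo_fml \<Theta> S" "valid \<Theta> (Iff S (Dia p (eq_vec eq vs ws)))"
      using ren[of vs ws] vs(1) by (auto simp: V_def)
    define E where "E = eq_vec eq vs ws"
    have E: "fo_fml \<Theta> E" "\<And>\<mu>. sat \<Theta> \<mu> E \<longleftrightarrow> (\<forall>v\<in>V. val \<Theta> \<mu> v = val \<Theta> \<mu> (t v))"
      using eq_vec_sem[OF eq tv \<open>vs \<noteq> []\<close>] vs(1)
      by (auto simp: E_def ws_def list_all2_map2 list_all2_same)
    have wf: "wf_fml \<Theta> (Iff S (Dia p E))" using S(1) E(1) p by (simp add: fo_fml_def)
    define t' where "t' = i \<circ> t \<circ> inv i"
    have t': "t' (i v) = i (t v)" for v using inj_i by (simp add: t'_def)
    show "\<exists>t S E. inj_on t (i ` V) \<and> t ` i ` V \<inter> (A \<union> i ` V) = {} \<and>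
      (\<forall>v\<in>i ` V. twin \<Delta> v (t v)) \<and> fo_fml \<Delta> S \<and> fo_fml \<Delta> E \<and>
      (\<forall>\<mu>. sat \<Delta> \<mu> E \<longleftrightarrow> (\<forall>v\<in>i ` V. val \<Delta> \<mu> v = val \<Delta> \<mu> (t v))) \<and>
      (\<forall>\<mu>. sat \<Delta> \<mu> S = sat \<Delta> \<mu> (Dia (q p) E)) \<and> prv (Iff S (Dia (q p) E))"
    proof (rule exI[of _ t'], rule exI[of _ "emb S"], rule exI[of _ "emb E"], intro conjI)
      show "inj_on t' (i ` V)" using t(1) inj_i by (auto simp: inj_on_def t' dest: injD)
      show "t' ` i ` V \<inter> (A \<union> i ` V) = {}" using t(2) by (auto simp: t' inj_eq[OF inj_i])
      show "\<forall>v\<in>i ` V. twin \<Delta> v (t' v)" using t(2) by (auto simp: t' twin_i)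
      show "fo_fml \<Delta> (emb S)" "fo_fml \<Delta> (emb E)" using S(1) E(1) by (simp_all add: fo_emb)
      show "\<forall>\<mu>. sat \<Delta> \<mu> (emb E) \<longleftrightarrow> (\<forall>v\<in>i ` V. val \<Delta> \<mu> v = val \<Delta> \<mu> (t' v))"
        by (simp add: sat_emb E(2) t' val_i)
      have "sat \<Theta> \<rho> S = sat \<Theta> \<rho> (Dia p E)" for \<rho>
        using S(2) unfolding valid_def E_def by (auto simp del: sat.simps(5))
      then have "sat \<Delta> \<mu> (emb S) = sat \<Delta> \<mu> (emb (Dia p E))" for \<mu> unfolding sat_emb by blast
      then show "\<forall>\<mu>. sat \<Delta> \<mu> (emb S) = sat \<Delta> \<mu> (Dia (q p) (emb E))" by simp
      \<comment> \<open>The rendition is a modal validity of \<Theta>; completeness of the component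
        makes it derivable although nothing is known about the program.\<close>
      have "prv (emb (Iff S (Dia p E)))" using prv_emb[OF wf] S(2) by (simp only: emb_def E_def)
      then show "prv (Iff (emb S) (Dia (q p) (emb E)))" by simp
    qed
  qed
qed

end

section \<open>The heterogeneous theory\<close>

lemma havoc_simps [simp]:
  "val (havoc \<Delta>) = val \<Delta>" "atoms (havoc \<Delta>) = atoms \<Delta>" "atom_eval (havoc \<Delta>) = atom_eval \<Delta>"
  "atom_fv (havoc \<Delta>) = atom_fv \<Delta>" "progs (havoc \<Delta>) = Prog ` progs \<Delta> \<union> range Havoc"
  "prog_rel (havoc \<Delta>) (Prog p) = prog_rel \<Delta> p"
  "prog_rel (havoc \<Delta>) (Havoc v) = {(\<mu>, \<nu>). agree \<Delta> (- {v}) \<mu> \<nu>}"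
  by (simp_all add: havoc_def)

lemma agree_havoc [simp]: "agree (havoc \<Delta>) = agree \<Delta>"
  by (simp add: agree_def fun_eq_iff)

lemma sat_emb_havoc [simp]: "sat (havoc \<Delta>) \<mu> (emb_havoc F) = sat \<Delta> \<mu> F"
  by (induction F arbitrary: \<mu>) (auto simp: emb_havoc_def)

lemma wf_emb_havoc [simp]: "wf_fml (havoc \<Delta>) (emb_havoc F) = wf_fml \<Delta> F"
  by (induction F) (auto simp: emb_havoc_def)

lemma first_order_emb_havoc [simp]: "first_order (emb_havoc F) = first_order F"
  by (induction F) (auto simp: emb_havoc_def)

lemma fo_emb_havoc [simp]: "fo_fml (havoc \<Delta>) (emb_havoc F) = fo_fml \<Delta> F"
  by (simp add: fo_fml_def)

lemma valid_emb_havoc [simp]: "valid (havoc \<Delta>) (emb_havoc F) = valid \<Delta> F"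
  by (simp add: valid_def)

lemma valid_emb_reg [simp]: "valid (regular \<Delta>) (emb_reg F) = valid \<Delta> F"
  by (simp add: valid_def)

text \<open>First-order formulas contain no programs, so the regular closure adds no new ones. This
  lets the havoc axiom be imported for any first-order postcondition.\<close>

lemma fo_regular_emb:
  assumes "fo_fml (regular \<Delta>) F"
  shows "\<exists>F'. F = emb_reg F' \<and> fo_fml \<Delta> F'"
  using assms
proof (induction F)
  case (Atom a)
  then show ?case by (intro exI[of _ "Atom a"]) (simp add: emb_reg_def fo_fml_def)
next
  case (Neg F)
  then obtain F' where "F = emb_reg F'" "fo_fml \<Delta> F'" by (auto simp: fo_fml_def)
  then show ?case by (intro exI[of _ "Neg F'"]) (simp add: emb_reg_def fo_fml_def)
next
  case (Conj F G)
  then obtain F' G' where "F = emb_reg F'" "fo_fml \<Delta> F'" "G = emb_reg G'" "fo_fml \<Delta> G'"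
    by (auto simp: fo_fml_def)
  then show ?case by (intro exI[of _ "Conj F' G'"]) (simp add: emb_reg_def fo_fml_def)
next
  case (All v F)
  then obtain F' where "F = emb_reg F'" "fo_fml \<Delta> F'" by (auto simp: fo_fml_def)
  then show ?case by (intro exI[of _ "All v F'"]) (simp add: emb_reg_def fo_fml_def)
qed (simp add: fo_fml_def)

text \<open>The translated premises are again valid first-order formulas and thus available in the
  larger theory; one reduction step then suffices.\<close>

lemma import_reduction:
  assumes "C {G. fo_fml \<Theta> G \<and> valid \<Theta> G} F" "wf_fml \<Theta> F" "reduction \<Theta> C e \<subseteq> R"
    "\<And>G. fo_fml \<Theta> G \<Longrightarrow> valid \<Theta> G \<Longrightarrow> fo_fml \<Delta> (e G) \<and> valid \<Delta> (e G)"
  shows "derives \<Delta> Ax R {G. fo_fml \<Delta> G \<and> valid \<Delta> G} (e F)"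
proof (rule derives.import)
  have "(e ` {G. fo_fml \<Theta> G \<and> valid \<Theta> G}, e F) \<in> reduction \<Theta> C e"
    unfolding reduction_def using assms(1,2) by (auto simp: fo_fml_def)
  then show "(e ` {G. fo_fml \<Theta> G \<and> valid \<Theta> G}, e F) \<in> R" using assms(3) by blast
  fix G assume "G \<in> e ` {G. fo_fml \<Theta> G \<and> valid \<Theta> G}"
  then show "derives \<Delta> Ax R {G. fo_fml \<Delta> G \<and> valid \<Delta> G} G"
    using assms(4) by (auto intro: derives.premise)
qed

section \<open>The product of the two components\<close>

lemma simple_het_simps [simp]:
  "val (simple_het \<Delta>0 \<Delta>1 H) \<mu> (Inl x) = val \<Delta>0 (fst \<mu>) x"
  "val (simple_het \<Delta>0 \<Delta>1 H) \<mu> (Inr y) = val \<Delta>1 (snd \<mu>) y"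
  "atoms (simple_het \<Delta>0 \<Delta>1 H) = Atom0 ` atoms \<Delta>0 \<union> Atom1 ` atoms \<Delta>1 \<union> AtomC ` hatoms H"
  "\<mu> \<in> atom_eval (simple_het \<Delta>0 \<Delta>1 H) (Atom0 b) \<longleftrightarrow> fst \<mu> \<in> atom_eval \<Delta>0 b"
  "\<mu> \<in> atom_eval (simple_het \<Delta>0 \<Delta>1 H) (Atom1 d) \<longleftrightarrow> snd \<mu> \<in> atom_eval \<Delta>1 d"
  "atom_eval (simple_het \<Delta>0 \<Delta>1 H) (AtomC c) = hatom_eval H c"
  "atom_fv (simple_het \<Delta>0 \<Delta>1 H) (Atom0 b) = Inl ` atom_fv \<Delta>0 b"
  "atom_fv (simple_het \<Delta>0 \<Delta>1 H) (Atom1 d) = Inr ` atom_fv \<Delta>1 d"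
  "atom_fv (simple_het \<Delta>0 \<Delta>1 H) (AtomC c) = hatom_fv H c"
  "progs (simple_het \<Delta>0 \<Delta>1 H) = Inl ` progs \<Delta>0 \<union> Inr ` progs \<Delta>1"
  "(\<mu>, \<nu>) \<in> prog_rel (simple_het \<Delta>0 \<Delta>1 H) (Inl p) \<longleftrightarrow>
    (fst \<mu>, fst \<nu>) \<in> prog_rel \<Delta>0 p \<and> agree \<Delta>1 UNIV (snd \<mu>) (snd \<nu>)"
  "(\<mu>, \<nu>) \<in> prog_rel (simple_het \<Delta>0 \<Delta>1 H) (Inr r) \<longleftrightarrow>
    agree \<Delta>0 UNIV (fst \<mu>) (fst \<nu>) \<and> (snd \<mu>, snd \<nu>) \<in> prog_rel \<Delta>1 r"
  by (simp_all add: simple_het_def het_val_def)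

lemma val_simple_het: "val (simple_het \<Delta>0 \<Delta>1 H) = het_val \<Delta>0 \<Delta>1"
  by (simp add: simple_het_def)

lemma not_Inl: "(\<forall>x. x \<notin> range Inl \<longrightarrow> P x) \<longleftrightarrow> (\<forall>y. P (Inr y))"
  by (auto simp: split_sum_all)

lemma not_Inr: "(\<forall>x. x \<notin> range Inr \<longrightarrow> P x) \<longleftrightarrow> (\<forall>y. P (Inl y))"
  by (auto simp: split_sum_all)

text \<open>Interpolation is done componentwise, with the preimages of \<open>W\<close>;
  \<open>havoc\<close> and \<open>regular\<close> keep states, values and atoms.\<close>

lemma fo_theory_hero:
  fixes \<Delta>0 :: "('v0, 'a0, 'p0, 'u, 's0) dyn_theory" and \<Delta>1 :: "('v1, 'a1, 'p1, 'u, 's1) dyn_theory"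
  assumes d0: "dynamic_theory \<Delta>0" and d1: "dynamic_theory \<Delta>1" and ok: "het_atoms_ok \<Delta>0 \<Delta>1 H"
  shows "fo_theory (regular (havoc (simple_het \<Delta>0 \<Delta>1 H)))"
proof -
  interpret f0: fo_theory \<Delta>0 by (rule dynamic_theory_fo[OF d0])
  interpret f1: fo_theory \<Delta>1 by (rule dynamic_theory_fo[OF d1])
  show ?thesis
  proof
    fix W :: "('v0 + 'v1) set" and \<mu> \<nu> :: "'s0 \<times> 's1"
    obtain \<omega>0 where 0: "\<forall>x. val \<Delta>0 \<omega>0 x = (if x \<in> Inl -` W then val \<Delta>0 (fst \<mu>) x else val \<Delta>0 (fst \<nu>) x)"
      using f0.interpolate[of "Inl -` W" "fst \<mu>" "fst \<nu>"] by blast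
    obtain \<omega>1 where 1: "\<forall>x. val \<Delta>1 \<omega>1 x = (if x \<in> Inr -` W then val \<Delta>1 (snd \<mu>) x else val \<Delta>1 (snd \<nu>) x)"
      using f1.interpolate[of "Inr -` W" "snd \<mu>" "snd \<nu>"] by blast
    have "val (simple_het \<Delta>0 \<Delta>1 H) (\<omega>0, \<omega>1) v =
        (if v \<in> W then val (simple_het \<Delta>0 \<Delta>1 H) \<mu> v else val (simple_het \<Delta>0 \<Delta>1 H) \<nu> v)" for v
      using 0 1 by (cases v) simp_all
    then show "\<exists>\<omega>. agree (regular (havoc (simple_het \<Delta>0 \<Delta>1 H))) W \<omega> \<mu> \<and>
        agree (regular (havoc (simple_het \<Delta>0 \<Delta>1 H))) (- W) \<omega> \<nu>"
      by (intro exI[of _ "(\<omega>0, \<omega>1)"]) (simp add: agree_def)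
  next
    fix a assume a: "a \<in> atoms (regular (havoc (simple_het \<Delta>0 \<Delta>1 H)))"
    show "finite (atom_fv (regular (havoc (simple_het \<Delta>0 \<Delta>1 H))) a)"
      using a f0.atom_finite f1.atom_finite ok by (auto simp: het_atoms_ok_def)
    fix \<mu> \<nu>
    assume ag: "agree (regular (havoc (simple_het \<Delta>0 \<Delta>1 H)))
        (atom_fv (regular (havoc (simple_het \<Delta>0 \<Delta>1 H))) a) \<mu> \<nu>"
    show "\<mu> \<in> atom_eval (regular (havoc (simple_het \<Delta>0 \<Delta>1 H))) a \<longleftrightarrow>
        \<nu> \<in> atom_eval (regular (havoc (simple_het \<Delta>0 \<Delta>1 H))) a"
    proof (cases a)
      case (Atom0 b)
      then show ?thesis using a ag f0.atom_coincidence[of b "fst \<mu>" "fst \<nu>"] by (auto simp: agree_def)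
    next
      case (Atom1 b)
      then show ?thesis using a ag f1.atom_coincidence[of b "snd \<mu>" "snd \<nu>"] by (auto simp: agree_def)
    next
      case (AtomC c)
      then have "c \<in> hatoms H" "\<forall>v\<in>hatom_fv H c. het_val \<Delta>0 \<Delta>1 \<mu> v = het_val \<Delta>0 \<Delta>1 \<nu> v"
        using a ag by (auto simp: agree_def val_simple_het)
      then have "\<mu> \<in> hatom_eval H c \<longleftrightarrow> \<nu> \<in> hatom_eval H c"
        using ok unfolding het_atoms_ok_def by blast
      then show ?thesis using AtomC by simp
    qed
  qed
qed

lemma component0:
  assumes "dynamic_theory \<Delta>0" "dynamic_theory \<Delta>1" "het_atoms_ok \<Delta>0 \<Delta>1 H"
  shows "component (regular (havoc (simple_het \<Delta>0 \<Delta>1 H))) \<Delta>0 Inl Atom0 (\<lambda>p. Base (Prog (Inl p))) fst"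
proof (intro component.intro component_axioms.intro)
  show "fo_theory (regular (havoc (simple_het \<Delta>0 \<Delta>1 H)))" by (rule fo_theory_hero[OF assms])
  show "\<exists>\<nu>. fst \<nu> = \<rho> \<and> (\<forall>x. x \<notin> range Inl \<longrightarrow> val (regular (havoc (simple_het \<Delta>0 \<Delta>1 H))) \<nu> x =
      val (regular (havoc (simple_het \<Delta>0 \<Delta>1 H))) \<mu> x)" for \<rho> \<mu>
    unfolding not_Inl by (rule exI[of _ "(\<rho>, snd \<mu>)"]) simp
qed (use assms(1) in \<open>auto simp: not_Inl agree_def\<close>)

lemma component1:
  assumes "dynamic_theory \<Delta>0" "dynamic_theory \<Delta>1" "het_atoms_ok \<Delta>0 \<Delta>1 H"
  shows "component (regular (havoc (simple_het \<Delta>0 \<Delta>1 H))) \<Delta>1 Inr Atom1 (\<lambda>p. Base (Prog (Inr p))) snd"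
proof (intro component.intro component_axioms.intro)
  show "fo_theory (regular (havoc (simple_het \<Delta>0 \<Delta>1 H)))" by (rule fo_theory_hero[OF assms])
  show "\<exists>\<nu>. snd \<nu> = \<rho> \<and> (\<forall>x. x \<notin> range Inr \<longrightarrow> val (regular (havoc (simple_het \<Delta>0 \<Delta>1 H))) \<nu> x =
      val (regular (havoc (simple_het \<Delta>0 \<Delta>1 H))) \<mu> x)" for \<rho> \<mu>
    unfolding not_Inr by (rule exI[of _ "(fst \<mu>, \<rho>)"]) simp
qed (use assms(2) in \<open>auto simp: not_Inr agree_def\<close>)

lemma emb_hero0: "map_fml Inl Atom0 (\<lambda>p. Base (Prog (Inl p))) F = emb_reg (emb_havoc (emb0 F))"
  by (simp add: emb_reg_def emb_havoc_def emb0_def fml.map_comp comp_def)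

lemma emb_hero1: "map_fml Inr Atom1 (\<lambda>p. Base (Prog (Inr p))) F = emb_reg (emb_havoc (emb1 F))"
  by (simp add: emb_reg_def emb_havoc_def emb1_def fml.map_comp comp_def)

section \<open>Expressivity and imports in the combined theory\<close>

locale hero_setting =
  fixes \<Delta>0 :: "('v0, 'a0, 'p0, 'u, 's0) dyn_theory"
    and \<Delta>1 :: "('v1, 'a1, 'p1, 'u, 's1) dyn_theory"
    and C0 :: "('v0, 'a0, 'p0) calculus"
    and C1 :: "('v1, 'a1, 'p1) calculus"
    and N0 :: "('v0, 'a0, 'p0, 'u) nat_data"
    and N1 :: "('v1, 'a1, 'p1, 'u) nat_data"
    and H :: "('v0, 'v1, 'c, 's0, 's1) het_atoms"
    and N :: "('v0 + 'v1, ('a0, 'a1, 'c) het_atom, 'p0 + 'p1, 'u) nat_data"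
  assumes dyn: "dynamic_theory \<Delta>0" "dynamic_theory \<Delta>1"
    and support: "finite_support \<Delta>0" "finite_support \<Delta>1"
    and complete: "relatively_complete \<Delta>0 C0" "relatively_complete \<Delta>1 C1"
    and fol: "fol_expressive \<Delta>0" "fol_expressive \<Delta>1"
    and goedel: "goedel_expressive \<Delta>0 N0" "goedel_expressive \<Delta>1 N1"
    and ok: "het_atoms_ok \<Delta>0 \<Delta>1 H"
    and comm: "communicating \<Delta>0 N0 \<Delta>1 N1 H"
    and N: "N = nat_data0 N0 \<or> N = nat_data1 N1"
begin

abbreviation \<Delta>s where "\<Delta>s \<equiv> simple_het \<Delta>0 \<Delta>1 H"
abbreviation \<Delta>h where "\<Delta>h \<equiv> havoc \<Delta>s"

text \<open>Read off from the composite embedding into the regular theory, whose last two stages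
  preserve satisfaction.\<close>

lemma sat_emb01: "sat \<Delta>s \<mu> (emb0 F) = sat \<Delta>0 (fst \<mu>) F" "sat \<Delta>s \<mu> (emb1 G) = sat \<Delta>1 (snd \<mu>) G"
  using component.sat_emb[OF component0[OF dyn ok], of \<mu> F]
    component.sat_emb[OF component1[OF dyn ok], of \<mu> G]
  by (simp_all add: component.emb_def[OF component0[OF dyn ok]]
      component.emb_def[OF component1[OF dyn ok]] emb_hero0 emb_hero1)

lemma wf_emb01: "wf_fml \<Delta>0 F \<Longrightarrow> wf_fml \<Delta>s (emb0 F)" "wf_fml \<Delta>1 G \<Longrightarrow> wf_fml \<Delta>s (emb1 G)"
  using component.wf_emb[OF component0[OF dyn ok], of F]
    component.wf_emb[OF component1[OF dyn ok], of G]
  by (simp_all add: component.emb_def[OF component0[OF dyn ok]]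
      component.emb_def[OF component1[OF dyn ok]] emb_hero0 emb_hero1)

lemma fo_emb01: "fo_fml \<Delta>0 F \<Longrightarrow> fo_fml \<Delta>s (emb0 F)" "fo_fml \<Delta>1 G \<Longrightarrow> fo_fml \<Delta>s (emb1 G)"
  using component.fo_emb[OF component0[OF dyn ok], of F]
    component.fo_emb[OF component1[OF dyn ok], of G]
  by (simp_all add: component.emb_def[OF component0[OF dyn ok]]
      component.emb_def[OF component1[OF dyn ok]] emb_hero0 emb_hero1)

lemma definable_simple_het: "fo_fml \<Delta>s F \<Longrightarrow> (\<And>\<mu>. sat \<Delta>s \<mu> F = P \<mu>) \<Longrightarrow> definable (regular \<Delta>h) P"
  unfolding definable_def by (rule exI[of _ "emb_reg (emb_havoc F)"]) simp

text \<open>Twins may come from different components, and the equality predicate of communicating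
  theories covers these pairs; the lifts change neither states nor values.\<close>

lemma definable_equality:
  assumes "twin (regular \<Delta>h) x y"
  shows "definable (regular \<Delta>h) (\<lambda>\<mu>. val (regular \<Delta>h) \<mu> x = val (regular \<Delta>h) \<mu> y)"
proof -
  obtain eq where "equality_predicate \<Delta>s eq" using comm by (auto simp: communicating_def)
  moreover have "twin \<Delta>s x y" using assms by (simp add: twin_def attainable_def)
  ultimately have "fo_fml \<Delta>s (eq x y)" "\<And>\<mu>. sat \<Delta>s \<mu> (eq x y) \<longleftrightarrow> val \<Delta>s \<mu> x = val \<Delta>s \<mu> y"
    by (auto simp: equality_predicate_def)
  then show ?thesis using definable_simple_het by simp
qed

lemma counting_N: "counting (regular \<Delta>h) (u2n N) (nat_vars N)"
  using N component.counting_component[OF component0[OF dyn ok] goedel(1)]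
    component.counting_component[OF component1[OF dyn ok] goedel(2)]
  by (auto simp: nat_data0_def nat_data1_def)

lemma inductively: "inductively_expressive \<Delta>0 N0" "inductively_expressive \<Delta>1 N1"
  using goedel by (auto simp: goedel_expressive_def)

text \<open>\<open>N\<close> stems from one component. Number variables of that component are
  compared by its own \<open>nat_eq\<close>, those of the other by the communicating predicate, read
  in either direction.\<close>

lemma link:
  shows "n \<in> nat_vars N0 \<Longrightarrow> c \<in> nat_vars N \<Longrightarrow> definable (regular \<Delta>h)
      (\<lambda>\<mu>. u2n N0 (val (regular \<Delta>h) \<mu> (Inl n)) = u2n N (val (regular \<Delta>h) \<mu> c))"
    and "m \<in> nat_vars N1 \<Longrightarrow> c \<in> nat_vars N \<Longrightarrow> definable (regular \<Delta>h)
      (\<lambda>\<mu>. u2n N1 (val (regular \<Delta>h) \<mu> (Inr m)) = u2n N (val (regular \<Delta>h) \<mu> c))"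
proof -
  have ind0: "fo_fml \<Delta>0 (nat_eq N0 v w) \<and>
      (\<forall>\<mu>. sat \<Delta>0 \<mu> (nat_eq N0 v w) \<longleftrightarrow> u2n N0 (val \<Delta>0 \<mu> v) = u2n N0 (val \<Delta>0 \<mu> w))"
    if "v \<in> nat_vars N0" "w \<in> nat_vars N0" for v w
    using inductively(1) that by (simp add: inductively_expressive_def)
  have ind1: "fo_fml \<Delta>1 (nat_eq N1 v w) \<and>
      (\<forall>\<mu>. sat \<Delta>1 \<mu> (nat_eq N1 v w) \<longleftrightarrow> u2n N1 (val \<Delta>1 \<mu> v) = u2n N1 (val \<Delta>1 \<mu> w))"
    if "v \<in> nat_vars N1" "w \<in> nat_vars N1" for v w
    using inductively(2) that by (simp add: inductively_expressive_def)
  obtain nat_eq_sh where sh: "\<And>v w. v \<in> nat_vars N0 \<Longrightarrow> w \<in> nat_vars N1 \<Longrightarrow> fo_fml \<Delta>s (nat_eq_sh v w) \<and>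
      (\<forall>\<mu>. sat \<Delta>s \<mu> (nat_eq_sh v w) \<longleftrightarrow> u2n N0 (val \<Delta>s \<mu> (Inl v)) = u2n N1 (val \<Delta>s \<mu> (Inr w)))"
    using comm unfolding communicating_def by blast
  have d00: "definable (regular \<Delta>h) (\<lambda>\<mu>. u2n N0 (val \<Delta>0 (fst \<mu>) v) = u2n N0 (val \<Delta>0 (fst \<mu>) w))"
    if "v \<in> nat_vars N0" "w \<in> nat_vars N0" for v w
    by (rule definable_simple_het[of "emb0 (nat_eq N0 v w)"]) (use ind0[OF that] in \<open>simp_all add: fo_emb01 sat_emb01\<close>)
  have d11: "definable (regular \<Delta>h) (\<lambda>\<mu>. u2n N1 (val \<Delta>1 (snd \<mu>) v) = u2n N1 (val \<Delta>1 (snd \<mu>) w))"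
    if "v \<in> nat_vars N1" "w \<in> nat_vars N1" for v w
    by (rule definable_simple_het[of "emb1 (nat_eq N1 v w)"]) (use ind1[OF that] in \<open>simp_all add: fo_emb01 sat_emb01\<close>)
  have d01: "definable (regular \<Delta>h) (\<lambda>\<mu>. u2n N0 (val \<Delta>0 (fst \<mu>) v) = u2n N1 (val \<Delta>1 (snd \<mu>) w))"
    if "v \<in> nat_vars N0" "w \<in> nat_vars N1" for v w
    by (rule definable_simple_het[of "nat_eq_sh v w"]) (use sh[OF that] in \<open>simp_all del: split_paired_All\<close>)
  have d10: "definable (regular \<Delta>h) (\<lambda>\<mu>. u2n N1 (val \<Delta>1 (snd \<mu>) w) = u2n N0 (val \<Delta>0 (fst \<mu>) v))"
    if "v \<in> nat_vars N0" "w \<in> nat_vars N1" for v w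
    by (rule back_subst[of "definable (regular \<Delta>h)", OF d01[OF that]], rule ext, rule eq_commute)
  show "definable (regular \<Delta>h) (\<lambda>\<mu>. u2n N0 (val (regular \<Delta>h) \<mu> (Inl n)) = u2n N (val (regular \<Delta>h) \<mu> c))"
    if h: "n \<in> nat_vars N0" "c \<in> nat_vars N"
    using N
  proof
    assume N: "N = nat_data0 N0"
    then obtain c' where "c = Inl c'" "c' \<in> nat_vars N0" using h(2) by (auto simp: nat_data0_def)
    then show ?thesis using d00[OF h(1)] by (simp add: N nat_data0_def)
  next
    assume N: "N = nat_data1 N1"
    then obtain c' where "c = Inr c'" "c' \<in> nat_vars N1" using h(2) by (auto simp: nat_data1_def)
    then show ?thesis using d01[OF h(1)] by (simp add: N nat_data1_def)
  qed
  show "definable (regular \<Delta>h) (\<lambda>\<mu>. u2n N1 (val (regular \<Delta>h) \<mu> (Inr m)) = u2n N (val (regular \<Delta>h) \<mu> c))"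
    if h: "m \<in> nat_vars N1" "c \<in> nat_vars N"
    using N
  proof
    assume N: "N = nat_data0 N0"
    then obtain c' where "c = Inl c'" "c' \<in> nat_vars N0" using h(2) by (auto simp: nat_data0_def)
    then show ?thesis using d10[OF _ h(1)] by (simp add: N nat_data0_def)
  next
    assume N: "N = nat_data1 N1"
    then obtain c' where "c = Inr c'" "c' \<in> nat_vars N1" using h(2) by (auto simp: nat_data1_def)
    then show ?thesis using d11[OF h(1)] by (simp add: N nat_data1_def)
  qed
qed

text \<open>Each variable is coded within its own component. Lengths and positions sit in variables
  of \<open>N\<close> and reach the decoder of either component through \<open>link\<close>.\<close>

lemma sequence_coding_N: "sequence_coding (regular \<Delta>h) (u2n N) (nat_vars N)"
proof (rule sequence_coding.intro[OF counting_N sequence_coding_axioms.intro])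
  have tw: "\<And>v. infinite {w. twin \<Delta>0 v w}" "\<And>v. infinite {w. twin \<Delta>1 v w}"
    using fol by (auto simp: fol_expressive_def)
  have ind: "infinite (nat_vars N0)" "\<And>v. v \<in> nat_vars N0 \<Longrightarrow> u2n N0 ` attainable \<Delta>0 v = UNIV"
    "infinite (nat_vars N1)" "\<And>v. v \<in> nat_vars N1 \<Longrightarrow> u2n N1 ` attainable \<Delta>1 v = UNIV"
    using inductively by (auto simp: inductively_expressive_def)
  have sup: "\<And>v. supports_goedelization \<Delta>0 N0 v" "\<And>v. supports_goedelization \<Delta>1 N1 v"
    using goedel by (auto simp: goedel_expressive_def)
  fix v
  show "infinite {w. twin (regular \<Delta>h) v w}"
    using component.twins_infinite_i[OF component0[OF dyn ok] tw(1)]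
      component.twins_infinite_i[OF component1[OF dyn ok] tw(2)] by (cases v) auto
  show "\<exists>w dec A. sequence_decoder (regular \<Delta>h) (u2n N) (nat_vars N) v w dec A"
  proof (cases v)
    case (Inl x)
    then show ?thesis
      using component.decoder_component[OF component0[OF dyn ok] sup(1) ind(1,2) tw(1) link(1) definable_equality]
      by simp
  next
    case (Inr x)
    then show ?thesis
      using component.decoder_component[OF component1[OF dyn ok] sup(2) ind(3,4) tw(2) link(2) definable_equality]
      by simp
  qed
qed

lemma nat_formulas:
  assumes "v \<in> nat_vars N" "w \<in> nat_vars N"
  shows "fo_fml \<Delta>s (nat_pos N v) \<and> (\<forall>\<mu>. sat \<Delta>s \<mu> (nat_pos N v) \<longleftrightarrow> 0 < u2n N (val \<Delta>s \<mu> v))"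
    and "fo_fml \<Delta>s (nat_eq N v w) \<and>
      (\<forall>\<mu>. sat \<Delta>s \<mu> (nat_eq N v w) \<longleftrightarrow> u2n N (val \<Delta>s \<mu> v) = u2n N (val \<Delta>s \<mu> w))"
    and "fo_fml \<Delta>s (nat_succ N v w) \<and>
      (\<forall>\<mu>. sat \<Delta>s \<mu> (nat_succ N v w) \<longleftrightarrow> u2n N (val \<Delta>s \<mu> v) + 1 = u2n N (val \<Delta>s \<mu> w))"
proof -
  have "(fo_fml \<Delta>s (nat_pos N v) \<and> (\<forall>\<mu>. sat \<Delta>s \<mu> (nat_pos N v) \<longleftrightarrow> 0 < u2n N (val \<Delta>s \<mu> v))) \<and>
    (fo_fml \<Delta>s (nat_eq N v w) \<and>
      (\<forall>\<mu>. sat \<Delta>s \<mu> (nat_eq N v w) \<longleftrightarrow> u2n N (val \<Delta>s \<mu> v) = u2n N (val \<Delta>s \<mu> w))) \<and>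
    (fo_fml \<Delta>s (nat_succ N v w) \<and>
      (\<forall>\<mu>. sat \<Delta>s \<mu> (nat_succ N v w) \<longleftrightarrow> u2n N (val \<Delta>s \<mu> v) + 1 = u2n N (val \<Delta>s \<mu> w)))"
    (is ?all)
    using N
  proof
    assume N: "N = nat_data0 N0"
    then obtain v' w' where "v = Inl v'" "v' \<in> nat_vars N0" "w = Inl w'" "w' \<in> nat_vars N0"
      using assms by (auto simp: nat_data0_def)
    then show ?all
      using inductively(1) by (simp add: N nat_data0_def inductively_expressive_def fo_emb01 sat_emb01)
  next
    assume N: "N = nat_data1 N1"
    then obtain v' w' where "v = Inr v'" "v' \<in> nat_vars N1" "w = Inr w'" "w' \<in> nat_vars N1"
      using assms by (auto simp: nat_data1_def)
    then show ?all
      using inductively(2) by (simp add: N nat_data1_def inductively_expressive_def fo_emb01 sat_emb01)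
  qed
  then show "fo_fml \<Delta>s (nat_pos N v) \<and> (\<forall>\<mu>. sat \<Delta>s \<mu> (nat_pos N v) \<longleftrightarrow> 0 < u2n N (val \<Delta>s \<mu> v))"
    and "fo_fml \<Delta>s (nat_eq N v w) \<and>
      (\<forall>\<mu>. sat \<Delta>s \<mu> (nat_eq N v w) \<longleftrightarrow> u2n N (val \<Delta>s \<mu> v) = u2n N (val \<Delta>s \<mu> w))"
    and "fo_fml \<Delta>s (nat_succ N v w) \<and>
      (\<forall>\<mu>. sat \<Delta>s \<mu> (nat_succ N v w) \<longleftrightarrow> u2n N (val \<Delta>s \<mu> v) + 1 = u2n N (val \<Delta>s \<mu> w))"
    by blast+
qed

text \<open>Three imports in a row: from the component to the product, to the havoc lift, to the
  regular closure. At each stage the premises stay valid first-order formulas.\<close>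

lemma derives_emb0:
  assumes "wf_fml \<Delta>0 F" "valid \<Delta>0 F"
  shows "hero_calculus \<Delta>0 C0 \<Delta>1 C1 H N {G. fo_fml (regular \<Delta>h) G \<and> valid (regular \<Delta>h) G}
    (emb_reg (emb_havoc (emb0 F)))"
  unfolding hero_calculus_def regular_calculus_def
proof (rule import_reduction[OF _ _ subset_refl])
  show "havoc_calculus \<Delta>s (simple_het_calculus \<Delta>0 C0 \<Delta>1 C1 H) {G. fo_fml \<Delta>h G \<and> valid \<Delta>h G}
      (emb_havoc (emb0 F))"
    unfolding havoc_calculus_def
  proof (rule import_reduction[OF _ _ subset_refl])
    show "simple_het_calculus \<Delta>0 C0 \<Delta>1 C1 H {G. fo_fml \<Delta>s G \<and> valid \<Delta>s G} (emb0 F)"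
      unfolding simple_het_calculus_def
    proof (rule import_reduction[where C = C0 and \<Theta> = \<Delta>0 and e = emb0])
      show "C0 {G. fo_fml \<Delta>0 G \<and> valid \<Delta>0 G} F"
        using complete(1) assms by (simp add: relatively_complete_def)
    qed (use assms in \<open>auto simp: fo_emb01 valid_def sat_emb01\<close>)
  qed (use assms in \<open>auto simp: wf_emb01\<close>)
qed (use assms in \<open>auto simp: wf_emb01\<close>)

lemma derives_emb1:
  assumes "wf_fml \<Delta>1 F" "valid \<Delta>1 F"
  shows "hero_calculus \<Delta>0 C0 \<Delta>1 C1 H N {G. fo_fml (regular \<Delta>h) G \<and> valid (regular \<Delta>h) G}
    (emb_reg (emb_havoc (emb1 F)))"
  unfolding hero_calculus_def regular_calculus_def
proof (rule import_reduction[OF _ _ subset_refl])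
  show "havoc_calculus \<Delta>s (simple_het_calculus \<Delta>0 C0 \<Delta>1 C1 H) {G. fo_fml \<Delta>h G \<and> valid \<Delta>h G}
      (emb_havoc (emb1 F))"
    unfolding havoc_calculus_def
  proof (rule import_reduction[OF _ _ subset_refl])
    show "simple_het_calculus \<Delta>0 C0 \<Delta>1 C1 H {G. fo_fml \<Delta>s G \<and> valid \<Delta>s G} (emb1 F)"
      unfolding simple_het_calculus_def
    proof (rule import_reduction[where C = C1 and \<Theta> = \<Delta>1 and e = emb1])
      show "C1 {G. fo_fml \<Delta>1 G \<and> valid \<Delta>1 G} F"
        using complete(2) assms by (simp add: relatively_complete_def)
    qed (use assms in \<open>auto simp: fo_emb01 valid_def sat_emb01\<close>)
  qed (use assms in \<open>auto simp: wf_emb01\<close>)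
qed (use assms in \<open>auto simp: wf_emb01\<close>)

text \<open>The havoc axiom belongs to the calculus one level below and enters through the reduction
  without premises; a first-order \<open>F\<close> comes from that level.\<close>

lemma derives_havoc:
  assumes "fo_fml (regular \<Delta>h) F"
  shows "hero_calculus \<Delta>0 C0 \<Delta>1 C1 H N \<Gamma> (Iff (Box (Base (Havoc v)) F) (All v F))"
proof -
  obtain F' where F': "F = emb_reg F'" "fo_fml \<Delta>h F'" using fo_regular_emb[OF assms] by blast
  define I where "I = Iff (Box (Havoc v) F') (All v F')"
  have wf: "wf_fml \<Delta>h I" using F'(2) by (simp add: I_def fo_fml_def)
  have "havoc_calculus \<Delta>s (simple_het_calculus \<Delta>0 C0 \<Delta>1 C1 H) {} I"
    unfolding havoc_calculus_def
    by (rule derives.axiom) (use F'(2) in \<open>auto simp: havoc_axioms_def I_def fo_fml_def\<close>)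
  then have "(emb_reg ` {}, emb_reg I) \<in>
      reduction \<Delta>h (havoc_calculus \<Delta>s (simple_het_calculus \<Delta>0 C0 \<Delta>1 C1 H)) emb_reg"
    using wf unfolding reduction_def by blast
  then have "hero_calculus \<Delta>0 C0 \<Delta>1 C1 H N \<Gamma> (emb_reg I)"
    unfolding hero_calculus_def regular_calculus_def by (rule derives.import) simp
  moreover have "emb_reg I = Iff (Box (Base (Havoc v)) F) (All v F)"
    by (simp add: I_def F'(1) emb_reg_def)
  ultimately show ?thesis by simp
qed

lemma hero_relatively_complete: "relatively_complete (hero \<Delta>0 \<Delta>1 H) (hero_calculus \<Delta>0 C0 \<Delta>1 C1 H N)"
proof -
  define Ax where "Ax = reg_axioms \<Delta>h \<union> convergence_axioms \<Delta>h (nat_data_havoc N)"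
  define R where "R = reduction \<Delta>h (havoc_calculus \<Delta>s (simple_het_calculus \<Delta>0 C0 \<Delta>1 C1 H)) emb_reg"
  define \<Gamma> where "\<Gamma> = {G. fo_fml (regular \<Delta>h) G \<and> valid (regular \<Delta>h) G}"
  have calc: "hero_calculus \<Delta>0 C0 \<Delta>1 C1 H N = derives (regular \<Delta>h) Ax R"
    by (simp add: hero_calculus_def regular_calculus_def Ax_def R_def fun_eq_iff)
  interpret c0: component "regular \<Delta>h" \<Delta>0 Inl Atom0 "\<lambda>p. Base (Prog (Inl p))" fst
    by (rule component0[OF dyn ok])
  interpret c1: component "regular \<Delta>h" \<Delta>1 Inr Atom1 "\<lambda>p. Base (Prog (Inr p))" snd
    by (rule component1[OF dyn ok])
  have rc: "relative_calculus (regular \<Delta>h) \<Gamma>"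
    by (rule relative_calculus.intro[OF fo_theory_hero[OF dyn ok]])
      (simp add: relative_calculus_axioms_def \<Gamma>_def)
  \<comment> \<open>\<open>Vars_q\<close> bounds variables in the regular theory; this carries the
    bound down to the programs of \<Delta>h.\<close>
  have Vars_base: "Vars \<Delta>h p = Vars (regular \<Delta>h) (Base p)" for p
    by (simp add: Vars_def FVp_Base BVp_Base)
  have "regular_calculus_rules \<Delta>h Ax \<Gamma>"
  proof (rule regular_calculus_rules.intro[OF rc regular_calculus_rules_axioms.intro])
    show "F \<in> reg_axioms \<Delta>h \<Longrightarrow> F \<in> Ax" for F by (simp add: Ax_def)
    fix p assume p: "p \<in> progs \<Delta>h"
    show "finite (Vars \<Delta>h p)"
    proof (cases p)
      case (Prog r)
      show ?thesis
      proof (cases r)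
        case (Inl a)
        then have a: "a \<in> progs \<Delta>0" using p Prog by auto
        then show ?thesis
          unfolding Vars_base Prog Inl
          using finite_subset[OF c0.Vars_q[OF a]] support(1) by (simp add: finite_support_def)
      next
        case (Inr a)
        then have a: "a \<in> progs \<Delta>1" using p Prog by auto
        then show ?thesis
          unfolding Vars_base Prog Inr
          using finite_subset[OF c1.Vars_q[OF a]] support(2) by (simp add: finite_support_def)
      qed
    next
      case (Havoc v)
      \<comment> \<open>The copied run takes the new \<open>v\<close> from \<omega> and everything
        else from \<nu>, so havoc reads nothing.\<close>
      have "\<exists>\<omega>'. agree \<Delta>s (- {v}) \<nu> \<omega>' \<and> agree \<Delta>s (- {x}) \<omega> \<omega>'"
        if a: "agree \<Delta>s (- {x}) \<mu> \<nu>" "agree \<Delta>s (- {v}) \<mu> \<omega>" for x \<mu> \<nu> \<omega>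
      proof -
        obtain \<omega>' where w': "\<forall>y. val \<Delta>s \<omega>' y = (if y \<in> {v} then val \<Delta>s \<omega> y else val \<Delta>s \<nu> y)"
          using c0.interpolate[of "{v}" \<omega> \<nu>] unfolding regular_simps havoc_simps by blast
        have "val \<Delta>s \<omega> y = val \<Delta>s \<omega>' y" if y: "y \<noteq> x" for y
        proof (cases "y = v")
          case False
          then have "val \<Delta>s \<mu> y = val \<Delta>s \<omega> y" "val \<Delta>s \<mu> y = val \<Delta>s \<nu> y"
            using a y unfolding agree_def by blast+
          then show ?thesis using w' False by simp
        qed (simp add: w')
        then show ?thesis using w' by (intro exI[of _ \<omega>']) (simp add: agree_def)
      qed
      then have "FVp \<Delta>h p = {}" using Havoc by (auto simp: FVp_def)
      moreover have "BVp \<Delta>h p \<subseteq> {v}" using Havoc by (auto simp: BVp_def agree_def)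
      ultimately show ?thesis using finite_subset by (auto simp: Vars_def)
    qed
    show "(\<mu>', \<omega>) \<in> prog_rel \<Delta>h p" if "agree \<Delta>h UNIV \<mu> \<mu>'" "(\<mu>, \<omega>) \<in> prog_rel \<Delta>h p" for \<mu> \<mu>' \<omega>
    proof (cases p)
      case (Prog r)
      then show ?thesis using p that c0.ext_q[of _ \<mu> \<mu>' \<omega>] c1.ext_q[of _ \<mu> \<mu>' \<omega>]
        by (cases r) (auto simp del: simple_het_simps(11,12))
    next
      case (Havoc v)
      then show ?thesis using that by (simp add: agree_def)
    qed
  qed
  then interpret regular_calculus_convergence \<Delta>h Ax R \<Gamma> "nat_data_havoc N"
  proof (intro regular_calculus_convergence.intro regular_calculus_convergence_axioms.intro)
    show "sequence_coding (regular \<Delta>h) (u2n (nat_data_havoc N)) (nat_vars (nat_data_havoc N))"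
      using sequence_coding_N by (simp add: nat_data_havoc_def)
    show "F \<in> convergence_axioms \<Delta>h (nat_data_havoc N) \<Longrightarrow> F \<in> Ax" for F by (simp add: Ax_def)
  qed (use nat_formulas in \<open>auto simp: nat_data_havoc_def\<close>)
  interpret c0: component_calculus "regular \<Delta>h" \<Delta>0 Inl Atom0 "\<lambda>p. Base (Prog (Inl p))" fst Ax R \<Gamma>
    by unfold_locales
      (use derives_emb0 fol(1) support(1) in \<open>simp_all add: emb_hero0 \<Gamma>_def flip: calc\<close>)
  interpret c1: component_calculus "regular \<Delta>h" \<Delta>1 Inr Atom1 "\<lambda>p. Base (Prog (Inr p))" snd Ax R \<Gamma>
    by unfold_locales
      (use derives_emb1 fol(2) support(2) in \<open>simp_all add: emb_hero1 \<Gamma>_def flip: calc\<close>)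
  have base: "box_reducible (Base p)" if p: "p \<in> progs \<Delta>h" for p
  proof (cases p)
    case (Prog r)
    then show ?thesis using p c0.box_reducible_component c1.box_reducible_component by auto
  next
    case (Havoc v)
    \<comment> \<open>Havoc on \<open>v\<close> has the transitions of the quantifier over
      \<open>v\<close>, so no rendition is involved.\<close>
    show ?thesis
      unfolding box_reducible_def Havoc
    proof (intro allI impI exI conjI)
      fix F assume F: "fo_fml (regular \<Delta>h) F"
      show "fo_fml (regular \<Delta>h) (All v F)" using F by (simp add: fo_fml_def)
      show "sat (regular \<Delta>h) \<mu> (All v F) = sat (regular \<Delta>h) \<mu> (Box (Base (Havoc v)) F)" for \<mu> by simp
      show "prv (Iff (Box (Base (Havoc v)) F) (All v F))" using derives_havoc[OF F] calc by simp
    qed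
  qed
  show ?thesis
    unfolding relatively_complete_def hero_def calc
  proof (intro allI impI, elim conjE)
    fix F assume F: "wf_fml (regular \<Delta>h) F" "valid (regular \<Delta>h) F"
    have "prv F" by (rule relative_completeness[OF _ F]) (use box_reducible_regular base in simp)
    then show "derives (regular \<Delta>h) Ax R {G. fo_fml (regular \<Delta>h) G \<and> valid (regular \<Delta>h) G} F"
      by (simp add: \<Gamma>_def)
  qed
qed

end

theorem mainTheorem19:
  fixes \<Delta>0 :: "('v0, 'a0, 'p0, 'u, 's0) dyn_theory"
    and \<Delta>1 :: "('v1, 'a1, 'p1, 'u, 's1) dyn_theory"
    and C0 :: "('v0, 'a0, 'p0) calculus"
    and C1 :: "('v1, 'a1, 'p1) calculus"
    and N0 :: "('v0, 'a0, 'p0, 'u) nat_data"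
    and N1 :: "('v1, 'a1, 'p1, 'u) nat_data"
    and H :: "('v0, 'v1, 'c, 's0, 's1) het_atoms"
    and N :: "('v0 + 'v1, ('a0, 'a1, 'c) het_atom, 'p0 + 'p1, 'u) nat_data"
  assumes "dynamic_theory \<Delta>0" and "dynamic_theory \<Delta>1"
    and "finite_support \<Delta>0" and "finite_support \<Delta>1"
    and "relatively_complete \<Delta>0 C0" and "relatively_complete \<Delta>1 C1"
    and "fol_expressive \<Delta>0" and "fol_expressive \<Delta>1"
    and "goedel_expressive \<Delta>0 N0" and "goedel_expressive \<Delta>1 N1"
    and "het_atoms_ok \<Delta>0 \<Delta>1 H"
    and "communicating \<Delta>0 N0 \<Delta>1 N1 H"
    and "N = nat_data0 N0 \<or> N = nat_data1 N1"
  shows "relatively_complete (hero \<Delta>0 \<Delta>1 H) (hero_calculus \<Delta>0 C0 \<Delta>1 C1 H N)"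
  by (rule hero_setting.hero_relatively_complete, rule hero_setting.intro) (rule assms)+

end
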